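(* Let $\Gamma$ be a discrete group with Kazhdan's property (T), and let $\{\Gamma_\alpha\}_{\alpha\in I}$ be an uncountable family of pairwise non-isomorphic quotient groups of $\Gamma$, each of which is simple and ICC. Let $\mathcal{C}=\{C^*\Gamma_\alpha : \alpha\in I\}$ or $\mathcal{C}=\{C^*_{\mathrm{red}}\Gamma_\alpha : \alpha\in I\}$. Then there is no separable $C^*$-algebra which is complementary universal for $\mathcal{C}$.
   Context: A discrete group $\Gamma$ has Kazhdan's property (T) if the trivial representation is isolated in the dual $\hat{\Gamma}$ equipped with the Fell topology. A group is ICC (infinite conjugacy classes) if every conjugacy class other than that of the identity is infinite. For a discrete group $\Delta$, $C^*\Delta$ denotes its full group $C^*$-algebra and $C^*_{\mathrm{red}}\Delta$ its reduced group $C^*$-algebra. One works in the category of unital $C^*$-algebras and unital completely positive maps. A (unital) $C^*$-algebra $A$ is complementary universal for a class $\mathcal{C}$ of (unital) $C^*$-algebras if for every member $B$ of $\mathcal{C}$ there are unital completely positive maps $\psi\colon B\to A$ and $\varphi\colon A\to B$ such that $\varphi\psi=\mathrm{id}_B$. "Pairwise non-isomorphic" means that $\Gamma_\alpha\not\cong\Gamma_\beta$ as groups for $\alpha\neq\beta$ in the (uncountable) index set $I$. The theorem asserts the conclusion for each of the two choices of $\mathcal{C}$. *)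

theory Defs
  imports "HOL-Analysis.Analysis" "HOL-Algebra.Algebraic_Closure_Type"
begin

section \<open>Groups\<close>

text \<open>
  The locale \<open>simple_group\<close> of HOL-Algebra demands \<open>order G > 1\<close>; as \<open>order\<close> is a cardinality
  in \<open>nat\<close>, this excludes all infinite groups. The following notion has no such restriction.
\<close>

definition simple_grp :: "('g, 'm) monoid_scheme \<Rightarrow> bool" where
  "simple_grp G \<longleftrightarrow> group G \<and> carrier G \<noteq> {\<one>\<^bsub>G\<^esub>} \<and>
     (\<forall>H. H \<lhd> G \<longrightarrow> H = carrier G \<or> H = {\<one>\<^bsub>G\<^esub>})"

definition conj_class :: "('g, 'm) monoid_scheme \<Rightarrow> 'g \<Rightarrow> 'g set" where
  "conj_class G g = {h \<otimes>\<^bsub>G\<^esub> g \<otimes>\<^bsub>G\<^esub> inv\<^bsub>G\<^esub> h | h. h \<in> carrier G}"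

definition icc :: "('g, 'm) monoid_scheme \<Rightarrow> bool" where
  "icc G \<longleftrightarrow> (\<forall>g\<in>carrier G. g \<noteq> \<one>\<^bsub>G\<^esub> \<longrightarrow> infinite (conj_class G g))"


section \<open>Complex Hilbert spaces\<close>

abbreviation complex_ring :: "complex ring" where
  "complex_ring \<equiv> ring_of_type_algebra"

definition complex_linear_map ::
    "(complex, 'a, 'm) module_scheme \<Rightarrow> (complex, 'b, 'n) module_scheme \<Rightarrow> ('a \<Rightarrow> 'b) \<Rightarrow> bool" where
  "complex_linear_map M N T \<longleftrightarrow> T \<in> carrier M \<rightarrow> carrier N \<and>
     (\<forall>x\<in>carrier M. \<forall>y\<in>carrier M. T (x \<oplus>\<^bsub>M\<^esub> y) = T x \<oplus>\<^bsub>N\<^esub> T y) \<and>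
     (\<forall>a. \<forall>x\<in>carrier M. T (a \<odot>\<^bsub>M\<^esub> x) = a \<odot>\<^bsub>N\<^esub> T x)"

text \<open>
  The ring fields \<open>mult\<close> and \<open>one\<close> which \<open>module\<close> inherits play no role for inner product spaces.
\<close>

record 'v inner_space = "(complex, 'v) module" +
  ip :: "'v \<Rightarrow> 'v \<Rightarrow> complex"

definition hnorm :: "'v inner_space \<Rightarrow> 'v \<Rightarrow> real" where
  "hnorm H x = sqrt (Re (ip H x x))"

text \<open>
  The locale \<open>Metric_space\<close> demands symmetry and non-negativity on the whole type, hence the
  guard here and in \<open>adist\<close> below.
\<close>

definition hdist :: "'v inner_space \<Rightarrow> 'v \<Rightarrow> 'v \<Rightarrow> real" where
  "hdist H x y = (if x \<in> carrier H \<and> y \<in> carrier H then hnorm H (x \<ominus>\<^bsub>H\<^esub> y) else 0)"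

locale hilbert_space = module complex_ring H for H :: "'v inner_space" (structure) +
  assumes ip_add_left: "\<lbrakk>x \<in> carrier H; y \<in> carrier H; z \<in> carrier H\<rbrakk>
      \<Longrightarrow> ip H (x \<oplus> y) z = ip H x z + ip H y z"
    and ip_smult_left: "\<lbrakk>x \<in> carrier H; y \<in> carrier H\<rbrakk> \<Longrightarrow> ip H (a \<odot> x) y = a * ip H x y"
    and ip_commute: "\<lbrakk>x \<in> carrier H; y \<in> carrier H\<rbrakk> \<Longrightarrow> ip H y x = cnj (ip H x y)"
    and ip_pos: "\<lbrakk>x \<in> carrier H; x \<noteq> \<zero>\<rbrakk> \<Longrightarrow> 0 < Re (ip H x x)"
    and complete: "Metric_space.mcomplete (carrier H) (hdist H)"

definition op_norm :: "'v inner_space \<Rightarrow> ('v \<Rightarrow> 'v) \<Rightarrow> real" where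
  "op_norm H T = (SUP x\<in>{x \<in> carrier H. hnorm H x \<le> 1}. hnorm H (T x))"

definition unitary_map :: "'v inner_space \<Rightarrow> 'w inner_space \<Rightarrow> ('v \<Rightarrow> 'w) \<Rightarrow> bool" where
  "unitary_map H K U \<longleftrightarrow> complex_linear_map H K U \<and> bij_betw U (carrier H) (carrier K) \<and>
     (\<forall>x\<in>carrier H. \<forall>y\<in>carrier H. ip K (U x) (U y) = ip H x y)"

definition complex_line :: "complex inner_space" where
  "complex_line = \<lparr>carrier = UNIV, monoid.mult = undefined, one = undefined, ring.zero = 0, add = (+),
     smult = (*), ip = (\<lambda>x y. x * cnj y)\<rparr>"

definition l2_space :: "'g set \<Rightarrow> ('g \<Rightarrow> complex) inner_space" where
  "l2_space S = \<lparr>carrier = {\<xi>. (\<forall>x. x \<notin> S \<longrightarrow> \<xi> x = 0) \<and> (\<lambda>x. (cmod (\<xi> x))\<^sup>2) summable_on S},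
     monoid.mult = undefined, one = undefined, ring.zero = (\<lambda>x. 0), add = (\<lambda>\<xi> \<eta> x. \<xi> x + \<eta> x),
     smult = (\<lambda>a \<xi> x. a * \<xi> x), ip = (\<lambda>\<xi> \<eta>. \<Sum>\<^sub>\<infinity>x\<in>S. \<xi> x * cnj (\<eta> x))\<rparr>"


section \<open>Unitary representations, the Fell topology and property (T)\<close>

type_synonym ('g, 'v) rep = "'v inner_space \<times> ('g \<Rightarrow> 'v \<Rightarrow> 'v)"

definition unitary_rep :: "('g, 'm) monoid_scheme \<Rightarrow> ('g, 'v) rep \<Rightarrow> bool" where
  "unitary_rep G = (\<lambda>(H, \<pi>). hilbert_space H \<and>
     (\<forall>g\<in>carrier G. unitary_map H H (\<pi> g)) \<and>
     (\<forall>x\<in>carrier H. \<pi> \<one>\<^bsub>G\<^esub> x = x) \<and>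
     (\<forall>g\<in>carrier G. \<forall>h\<in>carrier G. \<forall>x\<in>carrier H. \<pi> (g \<otimes>\<^bsub>G\<^esub> h) x = \<pi> g (\<pi> h x)))"

definition unitarily_equivalent ::
    "('g, 'm) monoid_scheme \<Rightarrow> ('g, 'v) rep \<Rightarrow> ('g, 'w) rep \<Rightarrow> bool" where
  "unitarily_equivalent G = (\<lambda>(H, \<pi>) (K, \<sigma>). \<exists>U. unitary_map H K U \<and>
     (\<forall>g\<in>carrier G. \<forall>x\<in>carrier H. U (\<pi> g x) = \<sigma> g (U x)))"

definition irreducible_rep :: "('g, 'm) monoid_scheme \<Rightarrow> ('g, 'v) rep \<Rightarrow> bool" where
  "irreducible_rep G = (\<lambda>(H, \<pi>). unitary_rep G (H, \<pi>) \<and> carrier H \<noteq> {\<zero>\<^bsub>H\<^esub>} \<and>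
     (\<forall>W. submodule W complex_ring H \<and>
          closedin (Metric_space.mtopology (carrier H) (hdist H)) W \<and>
          (\<forall>g\<in>carrier G. \<pi> g ` W \<subseteq> W) \<longrightarrow> W = {\<zero>\<^bsub>H\<^esub>} \<or> W = carrier H))"

text \<open>
  The dual has to be formed from Hilbert spaces living on one fixed type. The type
  \<open>'g \<Rightarrow> complex\<close> suffices: if \<open>\<xi>\<close> is a cyclic vector of a unitary representation \<open>\<pi>\<close> of \<open>G\<close>,
  then mapping \<open>\<eta>\<close> to the function \<open>g \<mapsto> \<langle>\<eta>, \<pi>(g) \<xi>\<rangle>\<close> (zero off \<open>carrier G\<close>) is injective and
  transports the representation to this type. In particular every irreducible unitary
  representation of \<open>G\<close> is unitarily equivalent to a member of \<open>irreps G\<close>.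
\<close>

definition irreps :: "('g, 'm) monoid_scheme \<Rightarrow> ('g, 'g \<Rightarrow> complex) rep set" where
  "irreps G = {\<rho>. irreducible_rep G \<rho>}"

definition unitary_dual :: "('g, 'm) monoid_scheme \<Rightarrow> ('g, 'g \<Rightarrow> complex) rep set set" where
  "unitary_dual G =
     irreps G // {(\<rho>, \<sigma>). \<rho> \<in> irreps G \<and> \<sigma> \<in> irreps G \<and> unitarily_equivalent G \<rho> \<sigma>}"

definition trivial_class :: "('g, 'm) monoid_scheme \<Rightarrow> ('g, 'g \<Rightarrow> complex) rep set" where
  "trivial_class G = {\<rho> \<in> irreps G. unitarily_equivalent G (complex_line, \<lambda>g z. z) \<rho>}"

text \<open>The functions of positive type associated with a representation.\<close>

definition diag_coeffs :: "('g, 'v) rep \<Rightarrow> ('g \<Rightarrow> complex) set" where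
  "diag_coeffs = (\<lambda>(H, \<pi>). {(\<lambda>g. ip H (\<pi> g \<xi>) \<xi>) | \<xi>. \<xi> \<in> carrier H})"

definition fell_nbhd :: "('g, 'm) monoid_scheme \<Rightarrow> ('g \<Rightarrow> complex) set \<Rightarrow> 'g set \<Rightarrow> real
    \<Rightarrow> ('g, 'g \<Rightarrow> complex) rep set set" where
  "fell_nbhd G \<Phi> Q \<epsilon> = {c \<in> unitary_dual G. \<forall>\<sigma>\<in>c. \<forall>\<phi>\<in>\<Phi>.
     \<exists>\<psi>s. set \<psi>s \<subseteq> diag_coeffs \<sigma> \<and> (\<forall>g\<in>Q. cmod (\<phi> g - (\<Sum>\<psi>\<leftarrow>\<psi>s. \<psi> g)) < \<epsilon>)}"

text \<open>
  The sets below form a basis of the Fell topology. As \<open>G\<close> is discrete, its compact subsets \<open>Q\<close>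
  are the finite ones.
\<close>

definition fell_topology :: "('g, 'm) monoid_scheme \<Rightarrow> ('g, 'g \<Rightarrow> complex) rep set topology" where
  "fell_topology G = topology_generated_by
     {fell_nbhd G \<Phi> Q \<epsilon> | \<Phi> Q \<epsilon>. (\<exists>\<rho>\<in>irreps G. \<Phi> \<subseteq> diag_coeffs \<rho>) \<and> finite \<Phi> \<and>
        Q \<subseteq> carrier G \<and> finite Q \<and> \<epsilon> > 0}"

definition property_T :: "('g, 'm) monoid_scheme \<Rightarrow> bool" where
  "property_T G \<longleftrightarrow> openin (fell_topology G) {trivial_class G}"


section \<open>Unital C*-algebras\<close>

record 'a normed_star_algebra = "(complex, 'a) module" +
  adj :: "'a \<Rightarrow> 'a"
  anorm :: "'a \<Rightarrow> real"

definition adist :: "'a normed_star_algebra \<Rightarrow> 'a \<Rightarrow> 'a \<Rightarrow> real" where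
  "adist A x y = (if x \<in> carrier A \<and> y \<in> carrier A then anorm A (x \<ominus>\<^bsub>A\<^esub> y) else 0)"

locale unital_cstar_algebra = ring A + module complex_ring A
  for A :: "'a normed_star_algebra" (structure) +
  assumes smult_mult_left: "\<lbrakk>x \<in> carrier A; y \<in> carrier A\<rbrakk> \<Longrightarrow> (a \<odot> x) \<otimes> y = a \<odot> (x \<otimes> y)"
    and smult_mult_right: "\<lbrakk>x \<in> carrier A; y \<in> carrier A\<rbrakk> \<Longrightarrow> x \<otimes> (a \<odot> y) = a \<odot> (x \<otimes> y)"
    and adj_closed: "x \<in> carrier A \<Longrightarrow> adj A x \<in> carrier A"
    and adj_adj: "x \<in> carrier A \<Longrightarrow> adj A (adj A x) = x"
    and adj_add: "\<lbrakk>x \<in> carrier A; y \<in> carrier A\<rbrakk> \<Longrightarrow> adj A (x \<oplus> y) = adj A x \<oplus> adj A y"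
    and adj_smult: "x \<in> carrier A \<Longrightarrow> adj A (a \<odot> x) = cnj a \<odot> adj A x"
    and adj_mult: "\<lbrakk>x \<in> carrier A; y \<in> carrier A\<rbrakk> \<Longrightarrow> adj A (x \<otimes> y) = adj A y \<otimes> adj A x"
    and anorm_eq_0: "x \<in> carrier A \<Longrightarrow> anorm A x = 0 \<longleftrightarrow> x = \<zero>"
    and anorm_triangle: "\<lbrakk>x \<in> carrier A; y \<in> carrier A\<rbrakk> \<Longrightarrow> anorm A (x \<oplus> y) \<le> anorm A x + anorm A y"
    and anorm_smult: "x \<in> carrier A \<Longrightarrow> anorm A (a \<odot> x) = cmod a * anorm A x"
    and anorm_mult: "\<lbrakk>x \<in> carrier A; y \<in> carrier A\<rbrakk> \<Longrightarrow> anorm A (x \<otimes> y) \<le> anorm A x * anorm A y"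
    and cstar_identity: "x \<in> carrier A \<Longrightarrow> anorm A (adj A x \<otimes> x) = (anorm A x)\<^sup>2"
    and complete: "Metric_space.mcomplete (carrier A) (adist A)"

definition separable_algebra :: "'a normed_star_algebra \<Rightarrow> bool" where
  "separable_algebra A \<longleftrightarrow> separable_space (Metric_space.mtopology (carrier A) (adist A))"

text \<open>
  Elements of the algebra of \<open>n \<times> n\<close> matrices over \<open>A\<close> are represented by functions of two
  indices below \<open>n\<close>; such a matrix is positive if it is of the form \<open>Y\<^sup>* Y\<close>.
\<close>

definition positive_matrix :: "'a normed_star_algebra \<Rightarrow> nat \<Rightarrow> (nat \<Rightarrow> nat \<Rightarrow> 'a) \<Rightarrow> bool" where
  "positive_matrix A n M \<longleftrightarrow> (\<exists>Y. (\<forall>i<n. \<forall>j<n. Y i j \<in> carrier A) \<and>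
     (\<forall>i<n. \<forall>j<n. M i j = (\<Oplus>\<^bsub>A\<^esub>k\<in>{..<n}. adj A (Y k i) \<otimes>\<^bsub>A\<^esub> Y k j)))"

definition ucp :: "'a normed_star_algebra \<Rightarrow> 'b normed_star_algebra \<Rightarrow> ('a \<Rightarrow> 'b) \<Rightarrow> bool" where
  "ucp A B \<phi> \<longleftrightarrow> complex_linear_map A B \<phi> \<and> \<phi> \<one>\<^bsub>A\<^esub> = \<one>\<^bsub>B\<^esub> \<and>
     (\<forall>n M. positive_matrix A n M \<longrightarrow> positive_matrix B n (\<lambda>i j. \<phi> (M i j)))"

definition complementary_universal ::
    "'a normed_star_algebra \<Rightarrow> 'b normed_star_algebra set \<Rightarrow> bool" where
  "complementary_universal A \<C> \<longleftrightarrow> unital_cstar_algebra A \<and>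
     (\<forall>B\<in>\<C>. \<exists>\<psi> \<phi>. ucp B A \<psi> \<and> ucp A B \<phi> \<and> (\<forall>b\<in>carrier B. \<phi> (\<psi> b) = b))"


section \<open>Completion of a seminormed *-algebra\<close>

definition cauchy_seqs :: "'a normed_star_algebra \<Rightarrow> (nat \<Rightarrow> 'a) set" where
  "cauchy_seqs P = {\<sigma>. Metric_space.MCauchy (carrier P) (adist P) \<sigma>}"

definition null_rel :: "'a normed_star_algebra \<Rightarrow> ((nat \<Rightarrow> 'a) \<times> (nat \<Rightarrow> 'a)) set" where
  "null_rel P = {(\<sigma>, \<tau>). \<sigma> \<in> cauchy_seqs P \<and> \<tau> \<in> cauchy_seqs P \<and>
     (\<lambda>n. adist P (\<sigma> n) (\<tau> n)) \<longlonglongrightarrow> 0}"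

definition completion :: "'a normed_star_algebra \<Rightarrow> (nat \<Rightarrow> 'a) set normed_star_algebra" where
  "completion P = \<lparr>carrier = cauchy_seqs P // null_rel P,
     monoid.mult = (\<lambda>c d. \<Union>\<sigma>\<in>c. \<Union>\<tau>\<in>d. null_rel P `` {\<lambda>n. \<sigma> n \<otimes>\<^bsub>P\<^esub> \<tau> n}),
     one = null_rel P `` {\<lambda>n. \<one>\<^bsub>P\<^esub>},
     ring.zero = null_rel P `` {\<lambda>n. \<zero>\<^bsub>P\<^esub>},
     add = (\<lambda>c d. \<Union>\<sigma>\<in>c. \<Union>\<tau>\<in>d. null_rel P `` {\<lambda>n. \<sigma> n \<oplus>\<^bsub>P\<^esub> \<tau> n}),
     smult = (\<lambda>a c. \<Union>\<sigma>\<in>c. null_rel P `` {\<lambda>n. a \<odot>\<^bsub>P\<^esub> \<sigma> n}),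
     adj = (\<lambda>c. \<Union>\<sigma>\<in>c. null_rel P `` {\<lambda>n. adj P (\<sigma> n)}),
     anorm = (\<lambda>c. THE r. \<forall>\<sigma>\<in>c. (\<lambda>n. anorm P (\<sigma> n)) \<longlonglongrightarrow> r)\<rparr>"


section \<open>Group C*-algebras\<close>

text \<open>The complex group algebra, convolution being its product, with a prescribed norm \<open>N\<close>.\<close>

definition group_algebra ::
    "('g, 'm) monoid_scheme \<Rightarrow> (('g \<Rightarrow> complex) \<Rightarrow> real) \<Rightarrow> ('g \<Rightarrow> complex) normed_star_algebra" where
  "group_algebra G N = \<lparr>carrier = {f. finite {x. f x \<noteq> 0} \<and> {x. f x \<noteq> 0} \<subseteq> carrier G},
     monoid.mult = (\<lambda>f h x. if x \<in> carrier G
       then \<Sum>y | f y \<noteq> 0. f y * h (inv\<^bsub>G\<^esub> y \<otimes>\<^bsub>G\<^esub> x) else 0),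
     one = (\<lambda>x. if x = \<one>\<^bsub>G\<^esub> then 1 else 0),
     ring.zero = (\<lambda>x. 0),
     add = (\<lambda>f h x. f x + h x),
     smult = (\<lambda>a f x. a * f x),
     adj = (\<lambda>f x. if x \<in> carrier G then cnj (f (inv\<^bsub>G\<^esub> x)) else 0),
     anorm = N\<rparr>"

text \<open>The extension of a unitary representation to the group algebra.\<close>

definition rep_ext :: "('g, 'v) rep \<Rightarrow> ('g \<Rightarrow> complex) \<Rightarrow> 'v \<Rightarrow> 'v" where
  "rep_ext = (\<lambda>(H, \<pi>) f \<xi>. \<Oplus>\<^bsub>H\<^esub>g\<in>{g. f g \<noteq> 0}. f g \<odot>\<^bsub>H\<^esub> \<pi> g \<xi>)"

text \<open>
  The full norm is the supremum over all unitary representations. It equals the supremum over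
  the cyclic ones, so that it suffices to consider Hilbert spaces on the type
  \<open>'g \<Rightarrow> complex\<close>, as for \<open>irreps\<close>.
\<close>

definition full_norm :: "('g, 'm) monoid_scheme \<Rightarrow> ('g \<Rightarrow> complex) \<Rightarrow> real" where
  "full_norm G f = (SUP \<rho> \<in> {\<rho> :: ('g, 'g \<Rightarrow> complex) rep. unitary_rep G \<rho>}.
     op_norm (fst \<rho>) (rep_ext \<rho> f))"

definition left_regular :: "('g, 'm) monoid_scheme \<Rightarrow> ('g, 'g \<Rightarrow> complex) rep" where
  "left_regular G = (l2_space (carrier G),
     \<lambda>g \<xi> x. if x \<in> carrier G then \<xi> (inv\<^bsub>G\<^esub> g \<otimes>\<^bsub>G\<^esub> x) else 0)"

definition reduced_norm :: "('g, 'm) monoid_scheme \<Rightarrow> ('g \<Rightarrow> complex) \<Rightarrow> real" where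
  "reduced_norm G f = op_norm (l2_space (carrier G)) (rep_ext (left_regular G) f)"

definition full_group_cstar ::
    "('g, 'm) monoid_scheme \<Rightarrow> (nat \<Rightarrow> 'g \<Rightarrow> complex) set normed_star_algebra" where
  "full_group_cstar G = completion (group_algebra G (full_norm G))"

definition reduced_group_cstar ::
    "('g, 'm) monoid_scheme \<Rightarrow> (nat \<Rightarrow> 'g \<Rightarrow> complex) set normed_star_algebra" where
  "reduced_group_cstar G = completion (group_algebra G (reduced_norm G))"

end

theory Submission
  imports Defs
begin

text \<open>
  Let \<open>\<psi>\<^sub>\<alpha>\<close>, \<open>\<phi>\<^sub>\<alpha>\<close> be the maps between the group C*-algebra \<open>B\<^sub>\<alpha>\<close> of \<open>\<Gamma> / N\<^sub>\<alpha>\<close> and a separable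
  complementary universal algebra \<open>A\<close>, let \<open>u\<^sub>\<alpha> s \<in> B\<^sub>\<alpha>\<close> be the unitary of \<open>s \<in> \<Gamma>\<close>, and let \<open>Q\<close> be a finite
  Kazhdan set of \<open>\<Gamma>\<close>. As \<open>A\<close> is separable and \<open>I\<close> is uncountable, there are \<open>\<alpha> \<noteq> \<beta>\<close> such that
  \<open>\<psi>\<^sub>\<alpha> (u\<^sub>\<alpha> s)\<close> and \<open>\<psi>\<^sub>\<beta> (u\<^sub>\<beta> s)\<close> are close for all \<open>s \<in> Q\<close>. The function \<open>f\<close> sending \<open>s\<close> to the coefficient
  of \<open>\<phi>\<^sub>\<alpha> (\<psi>\<^sub>\<beta> (u\<^sub>\<beta> s))\<close> at the coset \<open>s N\<^sub>\<alpha>\<close> is of positive type, by complete positivity, and is close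
  to \<open>1\<close> on \<open>Q\<close>, because \<open>\<phi>\<^sub>\<alpha> (\<psi>\<^sub>\<alpha> (u\<^sub>\<alpha> s)) = u\<^sub>\<alpha> s\<close>. By property (T) it is close to \<open>1\<close> on all of \<open>\<Gamma>\<close>. But on
  \<open>N\<^sub>\<beta>\<close> it is the indicator function of \<open>N\<^sub>\<alpha>\<close>; hence \<open>N\<^sub>\<beta> \<subseteq> N\<^sub>\<alpha>\<close>, and by symmetry \<open>N\<^sub>\<alpha> = N\<^sub>\<beta>\<close>.

  To obtain a Kazhdan set from the definition of (T) by irreducible representations, one uses that a
  continuous affine functional on the compact convex set of normalized functions of positive type
  attains its minimum at an extreme point, and that the GNS representation of an extreme point is
  irreducible.
\<close>

section \<open>Inner product spaces\<close>

text \<open>Being close to 1 on \<open>Q\<close> says something at once only about extreme functions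
  of positive type. An inequality that is affine in the function passes from extreme points to all
  others, so property (T) enters as a linear inequality between the numbers
  \<open>1 - Re (\<phi> s)\<close>. The group C*-algebras are seen only through their coefficient
  functionals. These are continuous for the full and the reduced norm alike, since both dominate the
  operator norm in the left regular representation; one argument thus serves both cases. Positive
  type of \<open>f\<close> comes from the matrix of unitaries at
  \<open>h\<^sub>i\<^sup>-\<^sup>1 h\<^sub>j\<close>, which has the form \<open>Y\<^sup>* Y\<close>
  and therefore stays positive under the two maps. Closeness to 1 on \<open>Q\<close> requires the
  coefficients of \<open>\<phi>\<^sub>\<alpha>\<close> to be continuous; this is extracted from
  positivity, because \<open>1 - y\<close> is a square for self-adjoint \<open>y\<close> of norm
  below 1, and the same holds for \<open>- y\<close>. For \<open>s\<close> in
  \<open>N\<^sub>\<beta>\<close> the unitary \<open>u\<^sub>\<beta> s\<close> is 1 and both maps are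
  unital, so \<open>f s\<close> is a coefficient of 1, which is 0 or 1; a positive real part
  excludes 0.\<close>

lemma complex_ring_simps [simp]:
  "carrier complex_ring = UNIV" "\<one>\<^bsub>complex_ring\<^esub> = 1" "\<zero>\<^bsub>complex_ring\<^esub> = 0"
  "a \<oplus>\<^bsub>complex_ring\<^esub> b = a + b" "a \<otimes>\<^bsub>complex_ring\<^esub> b = a * b"
  by (simp_all add: ring_of_type_algebra_def)

section \<open>Complex vector spaces of functions\<close>

lemma complex_module_uminus:
  assumes "module complex_ring M" "x \<in> carrier M"
  shows "\<ominus>\<^bsub>M\<^esub> x = (-1) \<odot>\<^bsub>M\<^esub> x"
proof -
  interpret M: module complex_ring M by fact
  have "(-1) \<odot>\<^bsub>M\<^esub> x \<oplus>\<^bsub>M\<^esub> x = (-1 + 1) \<odot>\<^bsub>M\<^esub> x"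
    using assms M.smult_l_distr[of "-1" 1 x] M.smult_one[of x] by simp
  also have "\<dots> = \<zero>\<^bsub>M\<^esub>"
    using assms M.smult_l_null[of x] by simp
  finally show ?thesis
    using assms M.smult_closed[of "-1" x] by (intro M.minus_equality) auto
qed

text \<open>Finitely supported functions, \<open>rkhs\<close>, \<open>l2_space\<close> and the group
  algebra all have pointwise operations; with this rule only closure of the carrier remains to be
  shown for each of them.\<close>

lemma function_module:
  fixes H :: "(complex, 'x \<Rightarrow> complex, 'm) module_scheme"
  assumes [simp]: "zero H = (\<lambda>x. 0)" "add H = (\<lambda>f h x. f x + h x)" "smult H = (\<lambda>a f x. a * f x)"
    and z: "(\<lambda>x. 0) \<in> carrier H"
    and a: "\<And>f h. \<lbrakk>f \<in> carrier H; h \<in> carrier H\<rbrakk> \<Longrightarrow> (\<lambda>x. f x + h x) \<in> carrier H"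
    and s: "\<And>a f. f \<in> carrier H \<Longrightarrow> (\<lambda>x. a * f x) \<in> carrier H"
  shows "module complex_ring H"
proof (rule moduleI)
  show "abelian_group H"
  proof (rule abelian_groupI)
    fix f assume "f \<in> carrier H"
    then show "\<exists>y\<in>carrier H. y \<oplus>\<^bsub>H\<^esub> f = \<zero>\<^bsub>H\<^esub>"
      using s[of f "-1"] by (intro bexI[of _ "\<lambda>x. - f x"]) auto
  qed (use z a in \<open>auto simp: algebra_simps\<close>)
qed (use s in \<open>auto simp: algebra_simps\<close>)

lemma function_module_minus:
  fixes H :: "(complex, 'x \<Rightarrow> complex, 'm) module_scheme"
  assumes "module complex_ring H" "add H = (\<lambda>f h x. f x + h x)" "smult H = (\<lambda>a f x. a * f x)"
    and "f \<in> carrier H" "h \<in> carrier H"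
  shows "f \<ominus>\<^bsub>H\<^esub> h = (\<lambda>x. f x - h x)"
  using complex_module_uminus[OF assms(1,5)] assms by (simp add: a_minus_def)

text \<open>Definiteness is relaxed to nonnegativity because the form that a kernel induces on
  finitely supported functions may have nonzero null vectors, and Cauchy-Schwarz is wanted there
  already, before completion.\<close>

locale semi_inner_space = module complex_ring H for H :: "'v inner_space" (structure) +
  assumes ip_add_left: "\<lbrakk>x \<in> carrier H; y \<in> carrier H; z \<in> carrier H\<rbrakk>
      \<Longrightarrow> ip H (x \<oplus> y) z = ip H x z + ip H y z"
    and ip_smult_left: "\<lbrakk>x \<in> carrier H; y \<in> carrier H\<rbrakk> \<Longrightarrow> ip H (a \<odot> x) y = a * ip H x y"
    and ip_commute: "\<lbrakk>x \<in> carrier H; y \<in> carrier H\<rbrakk> \<Longrightarrow> ip H y x = cnj (ip H x y)"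
    and ip_nonneg: "x \<in> carrier H \<Longrightarrow> 0 \<le> Re (ip H x x)"
begin

section \<open>Calculus of semi-inner products\<close>

lemma ip_add_right:
  "\<lbrakk>x \<in> carrier H; y \<in> carrier H; z \<in> carrier H\<rbrakk> \<Longrightarrow> ip H x (y \<oplus> z) = ip H x y + ip H x z"
  using ip_commute[of "y \<oplus> z" x] ip_commute[of y x] ip_commute[of z x]
  by (simp add: ip_add_left)

lemma ip_smult_right:
  "\<lbrakk>x \<in> carrier H; y \<in> carrier H\<rbrakk> \<Longrightarrow> ip H x (a \<odot> y) = cnj a * ip H x y"
  using ip_commute[of "a \<odot> y" x] ip_commute[of y x] by (simp add: ip_smult_left)

lemma ip_zero_left: "y \<in> carrier H \<Longrightarrow> ip H \<zero> y = 0"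
  using ip_smult_left[of \<zero> y 0] by simp

lemma ip_zero_right: "y \<in> carrier H \<Longrightarrow> ip H y \<zero> = 0"
  using ip_smult_right[of y \<zero> 0] by simp

lemma diff_eq: "\<lbrakk>x \<in> carrier H; y \<in> carrier H\<rbrakk> \<Longrightarrow> x \<ominus> y = x \<oplus> (-1) \<odot> y"
  by (simp add: a_minus_def complex_module_uminus[OF module_axioms])

lemma ip_diff_left:
  "\<lbrakk>x \<in> carrier H; y \<in> carrier H; z \<in> carrier H\<rbrakk> \<Longrightarrow> ip H (x \<ominus> y) z = ip H x z - ip H y z"
  by (simp add: diff_eq ip_add_left ip_smult_left)

lemma ip_diff_right:
  "\<lbrakk>x \<in> carrier H; y \<in> carrier H; z \<in> carrier H\<rbrakk> \<Longrightarrow> ip H x (y \<ominus> z) = ip H x y - ip H x z"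
  by (simp add: diff_eq ip_add_right ip_smult_right)

lemma ip_self: "x \<in> carrier H \<Longrightarrow> ip H x x = of_real ((hnorm H x)\<^sup>2)"
  using ip_commute[of x x] ip_nonneg[of x]
  by (simp add: hnorm_def complex_eq_iff)

lemma hnorm_nonneg: "x \<in> carrier H \<Longrightarrow> 0 \<le> hnorm H x"
  using ip_nonneg by (simp add: hnorm_def)

lemma hnorm_power2: "x \<in> carrier H \<Longrightarrow> (hnorm H x)\<^sup>2 = Re (ip H x x)"
  using ip_nonneg by (simp add: hnorm_def)

lemma hnorm_zero: "hnorm H \<zero> = 0"
  by (simp add: hnorm_def ip_zero_left)

lemma hnorm_smult: "x \<in> carrier H \<Longrightarrow> hnorm H (a \<odot> x) = cmod a * hnorm H x"
proof -
  assume x: "x \<in> carrier H"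
  have "ip H (a \<odot> x) (a \<odot> x) = (a * cnj a) * ip H x x"
    using x by (simp add: ip_smult_left ip_smult_right)
  also have "\<dots> = of_real ((cmod a)\<^sup>2 * (hnorm H x)\<^sup>2)"
    using ip_self[OF x] complex_norm_square[of a] by simp
  finally have "ip H (a \<odot> x) (a \<odot> x) = of_real ((cmod a)\<^sup>2 * (hnorm H x)\<^sup>2)" .
  then show ?thesis
    using x hnorm_nonneg[of x] by (simp add: hnorm_def[of H "a \<odot> x"] real_sqrt_mult)
qed

lemma hnorm_diff_power2:
  assumes "x \<in> carrier H" "y \<in> carrier H"
  shows "(hnorm H (x \<ominus> y))\<^sup>2 = (hnorm H x)\<^sup>2 + (hnorm H y)\<^sup>2 - 2 * Re (ip H x y)"
  using assms ip_commute[of x y]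
  by (simp add: hnorm_power2 ip_diff_left ip_diff_right)

lemma hnorm_add_power2:
  assumes "x \<in> carrier H" "y \<in> carrier H"
  shows "(hnorm H (x \<oplus> y))\<^sup>2 = (hnorm H x)\<^sup>2 + (hnorm H y)\<^sup>2 + 2 * Re (ip H x y)"
  using assms ip_commute[of x y]
  by (simp add: hnorm_power2 ip_add_left ip_add_right)

lemma cauchy_schwarz:
  assumes x: "x \<in> carrier H" and y: "y \<in> carrier H"
  shows "cmod (ip H x y) \<le> hnorm H x * hnorm H y"
proof -
  let ?z = "ip H x y" let ?p = "(hnorm H x)\<^sup>2" let ?q = "(hnorm H y)\<^sup>2"
  \<comment> \<open>Expand \<open>\<parallel>x - t z y\<parallel>\<^sup>2 \<ge> 0\<close> for
    \<open>z = ip H x y\<close> and real \<open>t\<close>; the factor \<open>z\<close> makes the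
    mixed term real.\<close>
  have key: "0 \<le> ?p - 2 * t * (cmod ?z)\<^sup>2 + t\<^sup>2 * (cmod ?z)\<^sup>2 * ?q" for t :: real
  proof -
    let ?a = "of_real t * ?z"
    have "0 \<le> (hnorm H (x \<ominus> ?a \<odot> y))\<^sup>2" by simp
    also have "\<dots> = ?p + (hnorm H (?a \<odot> y))\<^sup>2 - 2 * Re (ip H x (?a \<odot> y))"
      using x y by (simp add: hnorm_diff_power2)
    also have "(hnorm H (?a \<odot> y))\<^sup>2 = t\<^sup>2 * (cmod ?z)\<^sup>2 * ?q"
      using y by (simp add: hnorm_smult norm_mult power_mult_distrib)
    also have "ip H x (?a \<odot> y) = of_real (t * (cmod ?z)\<^sup>2)"
      using x y complex_norm_square[of ?z] by (simp add: ip_smult_right mult.assoc mult.commute)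
    finally show ?thesis by simp
  qed
  have "(cmod ?z)\<^sup>2 \<le> ?p * ?q"
  proof (cases "?q = 0")
    case True
    have "(cmod ?z)\<^sup>2 = 0"
    proof (rule ccontr)
      assume "(cmod ?z)\<^sup>2 \<noteq> 0"
      \<comment> \<open>If \<open>y\<close> is a null vector, \<open>key\<close> is affine in
        \<open>t\<close>; at this value it reads \<open>0 \<le> p - (p + 1)\<close>.\<close>
      moreover have "0 \<le> ?p - 2 * ((?p + 1) / (2 * (cmod ?z)\<^sup>2)) * (cmod ?z)\<^sup>2"
        using key[of "(?p + 1) / (2 * (cmod ?z)\<^sup>2)"] True by simp
      ultimately show False by (simp add: field_simps)
    qed
    then show ?thesis by simp
  next
    case False
    have "0 \<le> ?p - (cmod ?z)\<^sup>2 / ?q"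
    proof -
      have "(1 / ?q)\<^sup>2 * (cmod ?z)\<^sup>2 * ?q = (cmod ?z)\<^sup>2 / ?q"
        using False by (simp add: power2_eq_square power_divide)
      then show ?thesis using key[of "1 / ?q"] by simp
    qed
    moreover have "0 < ?q" using False by simp
    ultimately show ?thesis by (simp add: field_simps)
  qed
  then have "(cmod ?z)\<^sup>2 \<le> (hnorm H x * hnorm H y)\<^sup>2" by (simp add: power_mult_distrib)
  then show ?thesis
    using x y hnorm_nonneg by (meson mult_nonneg_nonneg power2_le_imp_le)
qed

lemma hnorm_triangle:
  assumes x: "x \<in> carrier H" and y: "y \<in> carrier H"
  shows "hnorm H (x \<oplus> y) \<le> hnorm H x + hnorm H y"
proof (rule power2_le_imp_le)
  have "Re (ip H x y) \<le> hnorm H x * hnorm H y"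
    using cauchy_schwarz[OF x y] complex_Re_le_cmod[of "ip H x y"] by linarith
  then show "(hnorm H (x \<oplus> y))\<^sup>2 \<le> (hnorm H x + hnorm H y)\<^sup>2"
    using x y by (simp add: hnorm_add_power2 power2_sum)
qed (use x y hnorm_nonneg in auto)

lemma hnorm_minus_commute:
  assumes "x \<in> carrier H" "y \<in> carrier H"
  shows "hnorm H (x \<ominus> y) = hnorm H (y \<ominus> x)"
proof (rule power2_eq_imp_eq)
  show "(hnorm H (x \<ominus> y))\<^sup>2 = (hnorm H (y \<ominus> x))\<^sup>2"
    using assms ip_commute[OF assms] by (simp add: hnorm_diff_power2)
qed (use assms hnorm_nonneg in auto)

lemma diff_add_diff:
  assumes "x \<in> carrier H" "y \<in> carrier H" "z \<in> carrier H"
  shows "(x \<ominus> y) \<oplus> (y \<ominus> z) = x \<ominus> z"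
  using assms by (simp add: a_minus_def a_ac r_neg1 r_neg2)

lemma hnorm_diff_triangle:
  assumes "x \<in> carrier H" "y \<in> carrier H" "z \<in> carrier H"
  shows "hnorm H (x \<ominus> z) \<le> hnorm H (x \<ominus> y) + hnorm H (y \<ominus> z)"
  using hnorm_triangle[of "x \<ominus> y" "y \<ominus> z"] assms by (simp add: diff_add_diff)

lemma ip_finsum_left:
  assumes "finite A" "f \<in> A \<rightarrow> carrier H" "y \<in> carrier H"
  shows "ip H (finsum H f A) y = (\<Sum>i\<in>A. ip H (f i) y)"
  using assms
proof (induction A)
  case (insert i A)
  then have "f i \<in> carrier H" "f \<in> A \<rightarrow> carrier H" by auto
  with insert show ?case by (simp add: ip_add_left)
qed (simp add: ip_zero_left)

lemma ip_finsum_right: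
  assumes "finite A" "f \<in> A \<rightarrow> carrier H" "y \<in> carrier H"
  shows "ip H y (finsum H f A) = (\<Sum>i\<in>A. ip H y (f i))"
  using assms
proof (induction A)
  case (insert i A)
  then have "f i \<in> carrier H" "f \<in> A \<rightarrow> carrier H" by auto
  with insert show ?case by (simp add: ip_add_right)
qed (simp add: ip_zero_right)

lemma hnorm_finsum:
  assumes "finite A" "f \<in> A \<rightarrow> carrier H"
  shows "hnorm H (finsum H f A) \<le> (\<Sum>i\<in>A. hnorm H (f i))"
  using assms
proof (induction A)
  case (insert i A)
  then have *: "f i \<in> carrier H" "f \<in> A \<rightarrow> carrier H" by auto
  with insert hnorm_triangle[of "f i" "finsum H f A"] show ?case by simp
qed (simp add: hnorm_zero)

end

text \<open>\<open>hilbert_space\<close> without completeness: it supplies \<open>rkhs\<close> and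
  \<open>l2_space\<close> with their norm and metric, after which \<open>hilbert_spaceI\<close>
  reduces completeness to Cauchy sequences in the norm.\<close>

locale pre_hilbert_space = module complex_ring H for H :: "'v inner_space" (structure) +
  assumes ip_add_left: "\<lbrakk>x \<in> carrier H; y \<in> carrier H; z \<in> carrier H\<rbrakk>
      \<Longrightarrow> ip H (x \<oplus> y) z = ip H x z + ip H y z"
    and ip_smult_left: "\<lbrakk>x \<in> carrier H; y \<in> carrier H\<rbrakk> \<Longrightarrow> ip H (a \<odot> x) y = a * ip H x y"
    and ip_commute: "\<lbrakk>x \<in> carrier H; y \<in> carrier H\<rbrakk> \<Longrightarrow> ip H y x = cnj (ip H x y)"
    and ip_pos: "\<lbrakk>x \<in> carrier H; x \<noteq> \<zero>\<rbrakk> \<Longrightarrow> 0 < Re (ip H x x)"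

sublocale pre_hilbert_space \<subseteq> semi: semi_inner_space H
proof
  show "0 \<le> Re (ip H x x)" if x: "x \<in> carrier H" for x
  proof (cases "x = \<zero>")
    case True
    have "ip H (0 \<odot> \<zero>) \<zero> = 0 * ip H \<zero> \<zero>" by (rule ip_smult_left) auto
    then show ?thesis using True smult_l_null[of \<zero>] by simp
  qed (use ip_pos x in fastforce)
qed (assumption | rule ip_add_left ip_smult_left ip_commute)+

sublocale hilbert_space \<subseteq> pre_hilbert_space H
  by unfold_locales (assumption | rule ip_add_left ip_smult_left ip_commute ip_pos)+

context pre_hilbert_space
begin

lemma hnorm_eq_0: "x \<in> carrier H \<Longrightarrow> hnorm H x = 0 \<longleftrightarrow> x = \<zero>"
  using ip_pos[of x] semi.hnorm_zero by (force simp: hnorm_def)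

lemma diff_eq_0: "\<lbrakk>x \<in> carrier H; y \<in> carrier H\<rbrakk> \<Longrightarrow> x \<ominus> y = \<zero> \<longleftrightarrow> x = y"
  by (metis M.add.inv_solve_right' M.l_zero M.zero_closed a_minus_def)

lemma metric: "Metric_space (carrier H) (hdist H)"
proof
  fix x y z
  show "0 \<le> hdist H x y" by (simp add: hdist_def semi.hnorm_nonneg)
  show "hdist H x y = hdist H y x" by (simp add: hdist_def semi.hnorm_minus_commute)
  assume x: "x \<in> carrier H" and y: "y \<in> carrier H"
  then show "hdist H x y = 0 \<longleftrightarrow> x = y" by (simp add: hdist_def hnorm_eq_0 diff_eq_0)
  assume "z \<in> carrier H"
  with x y show "hdist H x z \<le> hdist H x y + hdist H y z"
    by (simp add: hdist_def semi.hnorm_diff_triangle)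
qed

lemma limitin_iff:
  fixes \<sigma> :: "nat \<Rightarrow> 'v"
  assumes "range \<sigma> \<subseteq> carrier H"
  shows "limitin (Metric_space.mtopology (carrier H) (hdist H)) \<sigma> x sequentially \<longleftrightarrow>
    x \<in> carrier H \<and> (\<lambda>n. hnorm H (\<sigma> n \<ominus> x)) \<longlonglongrightarrow> 0"
proof -
  have *: "\<sigma> n \<in> carrier H" for n using assms by auto
  show ?thesis
    unfolding Metric_space.limit_metric_sequentially[OF metric] lim_sequentially
    using * by (auto simp: hdist_def dist_real_def abs_of_nonneg semi.hnorm_nonneg)
qed

lemma hilbert_spaceI:
  assumes "\<And>\<sigma>. \<lbrakk>\<And>n. \<sigma> n \<in> carrier H; \<And>e. e > 0 \<Longrightarrow> \<exists>N. \<forall>m\<ge>N. \<forall>n\<ge>N. hnorm H (\<sigma> m \<ominus> \<sigma> n) < e\<rbrakk>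
    \<Longrightarrow> \<exists>x\<in>carrier H. (\<lambda>n. hnorm H (\<sigma> n \<ominus> x)) \<longlonglongrightarrow> 0"
  shows "hilbert_space H"
proof
  show "Metric_space.mcomplete (carrier H) (hdist H)"
    unfolding Metric_space.mcomplete_def[OF metric]
  proof (intro allI impI)
    fix \<sigma> assume "Metric_space.MCauchy (carrier H) (hdist H) \<sigma>"
    then have r: "range \<sigma> \<subseteq> carrier H"
      and c: "\<forall>e>0. \<exists>N. \<forall>n n'. N \<le> n \<longrightarrow> N \<le> n' \<longrightarrow> hdist H (\<sigma> n) (\<sigma> n') < e"
      unfolding Metric_space.MCauchy_def[OF metric] by auto
    have in_H: "\<sigma> n \<in> carrier H" for n using r by auto
    have "\<exists>N. \<forall>m\<ge>N. \<forall>n\<ge>N. hnorm H (\<sigma> m \<ominus> \<sigma> n) < e" if "e > 0" for e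
      using c that in_H by (simp add: hdist_def)
    then have "\<exists>x\<in>carrier H. (\<lambda>n. hnorm H (\<sigma> n \<ominus> x)) \<longlonglongrightarrow> 0"
      by (rule assms[OF in_H])
    then show "\<exists>x. limitin (Metric_space.mtopology (carrier H) (hdist H)) \<sigma> x sequentially"
      using limitin_iff[OF r] by blast
  qed
qed (assumption | rule ip_add_left ip_smult_left ip_commute ip_pos)+

lemma closedin_limit:
  fixes \<sigma> :: "nat \<Rightarrow> 'v"
  assumes W: "closedin (Metric_space.mtopology (carrier H) (hdist H)) W"
    and \<sigma>: "\<And>n. \<sigma> n \<in> W" and x: "x \<in> carrier H" and lim: "(\<lambda>n. hnorm H (\<sigma> n \<ominus> x)) \<longlonglongrightarrow> 0"
  shows "x \<in> W"
proof -
  have sub: "W \<subseteq> carrier H"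
    and cl: "\<And>\<sigma> l. \<lbrakk>range \<sigma> \<subseteq> W;
      limitin (Metric_space.mtopology (carrier H) (hdist H)) \<sigma> l sequentially\<rbrakk> \<Longrightarrow> l \<in> W"
    using W unfolding Metric_space.metric_closedin_iff_sequentially_closed[OF metric] by auto
  have "range \<sigma> \<subseteq> carrier H" using \<sigma> sub by auto
  then show ?thesis using cl[of \<sigma> x] \<sigma> x lim limitin_iff[of \<sigma> x] by auto
qed

end

section \<open>Completeness and orthogonal projections\<close>

context hilbert_space
begin

lemma complete_sequence:
  fixes \<sigma> :: "nat \<Rightarrow> 'v"
  assumes in_H: "\<And>n. \<sigma> n \<in> carrier H"
    and c: "\<And>e. e > 0 \<Longrightarrow> \<exists>N. \<forall>m\<ge>N. \<forall>n\<ge>N. hnorm H (\<sigma> m \<ominus> \<sigma> n) < e"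
  obtains x where "x \<in> carrier H" "(\<lambda>n. hnorm H (\<sigma> n \<ominus> x)) \<longlonglongrightarrow> 0"
proof -
  have r: "range \<sigma> \<subseteq> carrier H" using in_H by auto
  have "Metric_space.MCauchy (carrier H) (hdist H) \<sigma>"
    unfolding Metric_space.MCauchy_def[OF metric]
  proof (intro conjI allI impI)
    fix e :: real assume "e > 0"
    from c[OF this] show "\<exists>N. \<forall>n n'. N \<le> n \<longrightarrow> N \<le> n' \<longrightarrow> hdist H (\<sigma> n) (\<sigma> n') < e"
      using in_H by (simp add: hdist_def)
  qed (use in_H in auto)
  then show thesis
    using complete that limitin_iff[OF r] unfolding Metric_space.mcomplete_def[OF metric] by blast
qed

text \<open>A sequence in \<open>W\<close> minimising the distance to \<open>x\<close> is Cauchy by the parallelogram law.\<close>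

lemma orthogonal_projection:
  assumes W: "submodule W complex_ring H"
    and cl: "closedin (Metric_space.mtopology (carrier H) (hdist H)) W" and x: "x \<in> carrier H"
  obtains p where "p \<in> W" "\<And>w. w \<in> W \<Longrightarrow> ip H (x \<ominus> p) w = 0"
proof -
  have sub: "W \<subseteq> carrier H" and ne: "W \<noteq> {}" and s: "\<And>a w. w \<in> W \<Longrightarrow> a \<odot> w \<in> W"
    and add: "\<And>v w. v \<in> W \<Longrightarrow> w \<in> W \<Longrightarrow> v \<oplus> w \<in> W"
    using submoduleE[OF W] by auto
  have [simp, intro]: "w \<in> carrier H" if "w \<in> W" for w using sub that by auto
  define d where "d = (INF w\<in>W. (hnorm H (x \<ominus> w))\<^sup>2)"
  have bdd: "bdd_below ((\<lambda>w. (hnorm H (x \<ominus> w))\<^sup>2) ` W)" by (rule bdd_belowI2[of _ 0]) simp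
  have d_le: "d \<le> (hnorm H (x \<ominus> w))\<^sup>2" if "w \<in> W" for w
    unfolding d_def using bdd that by (rule cINF_lower)
  have "\<exists>w\<in>W. (hnorm H (x \<ominus> w))\<^sup>2 < d + 1 / real (Suc n)" for n
  proof -
    have "d < d + 1 / real (Suc n)" by simp
    then show ?thesis unfolding d_def using cINF_less_iff[OF ne bdd] by blast
  qed
  then obtain \<sigma> where \<sigma>: "\<And>n. \<sigma> n \<in> W" and \<sigma>d: "\<And>n. (hnorm H (x \<ominus> \<sigma> n))\<^sup>2 < d + 1 / real (Suc n)"
    by metis
  \<comment> \<open>The parallelogram law for \<open>x - v\<close> and \<open>x - w\<close>; the
    midpoint of \<open>v\<close> and \<open>w\<close> lies in \<open>W\<close>, so its squared
    distance from \<open>x\<close> is at least \<open>d\<close>.\<close>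
  have par: "(hnorm H (v \<ominus> w))\<^sup>2 \<le> 2 * (hnorm H (x \<ominus> v))\<^sup>2 + 2 * (hnorm H (x \<ominus> w))\<^sup>2 - 4 * d"
    if v: "v \<in> W" and w: "w \<in> W" for v w
  proof -
    have m: "(1/2) \<odot> (v \<oplus> w) \<in> W" using v w add s by auto
    have v': "v \<in> carrier H" and w': "w \<in> carrier H" using v w by auto
    have "(hnorm H (v \<ominus> w))\<^sup>2 + 4 * (hnorm H (x \<ominus> (1/2) \<odot> (v \<oplus> w)))\<^sup>2
      = 2 * (hnorm H (x \<ominus> v))\<^sup>2 + 2 * (hnorm H (x \<ominus> w))\<^sup>2"
    proof -
      have "Re (ip H x ((1/2) \<odot> (v \<oplus> w))) = (Re (ip H x v) + Re (ip H x w)) / 2"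
        using x v' w' by (simp add: semi.ip_smult_right semi.ip_add_right)
      moreover have "(hnorm H ((1/2) \<odot> (v \<oplus> w)))\<^sup>2 = (hnorm H (v \<oplus> w))\<^sup>2 / 4"
        using v' w' by (simp add: semi.hnorm_smult power_divide)
      ultimately show ?thesis
        using semi.hnorm_diff_power2[OF x v'] semi.hnorm_diff_power2[OF x w']
          semi.hnorm_diff_power2[OF v' w'] semi.hnorm_add_power2[OF v' w']
          semi.hnorm_diff_power2[OF x, of "(1/2) \<odot> (v \<oplus> w)"] v' w' by simp
    qed
    then show ?thesis using d_le[OF m] by linarith
  qed
  have "\<exists>N. \<forall>m\<ge>N. \<forall>n\<ge>N. hnorm H (\<sigma> m \<ominus> \<sigma> n) < e" if e: "e > 0" for e
  proof -
    \<comment> \<open>By \<open>par\<close> the squared distance of two terms is below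
      \<open>2/(m+1) + 2/(n+1) \<le> 4/(N+1)\<close>, hence the factor 4.\<close>
    obtain N where N: "1 / real (Suc N) < e\<^sup>2 / 4"
      using reals_Archimedean[of "e\<^sup>2 / 4"] e by (auto simp: inverse_eq_divide)
    have "hnorm H (\<sigma> m \<ominus> \<sigma> n) < e" if "m \<ge> N" "n \<ge> N" for m n
    proof (rule power2_less_imp_less)
      have "1 / real (Suc m) \<le> 1 / real (Suc N)" "1 / real (Suc n) \<le> 1 / real (Suc N)"
        using that by (auto intro!: divide_left_mono)
      then show "(hnorm H (\<sigma> m \<ominus> \<sigma> n))\<^sup>2 < e\<^sup>2"
        using par[OF \<sigma>[of m] \<sigma>[of n]] \<sigma>d[of m] \<sigma>d[of n] N by linarith
    qed (use e in simp)
    then show ?thesis by blast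
  qed
  then obtain p where p: "p \<in> carrier H" and lim: "(\<lambda>n. hnorm H (\<sigma> n \<ominus> p)) \<longlonglongrightarrow> 0"
    using complete_sequence[of \<sigma>] \<sigma> by blast
  have pW: "p \<in> W" by (rule closedin_limit[OF cl \<sigma> p lim])
  have min: "hnorm H (x \<ominus> p) \<le> hnorm H (x \<ominus> w)" if w: "w \<in> W" for w
  proof (rule power2_le_imp_le)
    have "(\<lambda>n. (hnorm H (x \<ominus> w))\<^sup>2 + 1 / real (Suc n)) \<longlonglongrightarrow> (hnorm H (x \<ominus> w))\<^sup>2 + 0"
      by (intro tendsto_add tendsto_const lim_const_over_n LIMSEQ_Suc)
    moreover have "(\<lambda>n. sqrt ((hnorm H (x \<ominus> w))\<^sup>2 + 1 / real (Suc n)) + hnorm H (\<sigma> n \<ominus> p))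
       \<longlonglongrightarrow> sqrt ((hnorm H (x \<ominus> w))\<^sup>2 + 0) + 0"
      by (intro tendsto_add[OF tendsto_real_sqrt[OF calculation] lim])
    moreover have "hnorm H (x \<ominus> p) \<le> sqrt ((hnorm H (x \<ominus> w))\<^sup>2 + 1 / real (Suc n)) + hnorm H (\<sigma> n \<ominus> p)" for n
    proof -
      have "hnorm H (x \<ominus> \<sigma> n) \<le> sqrt ((hnorm H (x \<ominus> w))\<^sup>2 + 1 / real (Suc n))"
        using \<sigma>d[of n] d_le[OF w] by (intro real_le_rsqrt) linarith
      then show ?thesis using semi.hnorm_diff_triangle[OF x _ p, of "\<sigma> n"] \<sigma>[of n] by auto
    qed
    ultimately have "hnorm H (x \<ominus> p) \<le> sqrt ((hnorm H (x \<ominus> w))\<^sup>2 + 0) + 0"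
      using LIMSEQ_le_const by blast
    then show "(hnorm H (x \<ominus> p))\<^sup>2 \<le> (hnorm H (x \<ominus> w))\<^sup>2"
      using x p w semi.hnorm_nonneg by (simp add: power_mono)
  qed (use x w semi.hnorm_nonneg in auto)
  have "ip H (x \<ominus> p) w = 0" if w: "w \<in> W" for w
  proof (rule ccontr)
    let ?z = "ip H (x \<ominus> p) w"
    assume z: "?z \<noteq> 0"
    have w': "w \<in> carrier H" using w by auto
    \<comment> \<open>Moving \<open>p\<close> by \<open>t z w\<close> inside \<open>W\<close>
      changes the squared distance by \<open>t\<^sup>2 |z|\<^sup>2 \<parallel>w\<parallel>\<^sup>2 -
      2 t |z|\<^sup>2\<close>. With this \<open>t\<close> the first term is less than half the
      second, so the distance would drop below its minimum.\<close>
    define t where "t = 1 / ((hnorm H w)\<^sup>2 + 1)"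
    let ?a = "of_real t * ?z"
    have t: "t > 0" "t * (hnorm H w)\<^sup>2 < 1"
    proof -
      have "0 < (hnorm H w)\<^sup>2 + 1" by (simp add: add_nonneg_pos)
      then show "t > 0" "t * (hnorm H w)\<^sup>2 < 1" by (simp_all add: t_def)
    qed
    have "p \<oplus> ?a \<odot> w \<in> W" using pW w add s by auto
    from min[OF this] have "(hnorm H (x \<ominus> p))\<^sup>2 \<le> (hnorm H (x \<ominus> (p \<oplus> ?a \<odot> w)))\<^sup>2"
      using x p semi.hnorm_nonneg by (intro power_mono) auto
    also have "x \<ominus> (p \<oplus> ?a \<odot> w) = (x \<ominus> p) \<ominus> ?a \<odot> w"
      using x p w' by (simp add: a_minus_def minus_add a_assoc)
    also have "(hnorm H \<dots>)\<^sup>2 = (hnorm H (x \<ominus> p))\<^sup>2 + (hnorm H (?a \<odot> w))\<^sup>2 - 2 * Re (ip H (x \<ominus> p) (?a \<odot> w))"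
      using x p w' by (simp add: semi.hnorm_diff_power2)
    also have "(hnorm H (?a \<odot> w))\<^sup>2 = t * (cmod ?z)\<^sup>2 * (t * (hnorm H w)\<^sup>2)"
      using w' by (simp add: semi.hnorm_smult norm_mult power_mult_distrib power2_eq_square)
    also have "ip H (x \<ominus> p) (?a \<odot> w) = of_real (t * (cmod ?z)\<^sup>2)"
      using x p w' complex_norm_square[of ?z] by (simp add: semi.ip_smult_right mult.assoc mult.commute)
    finally have "2 * (t * (cmod ?z)\<^sup>2) \<le> (t * (hnorm H w)\<^sup>2) * (t * (cmod ?z)\<^sup>2)"
      by (simp add: mult.commute)
    moreover have "t * (cmod ?z)\<^sup>2 > 0" using z t by simp
    ultimately have "2 \<le> t * (hnorm H w)\<^sup>2" by (rule mult_right_le_imp_le)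
    then show False using t by linarith
  qed
  with pW show thesis by (rule that)
qed

end

section \<open>Positive semidefinite kernels and their Hilbert spaces\<close>

definition delta :: "'x \<Rightarrow> 'x \<Rightarrow> complex" where
  "delta x = (\<lambda>y. if y = x then 1 else 0)"

text \<open>\<open>kernel_psd\<close> constrains only the real part of the quadratic form, and an
  imaginary multiple of the identity kernel satisfies it too; hence the separate Hermitian
  condition.\<close>

locale psd_kernel =
  fixes S :: "'x set" and K :: "'x \<Rightarrow> 'x \<Rightarrow> complex"
  assumes kernel_hermitian: "\<lbrakk>x \<in> S; y \<in> S\<rbrakk> \<Longrightarrow> K y x = cnj (K x y)"
    and kernel_psd: "\<lbrakk>finite F; F \<subseteq> S\<rbrakk> \<Longrightarrow> 0 \<le> Re (\<Sum>x\<in>F. \<Sum>y\<in>F. c x * cnj (c y) * K x y)"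
begin

section \<open>The semidefinite form on finitely supported functions\<close>

definition V :: "('x \<Rightarrow> complex) set" where
  "V = {c. finite {x. c x \<noteq> 0} \<and> {x. c x \<noteq> 0} \<subseteq> S}"

definition form :: "('x \<Rightarrow> complex) \<Rightarrow> ('x \<Rightarrow> complex) \<Rightarrow> complex" where
  "form c d = (\<Sum>x | c x \<noteq> 0. \<Sum>y | d y \<noteq> 0. c x * cnj (d y) * K x y)"

text \<open>Lets functions with different supports be compared over one common finite index
  set.\<close>

lemma form_superset:
  assumes "finite F" "finite G" "{x. c x \<noteq> 0} \<subseteq> F" "{x. d x \<noteq> 0} \<subseteq> G"
  shows "form c d = (\<Sum>x\<in>F. \<Sum>y\<in>G. c x * cnj (d y) * K x y)"
proof -
  have "form c d = (\<Sum>x | c x \<noteq> 0. \<Sum>y\<in>G. c x * cnj (d y) * K x y)"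
    unfolding form_def
  proof (rule sum.cong[OF refl])
    fix x
    show "(\<Sum>y | d y \<noteq> 0. c x * cnj (d y) * K x y) = (\<Sum>y\<in>G. c x * cnj (d y) * K x y)"
      using assms by (intro sum.mono_neutral_left) auto
  qed
  also have "\<dots> = (\<Sum>x\<in>F. \<Sum>y\<in>G. c x * cnj (d y) * K x y)"
    using assms by (intro sum.mono_neutral_left) auto
  finally show ?thesis .
qed

definition pre :: "('x \<Rightarrow> complex) inner_space" where
  "pre = \<lparr>carrier = V, monoid.mult = undefined, one = undefined, ring.zero = (\<lambda>x. 0),
     add = (\<lambda>\<xi> \<eta> x. \<xi> x + \<eta> x), smult = (\<lambda>a \<xi> x. a * \<xi> x), ip = form\<rparr>"

lemma pre_simps [simp]:
  "carrier pre = V" "zero pre = (\<lambda>x. 0)" "add pre = (\<lambda>\<xi> \<eta> x. \<xi> x + \<eta> x)"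
  "smult pre = (\<lambda>a \<xi> x. a * \<xi> x)" "ip pre = form"
  by (simp_all add: pre_def)

lemma V_add: "\<lbrakk>c \<in> V; d \<in> V\<rbrakk> \<Longrightarrow> (\<lambda>x. c x + d x) \<in> V"
proof -
  assume cd: "c \<in> V" "d \<in> V"
  have "{x. c x + d x \<noteq> 0} \<subseteq> {x. c x \<noteq> 0} \<union> {x. d x \<noteq> 0}" by auto
  then show ?thesis using cd unfolding V_def by (blast intro: finite_subset)
qed

lemma V_smult: "c \<in> V \<Longrightarrow> (\<lambda>x. a * c x) \<in> V"
proof -
  assume c: "c \<in> V"
  have "{x. a * c x \<noteq> 0} \<subseteq> {x. c x \<noteq> 0}" by auto
  then show ?thesis using c unfolding V_def by (blast intro: finite_subset)
qed

lemma V_diff: "\<lbrakk>c \<in> V; d \<in> V\<rbrakk> \<Longrightarrow> (\<lambda>x. c x - d x) \<in> V"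
  using V_add[of c "\<lambda>x. - d x"] V_smult[of d "-1"] by simp

lemma V_zero: "(\<lambda>x. 0) \<in> V"
  by (simp add: V_def)

lemma V_delta: "x \<in> S \<Longrightarrow> delta x \<in> V"
  by (auto simp: V_def delta_def)

lemma module_pre: "module complex_ring pre"
  by (rule function_module) (simp_all add: V_add V_smult V_zero)

lemma form_add_left:
  assumes "c \<in> V" "d \<in> V" "v \<in> V"
  shows "form (\<lambda>x. c x + d x) v = form c v + form d v"
proof -
  let ?F = "{x. c x \<noteq> 0} \<union> {x. d x \<noteq> 0}" and ?G = "{x. v x \<noteq> 0}"
  have f: "finite ?F" "finite ?G" using assms by (auto simp: V_def)
  have "form (\<lambda>x. c x + d x) v = (\<Sum>x\<in>?F. \<Sum>y\<in>?G. (c x + d x) * cnj (v y) * K x y)"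
    using f by (rule form_superset) auto
  moreover have "form c v = (\<Sum>x\<in>?F. \<Sum>y\<in>?G. c x * cnj (v y) * K x y)"
    using f by (rule form_superset) auto
  moreover have "form d v = (\<Sum>x\<in>?F. \<Sum>y\<in>?G. d x * cnj (v y) * K x y)"
    using f by (rule form_superset) auto
  ultimately show ?thesis by (simp add: algebra_simps sum.distrib)
qed

lemma form_smult_left:
  assumes "c \<in> V" "v \<in> V"
  shows "form (\<lambda>x. a * c x) v = a * form c v"
proof -
  let ?F = "{x. c x \<noteq> 0}" and ?G = "{x. v x \<noteq> 0}"
  have f: "finite ?F" "finite ?G" using assms by (auto simp: V_def)
  have "form (\<lambda>x. a * c x) v = (\<Sum>x\<in>?F. \<Sum>y\<in>?G. (a * c x) * cnj (v y) * K x y)"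
    using f by (rule form_superset) auto
  then show ?thesis by (simp add: form_def sum_distrib_left mult.assoc)
qed

lemma form_commute:
  assumes "c \<in> V" "d \<in> V"
  shows "form d c = cnj (form c d)"
proof -
  have "form d c = (\<Sum>x | c x \<noteq> 0. \<Sum>y | d y \<noteq> 0. d y * cnj (c x) * K y x)"
    unfolding form_def by (rule sum.swap)
  also have "\<dots> = (\<Sum>x | c x \<noteq> 0. \<Sum>y | d y \<noteq> 0. cnj (c x * cnj (d y) * K x y))"
  proof (intro sum.cong refl)
    fix x y assume "x \<in> {x. c x \<noteq> 0}" "y \<in> {y. d y \<noteq> 0}"
    then have "x \<in> S" "y \<in> S" using assms by (auto simp: V_def)
    then show "d y * cnj (c x) * K y x = cnj (c x * cnj (d y) * K x y)"
      using kernel_hermitian[of x y] by simp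
  qed
  also have "\<dots> = cnj (form c d)" by (simp add: form_def)
  finally show ?thesis .
qed

sublocale pre: semi_inner_space pre
proof -
  interpret module complex_ring pre by (rule module_pre)
  show "semi_inner_space pre"
  proof
    show "0 \<le> Re (ip pre c c)" if "c \<in> carrier pre" for c
      using that kernel_psd[of "{x. c x \<noteq> 0}" c] by (simp add: V_def form_def)
    show "ip pre d c = cnj (ip pre c d)" if "c \<in> carrier pre" "d \<in> carrier pre" for c d
      using that form_commute[of c d] by simp
  qed (simp_all add: form_add_left form_smult_left)
qed

lemma pre_minus: "\<lbrakk>c \<in> V; d \<in> V\<rbrakk> \<Longrightarrow> c \<ominus>\<^bsub>pre\<^esub> d = (\<lambda>x. c x - d x)"
  by (rule function_module_minus[OF module_pre]) simp_all

definition nrm :: "('x \<Rightarrow> complex) \<Rightarrow> real" where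
  "nrm c = hnorm pre c"

lemma nrm_nonneg: "c \<in> V \<Longrightarrow> 0 \<le> nrm c"
  using pre.hnorm_nonneg[of c] by (simp add: nrm_def)

lemma form_bound: "\<lbrakk>c \<in> V; d \<in> V\<rbrakk> \<Longrightarrow> cmod (form c d) \<le> nrm c * nrm d"
  using pre.cauchy_schwarz[of c d] by (simp add: nrm_def)

lemma form_self: "c \<in> V \<Longrightarrow> form c c = of_real ((nrm c)\<^sup>2)"
  using pre.ip_self[of c] by (simp add: nrm_def)

lemma nrm_triangle: "\<lbrakk>a \<in> V; b \<in> V; c \<in> V\<rbrakk> \<Longrightarrow>
    nrm (\<lambda>x. a x - c x) \<le> nrm (\<lambda>x. a x - b x) + nrm (\<lambda>x. b x - c x)"
  using pre.hnorm_diff_triangle[of a b c] by (simp add: nrm_def pre_minus)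

lemma nrm_minus_commute: "\<lbrakk>a \<in> V; b \<in> V\<rbrakk> \<Longrightarrow> nrm (\<lambda>x. a x - b x) = nrm (\<lambda>x. b x - a x)"
  using pre.hnorm_minus_commute[of a b] by (simp add: nrm_def pre_minus)

lemma form_diff_left: "\<lbrakk>a \<in> V; b \<in> V; c \<in> V\<rbrakk> \<Longrightarrow> form (\<lambda>x. a x - b x) c = form a c - form b c"
  using pre.ip_diff_left[of a b c] by (simp add: pre_minus)

lemma form_diff_right: "\<lbrakk>a \<in> V; b \<in> V; c \<in> V\<rbrakk> \<Longrightarrow> form a (\<lambda>x. b x - c x) = form a b - form a c"
  using pre.ip_diff_right[of a b c] by (simp add: pre_minus)

text \<open>Continuity of the form on bounded sets; it gives both convergence along Cauchy sequences
  and independence of the representing sequences.\<close>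

lemma form_diff_bound:
  assumes "a \<in> V" "b \<in> V" "a' \<in> V" "b' \<in> V"
  shows "cmod (form a b - form a' b') \<le> nrm (\<lambda>x. a x - a' x) * nrm b + nrm a' * nrm (\<lambda>x. b x - b' x)"
proof -
  have "form a b - form a' b' = form (\<lambda>x. a x - a' x) b + form a' (\<lambda>x. b x - b' x)"
    using assms by (simp add: form_diff_left form_diff_right)
  also have "cmod \<dots> \<le> cmod (form (\<lambda>x. a x - a' x) b) + cmod (form a' (\<lambda>x. b x - b' x))"
    by (rule norm_triangle_ineq)
  also have "\<dots> \<le> nrm (\<lambda>x. a x - a' x) * nrm b + nrm a' * nrm (\<lambda>x. b x - b' x)"
    using assms by (intro add_mono form_bound V_diff)
  finally show ?thesis .
qed

lemma form_delta_expand: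
  assumes "c \<in> V" "v \<in> V"
  shows "form c v = (\<Sum>y | v y \<noteq> 0. cnj (v y) * form c (delta y))"
proof -
  have "form c v = (\<Sum>y | v y \<noteq> 0. \<Sum>x | c x \<noteq> 0. c x * cnj (v y) * K x y)"
    unfolding form_def by (rule sum.swap)
  moreover have "{z. delta y z \<noteq> 0} = {y}" for y :: 'x by (auto simp: delta_def)
  ultimately show ?thesis
    by (simp add: form_def delta_def sum_distrib_left mult_ac)
qed

section \<open>Cauchy sequences and the functions they represent\<close>

definition cauchy :: "(nat \<Rightarrow> 'x \<Rightarrow> complex) \<Rightarrow> bool" where
  "cauchy c \<longleftrightarrow> (\<forall>n. c n \<in> V) \<and> (\<forall>e>0. \<exists>N. \<forall>m\<ge>N. \<forall>n\<ge>N. nrm (\<lambda>x. c m x - c n x) < e)"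

lemma cauchy_V: "cauchy c \<Longrightarrow> c n \<in> V"
  by (simp add: cauchy_def)

lemma cauchyD: "cauchy c \<Longrightarrow> e > 0 \<Longrightarrow> \<exists>N. \<forall>m\<ge>N. \<forall>n\<ge>N. nrm (\<lambda>x. c m x - c n x) < e"
  by (simp add: cauchy_def)

lemma nrm_le_diff: "\<lbrakk>a \<in> V; b \<in> V\<rbrakk> \<Longrightarrow> nrm a \<le> nrm (\<lambda>x. a x - b x) + nrm b"
  using nrm_triangle[of a b "\<lambda>x. 0"] V_zero by simp

lemma cauchy_bounded:
  assumes c: "cauchy c"
  obtains M where "M > 0" "\<And>n. nrm (c n) \<le> M"
proof -
  obtain N where N: "\<forall>m\<ge>N. \<forall>n\<ge>N. nrm (\<lambda>x. c m x - c n x) < 1"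
    using cauchyD[OF c, of 1] by auto
  define M where "M = (\<Sum>i\<le>N. nrm (c i)) + 1"
  have pos: "0 \<le> nrm (c i)" for i using nrm_nonneg cauchy_V[OF c] by blast
  have le: "nrm (c i) \<le> (\<Sum>i\<le>N. nrm (c i))" if "i \<le> N" for i
    using that pos by (intro member_le_sum) auto
  have "nrm (c n) \<le> M" for n
  proof (cases "n \<le> N")
    case True then show ?thesis using le[of n] by (simp add: M_def)
  next
    case False
    then have "nrm (\<lambda>x. c n x - c N x) < 1" using N by auto
    then show ?thesis
      using nrm_le_diff[OF cauchy_V[OF c] cauchy_V[OF c], of n N] le[of N] by (simp add: M_def)
  qed
  moreover have "M > 0" unfolding M_def using pos by (simp add: add_nonneg_pos sum_nonneg)
  ultimately show thesis using that by blast
qed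

lemma cauchy_diff:
  assumes c: "cauchy c" and d: "cauchy d"
  shows "cauchy (\<lambda>n x. c n x - d n x)"
proof -
  have V: "c n \<in> V" "d n \<in> V" for n using c d by (simp_all add: cauchy_V)
  have "\<exists>N. \<forall>m\<ge>N. \<forall>n\<ge>N. nrm (\<lambda>x. (c m x - d m x) - (c n x - d n x)) < e" if e: "e > 0" for e
  proof -
    obtain N1 where N1: "\<forall>m\<ge>N1. \<forall>n\<ge>N1. nrm (\<lambda>x. c m x - c n x) < e/2"
      using cauchyD[OF c, of "e/2"] e by auto
    obtain N2 where N2: "\<forall>m\<ge>N2. \<forall>n\<ge>N2. nrm (\<lambda>x. d m x - d n x) < e/2"
      using cauchyD[OF d, of "e/2"] e by auto
    have "nrm (\<lambda>x. (c m x - d m x) - (c n x - d n x)) < e"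
      if "m \<ge> max N1 N2" "n \<ge> max N1 N2" for m n
    proof -
      have "nrm (\<lambda>x. (c m x - c n x) - (d m x - d n x)) \<le>
        nrm (\<lambda>x. (c m x - c n x) - 0) + nrm (\<lambda>x. 0 - (d m x - d n x))"
        by (rule nrm_triangle) (simp_all add: V_diff V V_zero)
      also have "nrm (\<lambda>x. 0 - (d m x - d n x)) = nrm (\<lambda>x. (d m x - d n x) - 0)"
        by (rule nrm_minus_commute) (simp_all add: V_diff V V_zero)
      finally have "nrm (\<lambda>x. (c m x - c n x) - (d m x - d n x)) < e"
        using N1 N2 that by fastforce
      moreover have "(\<lambda>x. (c m x - d m x) - (c n x - d n x)) = (\<lambda>x. (c m x - c n x) - (d m x - d n x))"
        by (simp add: algebra_simps)
      ultimately show ?thesis by simp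
    qed
    then show ?thesis by blast
  qed
  then show ?thesis using V by (simp add: cauchy_def V_diff)
qed

lemma cauchy_const: "v \<in> V \<Longrightarrow> cauchy (\<lambda>n. v)"
  using pre.hnorm_zero by (simp add: cauchy_def nrm_def)

lemma cauchy_smult:
  assumes c: "cauchy c"
  shows "cauchy (\<lambda>n x. a * c n x)"
proof -
  have V: "c n \<in> V" for n using c by (simp add: cauchy_V)
  have eq: "nrm (\<lambda>x. a * c m x - a * c n x) = cmod a * nrm (\<lambda>x. c m x - c n x)" for m n
    using pre.hnorm_smult[of "\<lambda>x. c m x - c n x" a] V_diff[OF V V, of m n]
    by (simp add: nrm_def algebra_simps)
  have "\<exists>N. \<forall>m\<ge>N. \<forall>n\<ge>N. cmod a * nrm (\<lambda>x. c m x - c n x) < e" if e: "e > 0" for e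
  proof -
    obtain N where N: "\<forall>m\<ge>N. \<forall>n\<ge>N. nrm (\<lambda>x. c m x - c n x) < e / (cmod a + 1)"
      using cauchyD[OF c, of "e / (cmod a + 1)"] e by (auto simp: add_nonneg_pos)
    have "cmod a * nrm (\<lambda>x. c m x - c n x) < e" if "m \<ge> N" "n \<ge> N" for m n
    proof -
      have "cmod a * nrm (\<lambda>x. c m x - c n x) \<le> (cmod a + 1) * nrm (\<lambda>x. c m x - c n x)"
        using nrm_nonneg[OF V_diff[OF V V, of m n]] by (intro mult_right_mono) auto
      also have "\<dots> < (cmod a + 1) * (e / (cmod a + 1))"
        using N that by (intro mult_strict_left_mono) (auto simp: add_nonneg_pos)
      also have "\<dots> = e"
      proof -
        have "cmod a + 1 \<noteq> 0" using norm_ge_zero[of a] by linarith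
        then show ?thesis by simp
      qed
      finally show ?thesis .
    qed
    then show ?thesis by blast
  qed
  then show ?thesis using V V_smult by (simp add: cauchy_def eq)
qed

lemma cauchy_add:
  assumes "cauchy c" "cauchy d"
  shows "cauchy (\<lambda>n x. c n x + d n x)"
  using cauchy_diff[OF assms(1) cauchy_smult[OF assms(2), of "-1"]] by simp

text \<open>Split \<open>\<parallel>a\<^sub>n\<parallel>\<^sup>2 = \<langle>a\<^sub>n, a\<^sub>n -
  a\<^sub>N\<rangle> + \<langle>a\<^sub>n, a\<^sub>N\<rangle>\<close>. The first term is small
  because the sequence is bounded and Cauchy, the second because \<open>a\<^sub>N\<close> is fixed
  and the functions \<open>delta x\<close> span \<open>V\<close>.\<close>

lemma cauchy_null:
  assumes a: "cauchy a" and lim: "\<And>x. x \<in> S \<Longrightarrow> (\<lambda>n. form (a n) (delta x)) \<longlonglongrightarrow> 0"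
  shows "(\<lambda>n. nrm (a n)) \<longlonglongrightarrow> 0"
proof -
  have V: "a n \<in> V" for n using a by (rule cauchy_V)
  have weak: "(\<lambda>n. form (a n) v) \<longlonglongrightarrow> 0" if v: "v \<in> V" for v
  proof -
    have "(\<lambda>n. \<Sum>y | v y \<noteq> 0. cnj (v y) * form (a n) (delta y)) \<longlonglongrightarrow> (\<Sum>y | v y \<noteq> 0. cnj (v y) * 0)"
      using v by (intro tendsto_sum tendsto_mult_left lim) (auto simp: V_def)
    then show ?thesis using form_delta_expand[OF V v] by simp
  qed
  obtain M where M: "M > 0" "\<And>n. nrm (a n) \<le> M" using cauchy_bounded[OF a] by blast
  show ?thesis
  proof (rule LIMSEQ_I)
    fix e :: real assume e: "e > 0"
    \<comment> \<open>The threshold makes each of the two terms at most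
      \<open>e\<^sup>2 / 2\<close>.\<close>
    then have "e\<^sup>2 / (2 * M) > 0" using M by simp
    from cauchyD[OF a this] obtain N where
      N: "\<And>m n. m \<ge> N \<Longrightarrow> n \<ge> N \<Longrightarrow> nrm (\<lambda>x. a m x - a n x) < e\<^sup>2 / (2 * M)" by blast
    obtain N' where N': "\<And>n. n \<ge> N' \<Longrightarrow> cmod (form (a n) (a N) - 0) < e\<^sup>2 / 2"
      using LIMSEQ_D[OF weak[OF V[of N]], of "e\<^sup>2 / 2"] e by auto
    have "nrm (a n) < e" if n: "n \<ge> max N N'" for n
    proof (rule power2_less_imp_less)
      have "(nrm (a n))\<^sup>2 = cmod (form (a n) (a n))"
        using form_self[OF V[of n]] by (simp add: norm_power)
      also have "form (a n) (a n) = form (a n) (\<lambda>x. a n x - a N x) + form (a n) (a N)"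
        using V by (simp add: form_diff_right)
      also have "cmod \<dots> \<le> cmod (form (a n) (\<lambda>x. a n x - a N x)) + cmod (form (a n) (a N))"
        by (rule norm_triangle_ineq)
      also have "cmod (form (a n) (\<lambda>x. a n x - a N x)) \<le> nrm (a n) * nrm (\<lambda>x. a n x - a N x)"
        using V by (intro form_bound V_diff)
      also have "\<dots> \<le> M * (e\<^sup>2 / (2 * M))"
        using N[of n N] n M V nrm_nonneg V_diff by (intro mult_mono) (auto intro: less_imp_le)
      also have "M * (e\<^sup>2 / (2 * M)) = e\<^sup>2 / 2" using M by simp
      finally show "(nrm (a n))\<^sup>2 < e\<^sup>2" using N'[of n] n by simp
    qed (use e in simp)
    then show "\<exists>no. \<forall>n\<ge>no. norm (nrm (a n) - 0) < e"
      using nrm_nonneg[OF V] by (intro exI[of _ "max N N'"]) auto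
  qed
qed

text \<open>The completion is realised on functions: the class of a Cauchy sequence \<open>c\<close> becomes the function
  \<open>x \<mapsto> lim \<langle>c\<^sub>n, \<delta>\<^sub>x\<rangle>\<close>, which determines it by \<open>cauchy_null\<close>. The representations in \<open>irreps\<close> have to
  live on such a type.\<close>

definition represents :: "(nat \<Rightarrow> 'x \<Rightarrow> complex) \<Rightarrow> ('x \<Rightarrow> complex) \<Rightarrow> bool" where
  "represents c F \<longleftrightarrow> cauchy c \<and> (\<forall>x. x \<notin> S \<longrightarrow> F x = 0) \<and>
     (\<forall>x\<in>S. (\<lambda>n. form (c n) (delta x)) \<longlonglongrightarrow> F x)"

lemma represents_V: "represents c F \<Longrightarrow> c n \<in> V"
  by (simp add: represents_def cauchy_V)

lemma represents_add:
  "\<lbrakk>represents c F; represents d G\<rbrakk> \<Longrightarrow> represents (\<lambda>n x. c n x + d n x) (\<lambda>x. F x + G x)"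
  unfolding represents_def
  by (auto simp: cauchy_add form_add_left V_delta cauchy_V intro!: tendsto_add)

lemma represents_smult: "represents c F \<Longrightarrow> represents (\<lambda>n x. a * c n x) (\<lambda>x. a * F x)"
  unfolding represents_def
  by (auto simp: cauchy_smult form_smult_left V_delta cauchy_V intro!: tendsto_mult)

lemma represents_diff:
  "\<lbrakk>represents c F; represents d G\<rbrakk> \<Longrightarrow> represents (\<lambda>n x. c n x - d n x) (\<lambda>x. F x - G x)"
  using represents_add[of c F "\<lambda>n x. -1 * d n x" "\<lambda>x. -1 * G x"] represents_smult[of d G "-1"]
  by simp

lemma represents_unique:
  assumes "represents c F" "represents d F"
  shows "(\<lambda>n. nrm (\<lambda>x. c n x - d n x)) \<longlonglongrightarrow> 0"
  using represents_diff[OF assms] by (intro cauchy_null) (auto simp: represents_def)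

section \<open>The reproducing kernel Hilbert space\<close>

definition rkhs :: "('x \<Rightarrow> complex) inner_space" where
  "rkhs = \<lparr>carrier = {F. \<exists>c. represents c F}, monoid.mult = undefined, one = undefined,
     ring.zero = (\<lambda>x. 0), add = (\<lambda>\<xi> \<eta> x. \<xi> x + \<eta> x), smult = (\<lambda>a \<xi> x. a * \<xi> x),
     ip = (\<lambda>F G. lim (\<lambda>n. form ((SOME c. represents c F) n) ((SOME d. represents d G) n)))\<rparr>"

lemma rkhs_simps [simp]:
  "zero rkhs = (\<lambda>x. 0)" "add rkhs = (\<lambda>\<xi> \<eta> x. \<xi> x + \<eta> x)" "smult rkhs = (\<lambda>a \<xi> x. a * \<xi> x)"
  by (simp_all add: rkhs_def)

lemma rkhs_carrier: "F \<in> carrier rkhs \<longleftrightarrow> (\<exists>c. represents c F)"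
  by (simp add: rkhs_def)

lemma represents_form_diff:
  assumes "cauchy c" "cauchy d" "cauchy c'" "cauchy d'"
    and lc: "(\<lambda>n. nrm (\<lambda>x. c n x - c' n x)) \<longlonglongrightarrow> 0" and ld: "(\<lambda>n. nrm (\<lambda>x. d n x - d' n x)) \<longlonglongrightarrow> 0"
  shows "(\<lambda>n. form (c n) (d n) - form (c' n) (d' n)) \<longlonglongrightarrow> 0"
proof -
  have V: "c n \<in> V" "d n \<in> V" "c' n \<in> V" "d' n \<in> V" for n using assms by (simp_all add: cauchy_V)
  obtain M where M: "M > 0" "\<And>n. nrm (d n) \<le> M" using cauchy_bounded[OF assms(2)] by blast
  obtain M' where M': "M' > 0" "\<And>n. nrm (c' n) \<le> M'" using cauchy_bounded[OF assms(3)] by blast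
  have "(\<lambda>n. nrm (\<lambda>x. c n x - c' n x) * M + M' * nrm (\<lambda>x. d n x - d' n x)) \<longlonglongrightarrow> 0 * M + M' * 0"
    by (intro tendsto_intros lc ld)
  then have z: "(\<lambda>n. nrm (\<lambda>x. c n x - c' n x) * M + M' * nrm (\<lambda>x. d n x - d' n x)) \<longlonglongrightarrow> 0" by simp
  show ?thesis
  proof (rule Lim_null_comparison[OF always_eventually z], rule allI)
    fix n
    have "cmod (form (c n) (d n) - form (c' n) (d' n)) \<le>
      nrm (\<lambda>x. c n x - c' n x) * nrm (d n) + nrm (c' n) * nrm (\<lambda>x. d n x - d' n x)"
      using V by (rule form_diff_bound)
    also have "\<dots> \<le> nrm (\<lambda>x. c n x - c' n x) * M + M' * nrm (\<lambda>x. d n x - d' n x)"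
      using V M M' nrm_nonneg V_diff by (intro add_mono mult_left_mono mult_right_mono) auto
    finally show "cmod (form (c n) (d n) - form (c' n) (d' n)) \<le>
      nrm (\<lambda>x. c n x - c' n x) * M + M' * nrm (\<lambda>x. d n x - d' n x)" .
  qed
qed

lemma form_convergent:
  assumes c: "cauchy c" and d: "cauchy d"
  shows "convergent (\<lambda>n. form (c n) (d n))"
proof (rule Cauchy_convergent, rule CauchyI)
  have V: "c n \<in> V" "d n \<in> V" for n using assms by (simp_all add: cauchy_V)
  obtain M where M: "M > 0" "\<And>n. nrm (d n) \<le> M" using cauchy_bounded[OF d] by blast
  obtain M' where M': "M' > 0" "\<And>n. nrm (c n) \<le> M'" using cauchy_bounded[OF c] by blast
  fix e :: real assume e: "e > 0"
  obtain N1 where N1: "\<And>m n. m \<ge> N1 \<Longrightarrow> n \<ge> N1 \<Longrightarrow> nrm (\<lambda>x. c m x - c n x) < e / (2 * M)"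
    using cauchyD[OF c, of "e / (2 * M)"] e M by auto
  obtain N2 where N2: "\<And>m n. m \<ge> N2 \<Longrightarrow> n \<ge> N2 \<Longrightarrow> nrm (\<lambda>x. d m x - d n x) < e / (2 * M')"
    using cauchyD[OF d, of "e / (2 * M')"] e M' by auto
  have "cmod (form (c m) (d m) - form (c n) (d n)) < e" if m: "m \<ge> max N1 N2" and n: "n \<ge> max N1 N2" for m n
  proof -
    have "cmod (form (c m) (d m) - form (c n) (d n)) \<le>
      nrm (\<lambda>x. c m x - c n x) * nrm (d m) + nrm (c n) * nrm (\<lambda>x. d m x - d n x)"
      using V by (intro form_diff_bound)
    also have "\<dots> \<le> nrm (\<lambda>x. c m x - c n x) * M + M' * nrm (\<lambda>x. d m x - d n x)"
      using V M M' nrm_nonneg V_diff by (intro add_mono mult_left_mono mult_right_mono) auto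
    also have "\<dots> < e / (2 * M) * M + M' * (e / (2 * M'))"
      using N1[of m n] N2[of m n] m n M M' by (intro add_strict_mono mult_strict_left_mono mult_strict_right_mono) auto
    also have "\<dots> = e" using M M' by simp
    finally show ?thesis .
  qed
  then show "\<exists>K. \<forall>m\<ge>K. \<forall>n\<ge>K. norm (form (c m) (d m) - form (c n) (d n)) < e" by blast
qed

text \<open>Two sequences that represent the same function differ by a null sequence
  (\<open>represents_unique\<close>), so the choice made by \<open>SOME\<close> in
  \<open>rkhs\<close> does not affect the limit.\<close>

lemma ip_lim:
  assumes c: "represents c F" and d: "represents d G"
  shows "(\<lambda>n. form (c n) (d n)) \<longlonglongrightarrow> ip rkhs F G"
proof -
  define c' where "c' = (SOME c. represents c F)"
  define d' where "d' = (SOME d. represents d G)"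
  have c': "represents c' F" unfolding c'_def by (rule someI[of "\<lambda>c. represents c F", OF c])
  have d': "represents d' G" unfolding d'_def by (rule someI[of "\<lambda>d. represents d G", OF d])
  have cau: "cauchy c" "cauchy d" "cauchy c'" "cauchy d'"
    using c d c' d' by (simp_all add: represents_def)
  have "(\<lambda>n. form (c' n) (d' n)) \<longlonglongrightarrow> ip rkhs F G"
    using form_convergent[OF cau(3,4)] unfolding convergent_LIMSEQ_iff
    by (simp add: rkhs_def c'_def d'_def)
  moreover have "(\<lambda>n. form (c n) (d n) - form (c' n) (d' n)) \<longlonglongrightarrow> 0"
    using cau represents_unique[OF c c'] represents_unique[OF d d'] by (rule represents_form_diff)
  ultimately have "(\<lambda>n. (form (c n) (d n) - form (c' n) (d' n)) + form (c' n) (d' n)) \<longlonglongrightarrow> 0 + ip rkhs F G"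
    by (intro tendsto_add)
  then show ?thesis by simp
qed

definition embed :: "('x \<Rightarrow> complex) \<Rightarrow> 'x \<Rightarrow> complex" where
  "embed v x = (if x \<in> S then form v (delta x) else 0)"

lemma represents_embed: "v \<in> V \<Longrightarrow> represents (\<lambda>n. v) (embed v)"
  by (simp add: represents_def cauchy_const embed_def)

lemma embed_carrier: "v \<in> V \<Longrightarrow> embed v \<in> carrier rkhs"
  using represents_embed rkhs_carrier by blast

lemma module_rkhs: "module complex_ring rkhs"
proof (rule function_module)
  show "(\<lambda>x. 0) \<in> carrier rkhs"
    using represents_smult[OF represents_embed[OF V_zero], of 0] by (auto simp: rkhs_carrier)
  show "(\<lambda>x. F x + G x) \<in> carrier rkhs" if "F \<in> carrier rkhs" "G \<in> carrier rkhs" for F G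
    using that represents_add by (fastforce simp: rkhs_carrier)
  show "(\<lambda>x. a * F x) \<in> carrier rkhs" if "F \<in> carrier rkhs" for a F
    using that represents_smult by (fastforce simp: rkhs_carrier)
qed simp_all

lemma rkhs_minus: "\<lbrakk>F \<in> carrier rkhs; G \<in> carrier rkhs\<rbrakk> \<Longrightarrow> F \<ominus>\<^bsub>rkhs\<^esub> G = (\<lambda>x. F x - G x)"
  by (rule function_module_minus[OF module_rkhs]) simp_all

text \<open>The algebraic laws pass to the limit along representing sequences. Definiteness uses the
  realisation by functions: if the norms of \<open>c n\<close> tend to 0, Cauchy-Schwarz against
  \<open>delta x\<close> forces every value \<open>F x\<close> to be 0.\<close>

sublocale pre_hilbert_space rkhs
proof -
  interpret module complex_ring rkhs by (rule module_rkhs)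
  show "pre_hilbert_space rkhs"
  proof
    fix F assume "F \<in> carrier rkhs"
    then obtain c where c: "represents c F" by (auto simp: rkhs_carrier)
    have cV: "c n \<in> V" for n using c by (rule represents_V)
    {
      fix G H assume "G \<in> carrier rkhs" "H \<in> carrier rkhs"
      then obtain d e where d: "represents d G" and e: "represents e H" by (auto simp: rkhs_carrier)
      have "(\<lambda>n. form (c n) (e n) + form (d n) (e n)) \<longlonglongrightarrow> ip rkhs (F \<oplus>\<^bsub>rkhs\<^esub> G) H"
        using ip_lim[OF represents_add[OF c d] e] represents_V[OF d] represents_V[OF e] cV
        by (simp add: form_add_left)
      moreover have "(\<lambda>n. form (c n) (e n) + form (d n) (e n)) \<longlonglongrightarrow> ip rkhs F H + ip rkhs G H"
        using c d e by (intro tendsto_add ip_lim)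
      ultimately show "ip rkhs (F \<oplus>\<^bsub>rkhs\<^esub> G) H = ip rkhs F H + ip rkhs G H"
        by (rule LIMSEQ_unique)
    next
      fix G a assume "G \<in> carrier rkhs"
      then obtain d where d: "represents d G" by (auto simp: rkhs_carrier)
      have "(\<lambda>n. a * form (c n) (d n)) \<longlonglongrightarrow> ip rkhs (a \<odot>\<^bsub>rkhs\<^esub> F) G"
        using ip_lim[OF represents_smult[OF c, of a] d] represents_V[OF d] cV
        by (simp add: form_smult_left)
      moreover have "(\<lambda>n. a * form (c n) (d n)) \<longlonglongrightarrow> a * ip rkhs F G"
        using c d by (intro tendsto_mult_left ip_lim)
      ultimately show "ip rkhs (a \<odot>\<^bsub>rkhs\<^esub> F) G = a * ip rkhs F G" by (rule LIMSEQ_unique)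
    next
      fix G assume "G \<in> carrier rkhs"
      then obtain d where d: "represents d G" by (auto simp: rkhs_carrier)
      have "(\<lambda>n. cnj (form (c n) (d n))) \<longlonglongrightarrow> ip rkhs G F"
        using ip_lim[OF d c] represents_V[OF d] cV by (simp add: form_commute[symmetric])
      moreover have "(\<lambda>n. cnj (form (c n) (d n))) \<longlonglongrightarrow> cnj (ip rkhs F G)"
        using c d by (intro tendsto_cnj ip_lim)
      ultimately show "ip rkhs G F = cnj (ip rkhs F G)" by (rule LIMSEQ_unique)
    }
    have l: "(\<lambda>n. (nrm (c n))\<^sup>2) \<longlonglongrightarrow> Re (ip rkhs F F)"
      using tendsto_Re[OF ip_lim[OF c c]] by (simp add: form_self[OF cV])
    assume nz: "F \<noteq> \<zero>\<^bsub>rkhs\<^esub>"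
    show "0 < Re (ip rkhs F F)"
    proof (rule ccontr)
      assume "\<not> 0 < Re (ip rkhs F F)"
      moreover have "0 \<le> Re (ip rkhs F F)"
        by (rule LIMSEQ_le_const[OF l]) simp
      ultimately have "(\<lambda>n. (nrm (c n))\<^sup>2) \<longlonglongrightarrow> 0" using l by simp
      then have "(\<lambda>n. sqrt ((nrm (c n))\<^sup>2)) \<longlonglongrightarrow> sqrt 0" by (rule tendsto_real_sqrt)
      then have n0: "(\<lambda>n. nrm (c n)) \<longlonglongrightarrow> 0" using nrm_nonneg[OF cV] by simp
      have "F x = 0" for x
      proof (cases "x \<in> S")
        case True
        have "(\<lambda>n. nrm (c n) * nrm (delta x)) \<longlonglongrightarrow> 0 * nrm (delta x)"
          by (intro tendsto_mult_right n0)
        then have "(\<lambda>n. nrm (c n) * nrm (delta x)) \<longlonglongrightarrow> 0" by simp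
        then have "(\<lambda>n. form (c n) (delta x)) \<longlonglongrightarrow> 0"
          by (rule Lim_null_comparison[rotated]) (simp add: form_bound cV V_delta True)
        moreover have "(\<lambda>n. form (c n) (delta x)) \<longlonglongrightarrow> F x" using c True by (simp add: represents_def)
        ultimately show ?thesis using LIMSEQ_unique by blast
      qed (use c in \<open>simp add: represents_def\<close>)
      then have "F = (\<lambda>x. 0)" by (rule ext)
      with nz show False by simp
    qed
  qed
qed

lemma hnorm_represents:
  assumes "represents c F"
  shows "(\<lambda>n. nrm (c n)) \<longlonglongrightarrow> hnorm rkhs F"
proof -
  have V: "c n \<in> V" for n using assms by (rule represents_V)
  have "(\<lambda>n. sqrt (Re (form (c n) (c n)))) \<longlonglongrightarrow> hnorm rkhs F"
    unfolding hnorm_def by (intro tendsto_real_sqrt tendsto_Re ip_lim assms)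
  then show ?thesis using nrm_nonneg[OF V] by (simp add: form_self[OF V])
qed

lemma hnorm_embed: "v \<in> V \<Longrightarrow> hnorm rkhs (embed v) = nrm v"
  using LIMSEQ_unique[OF hnorm_represents[OF represents_embed, of v] tendsto_const] by simp

lemma embed_diff: "\<lbrakk>v \<in> V; w \<in> V\<rbrakk> \<Longrightarrow> embed (\<lambda>x. v x - w x) = (\<lambda>x. embed v x - embed w x)"
  by (auto simp: embed_def form_diff_left V_delta)

text \<open>The seminorm of \<open>c n - c m\<close> is below \<open>e/2\<close> for large indices;
  letting \<open>m\<close> tend to infinity replaces \<open>c m\<close> by \<open>F\<close>. Thus
  the image of \<open>V\<close> is dense.\<close>

lemma embed_approx:
  assumes c: "represents c F"
  shows "(\<lambda>n. hnorm rkhs (embed (c n) \<ominus>\<^bsub>rkhs\<^esub> F)) \<longlonglongrightarrow> 0"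
proof (rule LIMSEQ_I)
  have V: "c n \<in> V" for n using c by (rule represents_V)
  have F: "F \<in> carrier rkhs" using c rkhs_carrier by blast
  fix e :: real assume e: "e > 0"
  obtain N where N: "\<And>m n. m \<ge> N \<Longrightarrow> n \<ge> N \<Longrightarrow> nrm (\<lambda>x. c m x - c n x) < e/2"
    using cauchyD[of c "e/2"] c e by (auto simp: represents_def)
  have "hnorm rkhs (embed (c n) \<ominus>\<^bsub>rkhs\<^esub> F) < e" if n: "n \<ge> N" for n
  proof -
    have "(\<lambda>m. nrm (\<lambda>x. c n x - c m x)) \<longlonglongrightarrow> hnorm rkhs (\<lambda>x. embed (c n) x - F x)"
      by (rule hnorm_represents[OF represents_diff[OF represents_embed[OF V] c]])
    then have "hnorm rkhs (\<lambda>x. embed (c n) x - F x) \<le> e/2"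
      by (rule LIMSEQ_le_const2) (use N n in \<open>auto intro!: exI[of _ N] less_imp_le\<close>)
    then show ?thesis using e F embed_carrier[OF V] by (simp add: rkhs_minus)
  qed
  then show "\<exists>no. \<forall>n\<ge>no. norm (hnorm rkhs (embed (c n) \<ominus>\<^bsub>rkhs\<^esub> F) - 0) < e"
    using F embed_carrier[OF V] semi.hnorm_nonneg by (intro exI[of _ N]) auto
qed

lemma reproducing:
  assumes F: "F \<in> carrier rkhs" and x: "x \<in> S"
  shows "ip rkhs F (embed (delta x)) = F x"
proof -
  obtain c where c: "represents c F" using F by (auto simp: rkhs_carrier)
  have "(\<lambda>n. form (c n) (delta x)) \<longlonglongrightarrow> ip rkhs F (embed (delta x))"
    by (rule ip_lim[OF c represents_embed[OF V_delta[OF x]]])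
  moreover have "(\<lambda>n. form (c n) (delta x)) \<longlonglongrightarrow> F x" using c x by (simp add: represents_def)
  ultimately show ?thesis by (rule LIMSEQ_unique)
qed

lemma cauchy_represents:
  assumes c: "cauchy c"
  obtains F where "represents c F"
proof
  show "represents c (\<lambda>x. if x \<in> S then lim (\<lambda>n. form (c n) (delta x)) else 0)"
    using c form_convergent[OF c cauchy_const[OF V_delta]]
    by (simp add: represents_def convergent_LIMSEQ_iff)
qed

text \<open>Approximate the \<open>k\<close>-th term by \<open>embed (v k)\<close> up to
  \<open>1 / (k + 1)\<close>. The sequence \<open>v\<close> is then Cauchy in the seminorm, and the
  function that it represents is the limit sought.\<close>

sublocale hilbert_space rkhs
proof (rule hilbert_spaceI)
  fix \<sigma> :: "nat \<Rightarrow> 'x \<Rightarrow> complex"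
  assume in_H: "\<And>n. \<sigma> n \<in> carrier rkhs"
    and cau: "\<And>e. e > 0 \<Longrightarrow> \<exists>N. \<forall>m\<ge>N. \<forall>n\<ge>N. hnorm rkhs (\<sigma> m \<ominus>\<^bsub>rkhs\<^esub> \<sigma> n) < e"
  have "\<exists>v\<in>V. hnorm rkhs (embed v \<ominus>\<^bsub>rkhs\<^esub> \<sigma> k) < 1 / real (Suc k)" for k
  proof -
    obtain c where c: "represents c (\<sigma> k)" using in_H[of k] by (auto simp: rkhs_carrier)
    have "1 / real (Suc k) > 0" by simp
    from LIMSEQ_D[OF embed_approx[OF c] this] obtain n where
      "norm (hnorm rkhs (embed (c n) \<ominus>\<^bsub>rkhs\<^esub> \<sigma> k) - 0) < 1 / real (Suc k)" by blast
    then show ?thesis using represents_V[OF c] by (intro bexI[of _ "c n"]) auto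
  qed
  then obtain v where V: "\<And>k. v k \<in> V"
    and v: "\<And>k. hnorm rkhs (embed (v k) \<ominus>\<^bsub>rkhs\<^esub> \<sigma> k) < 1 / real (Suc k)" by metis
  have e: "embed (v k) \<in> carrier rkhs" for k using V by (rule embed_carrier)
  have "cauchy v"
    unfolding cauchy_def
  proof (intro conjI allI impI V)
    fix r :: real assume r: "r > 0"
    obtain N1 where N1: "\<And>m n. m \<ge> N1 \<Longrightarrow> n \<ge> N1 \<Longrightarrow> hnorm rkhs (\<sigma> m \<ominus>\<^bsub>rkhs\<^esub> \<sigma> n) < r/3"
      using cau[of "r/3"] r by auto
    obtain N2 where N2: "1 / real (Suc N2) < r/3"
      using reals_Archimedean[of "r/3"] r by (auto simp: inverse_eq_divide)
    have "nrm (\<lambda>x. v m x - v n x) < r" if m: "m \<ge> max N1 N2" and n: "n \<ge> max N1 N2" for m n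
    proof -
      have s: "1 / real (Suc m) \<le> 1 / real (Suc N2)" "1 / real (Suc n) \<le> 1 / real (Suc N2)"
        using m n by (auto intro!: divide_left_mono)
      have "nrm (\<lambda>x. v m x - v n x) = hnorm rkhs (embed (v m) \<ominus>\<^bsub>rkhs\<^esub> embed (v n))"
        using V V_diff by (simp add: rkhs_minus e embed_diff[symmetric] hnorm_embed)
      also have "\<dots> \<le> hnorm rkhs (embed (v m) \<ominus>\<^bsub>rkhs\<^esub> \<sigma> m) + hnorm rkhs (\<sigma> m \<ominus>\<^bsub>rkhs\<^esub> embed (v n))"
        by (rule semi.hnorm_diff_triangle[OF e in_H e])
      also have "hnorm rkhs (\<sigma> m \<ominus>\<^bsub>rkhs\<^esub> embed (v n)) \<le>
          hnorm rkhs (\<sigma> m \<ominus>\<^bsub>rkhs\<^esub> \<sigma> n) + hnorm rkhs (\<sigma> n \<ominus>\<^bsub>rkhs\<^esub> embed (v n))"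
        by (rule semi.hnorm_diff_triangle[OF in_H in_H e])
      also have "hnorm rkhs (\<sigma> n \<ominus>\<^bsub>rkhs\<^esub> embed (v n)) = hnorm rkhs (embed (v n) \<ominus>\<^bsub>rkhs\<^esub> \<sigma> n)"
        by (rule semi.hnorm_minus_commute[OF in_H e])
      finally show ?thesis using v[of m] v[of n] N1[of m n] N2 s m n by linarith
    qed
    then show "\<exists>N. \<forall>m\<ge>N. \<forall>n\<ge>N. nrm (\<lambda>x. v m x - v n x) < r" by blast
  qed
  then obtain F where F: "represents v F" by (rule cauchy_represents)
  then have FH: "F \<in> carrier rkhs" using rkhs_carrier by blast
  have "(\<lambda>n. 1 / real (Suc n) + hnorm rkhs (embed (v n) \<ominus>\<^bsub>rkhs\<^esub> F)) \<longlonglongrightarrow> 0 + 0"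
    by (rule tendsto_add[OF LIMSEQ_Suc[OF lim_const_over_n] embed_approx[OF F]])
  then have z: "(\<lambda>n. 1 / real (Suc n) + hnorm rkhs (embed (v n) \<ominus>\<^bsub>rkhs\<^esub> F)) \<longlonglongrightarrow> 0" by simp
  have "(\<lambda>n. hnorm rkhs (\<sigma> n \<ominus>\<^bsub>rkhs\<^esub> F)) \<longlonglongrightarrow> 0"
  proof (rule Lim_null_comparison[OF always_eventually z], rule allI)
    fix n
    have "hnorm rkhs (\<sigma> n \<ominus>\<^bsub>rkhs\<^esub> F) \<le> hnorm rkhs (\<sigma> n \<ominus>\<^bsub>rkhs\<^esub> embed (v n)) + hnorm rkhs (embed (v n) \<ominus>\<^bsub>rkhs\<^esub> F)"
      by (rule semi.hnorm_diff_triangle[OF in_H e FH])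
    moreover have "hnorm rkhs (\<sigma> n \<ominus>\<^bsub>rkhs\<^esub> embed (v n)) < 1 / real (Suc n)"
      using v[of n] semi.hnorm_minus_commute[OF in_H e, of n n] by simp
    moreover have "0 \<le> hnorm rkhs (\<sigma> n \<ominus>\<^bsub>rkhs\<^esub> F)"
      using in_H FH by (intro semi.hnorm_nonneg) auto
    ultimately show "norm (hnorm rkhs (\<sigma> n \<ominus>\<^bsub>rkhs\<^esub> F)) \<le> 1 / real (Suc n) + hnorm rkhs (embed (v n) \<ominus>\<^bsub>rkhs\<^esub> F)"
      by simp
  qed
  with FH show "\<exists>F\<in>carrier rkhs. (\<lambda>n. hnorm rkhs (\<sigma> n \<ominus>\<^bsub>rkhs\<^esub> F)) \<longlonglongrightarrow> 0" by blast
qed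

end

section \<open>Functions of positive type and the GNS construction\<close>

text \<open>With the argument \<open>y\<^sup>-\<^sup>1 x\<close>, a coefficient
  \<open>\<phi> g = \<langle>\<pi>(g) \<xi>, \<xi>\<rangle>\<close> turns the double sum into the
  squared norm of \<open>\<Sum> c x \<pi>(x) \<xi>\<close>.\<close>

definition positive_definite :: "('g, 'm) monoid_scheme \<Rightarrow> ('g \<Rightarrow> complex) \<Rightarrow> bool" where
  "positive_definite G \<phi> \<longleftrightarrow> (\<forall>x\<in>carrier G. \<phi> (inv\<^bsub>G\<^esub> x) = cnj (\<phi> x)) \<and>
     (\<forall>F c. finite F \<longrightarrow> F \<subseteq> carrier G \<longrightarrow>
       0 \<le> Re (\<Sum>x\<in>F. \<Sum>y\<in>F. c x * cnj (c y) * \<phi> (inv\<^bsub>G\<^esub> y \<otimes>\<^bsub>G\<^esub> x)))"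

text \<open>The value 0 off the carrier makes such a function determined by its values on the group;
  compactness and extremality can then be stated in the full function type.\<close>

definition normalized_pd :: "('g, 'm) monoid_scheme \<Rightarrow> ('g \<Rightarrow> complex) set" where
  "normalized_pd G = {\<phi>. positive_definite G \<phi> \<and> \<phi> \<one>\<^bsub>G\<^esub> = 1 \<and> (\<forall>x. x \<notin> carrier G \<longrightarrow> \<phi> x = 0)}"

text \<open>The extreme points. Asking for \<open>\<phi>1 = \<phi>\<close> covers
  \<open>\<phi>2\<close> as well, since the summands may be exchanged with \<open>t\<close> replaced
  by \<open>1 - t\<close>.\<close>

definition pure_pd :: "('g, 'm) monoid_scheme \<Rightarrow> ('g \<Rightarrow> complex) \<Rightarrow> bool" where
  "pure_pd G \<phi> \<longleftrightarrow> \<phi> \<in> normalized_pd G \<and> (\<forall>\<phi>1\<in>normalized_pd G. \<forall>\<phi>2\<in>normalized_pd G. \<forall>t::real.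
     0 < t \<longrightarrow> t < 1 \<longrightarrow> (\<forall>x. \<phi> x = of_real t * \<phi>1 x + of_real (1 - t) * \<phi>2 x) \<longrightarrow> \<phi>1 = \<phi>)"

section \<open>Unitary representations and their diagonal coefficients\<close>

locale unitary_representation = hilbert_space H + G: group G
  for G :: "('g, 'm) monoid_scheme" and H :: "'v inner_space" +
  fixes \<pi> :: "'g \<Rightarrow> 'v \<Rightarrow> 'v"
  assumes rep: "unitary_rep G (H, \<pi>)"
begin

lemma rep_closed [simp]: "\<lbrakk>g \<in> carrier G; x \<in> carrier H\<rbrakk> \<Longrightarrow> \<pi> g x \<in> carrier H"
  using rep by (auto simp: unitary_rep_def unitary_map_def complex_linear_map_def)

lemma rep_add: "\<lbrakk>g \<in> carrier G; x \<in> carrier H; y \<in> carrier H\<rbrakk> \<Longrightarrow> \<pi> g (x \<oplus>\<^bsub>H\<^esub> y) = \<pi> g x \<oplus>\<^bsub>H\<^esub> \<pi> g y"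
  using rep by (auto simp: unitary_rep_def unitary_map_def complex_linear_map_def)

lemma rep_smult: "\<lbrakk>g \<in> carrier G; x \<in> carrier H\<rbrakk> \<Longrightarrow> \<pi> g (a \<odot>\<^bsub>H\<^esub> x) = a \<odot>\<^bsub>H\<^esub> \<pi> g x"
  using rep by (auto simp: unitary_rep_def unitary_map_def complex_linear_map_def)

lemma rep_ip: "\<lbrakk>g \<in> carrier G; x \<in> carrier H; y \<in> carrier H\<rbrakk> \<Longrightarrow> ip H (\<pi> g x) (\<pi> g y) = ip H x y"
  using rep by (auto simp: unitary_rep_def unitary_map_def)

lemma rep_one: "x \<in> carrier H \<Longrightarrow> \<pi> \<one>\<^bsub>G\<^esub> x = x"
  using rep by (auto simp: unitary_rep_def)

lemma rep_mult: "\<lbrakk>g \<in> carrier G; h \<in> carrier G; x \<in> carrier H\<rbrakk> \<Longrightarrow> \<pi> (g \<otimes>\<^bsub>G\<^esub> h) x = \<pi> g (\<pi> h x)"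
  using rep by (auto simp: unitary_rep_def)

lemma rep_inv_left:
  assumes "g \<in> carrier G" "x \<in> carrier H" "y \<in> carrier H"
  shows "ip H (\<pi> g x) y = ip H x (\<pi> (inv\<^bsub>G\<^esub> g) y)"
  using rep_ip[of "inv\<^bsub>G\<^esub> g" "\<pi> g x" y] assms rep_mult[of "inv\<^bsub>G\<^esub> g" g x]
  by (simp add: rep_one)

lemma rep_hnorm: "\<lbrakk>g \<in> carrier G; x \<in> carrier H\<rbrakk> \<Longrightarrow> hnorm H (\<pi> g x) = hnorm H x"
  by (simp add: hnorm_def rep_ip)

text \<open>The double sum is \<open>a\<close> times the squared norm of
  \<open>\<Sum> c x \<pi>(x) \<xi>\<close>. The factor \<open>a\<close> is there for
  \<open>irreducible_gns\<close>, which normalizes coefficients of vectors that are not unit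
  vectors.\<close>

lemma coefficient_positive_definite:
  assumes \<xi>: "\<xi> \<in> carrier H" and a: "a = of_real r" "0 \<le> r"
  shows "positive_definite G (\<lambda>g. if g \<in> carrier G then a * ip H (\<pi> g \<xi>) \<xi> else 0)"
  unfolding positive_definite_def
proof (intro conjI ballI allI impI)
  fix x assume x: "x \<in> carrier G"
  have "ip H (\<pi> (inv\<^bsub>G\<^esub> x) \<xi>) \<xi> = ip H \<xi> (\<pi> x \<xi>)"
    using rep_inv_left[of "inv\<^bsub>G\<^esub> x" \<xi> \<xi>] x \<xi> by simp
  also have "\<dots> = cnj (ip H (\<pi> x \<xi>) \<xi>)" by (rule ip_commute) (use x \<xi> in auto)
  finally show "(if inv\<^bsub>G\<^esub> x \<in> carrier G then a * ip H (\<pi> (inv\<^bsub>G\<^esub> x) \<xi>) \<xi> else 0) =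
      cnj (if x \<in> carrier G then a * ip H (\<pi> x \<xi>) \<xi> else 0)"
    using x a by simp
next
  fix F and c :: "'g \<Rightarrow> complex" assume fin: "finite F" and F: "F \<subseteq> carrier G"
  let ?v = "finsum H (\<lambda>x. c x \<odot>\<^bsub>H\<^esub> \<pi> x \<xi>) F"
  have f: "(\<lambda>x. c x \<odot>\<^bsub>H\<^esub> \<pi> x \<xi>) \<in> F \<rightarrow> carrier H" using F \<xi> by auto
  have v: "?v \<in> carrier H" by (rule finsum_closed[OF f])
  have *: "ip H (\<pi> x \<xi>) (\<pi> y \<xi>) = ip H (\<pi> (inv\<^bsub>G\<^esub> y \<otimes>\<^bsub>G\<^esub> x) \<xi>) \<xi>"
    if xyF: "x \<in> F" "y \<in> F" for x y
  proof -
    have xy: "x \<in> carrier G" "y \<in> carrier G" using xyF F by auto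
    have "ip H (\<pi> (inv\<^bsub>G\<^esub> y \<otimes>\<^bsub>G\<^esub> x) \<xi>) \<xi> = ip H (\<pi> (inv\<^bsub>G\<^esub> y) (\<pi> x \<xi>)) \<xi>"
      using xy \<xi> by (simp add: rep_mult)
    also have "\<dots> = ip H (\<pi> x \<xi>) (\<pi> y \<xi>)"
      using rep_inv_left[of "inv\<^bsub>G\<^esub> y" "\<pi> x \<xi>" \<xi>] xy \<xi> by simp
    finally show ?thesis by simp
  qed
  have "ip H ?v ?v = (\<Sum>x\<in>F. ip H (c x \<odot>\<^bsub>H\<^esub> \<pi> x \<xi>) ?v)"
    by (rule semi.ip_finsum_left[OF fin f v])
  also have "\<dots> = (\<Sum>x\<in>F. \<Sum>y\<in>F. ip H (c x \<odot>\<^bsub>H\<^esub> \<pi> x \<xi>) (c y \<odot>\<^bsub>H\<^esub> \<pi> y \<xi>))"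
    using f by (intro sum.cong refl semi.ip_finsum_right[OF fin f]) auto
  also have "\<dots> = (\<Sum>x\<in>F. \<Sum>y\<in>F. c x * cnj (c y) * ip H (\<pi> (inv\<^bsub>G\<^esub> y \<otimes>\<^bsub>G\<^esub> x) \<xi>) \<xi>)"
  proof (intro sum.cong refl)
    fix x y assume xy: "x \<in> F" "y \<in> F"
    then have "\<pi> x \<xi> \<in> carrier H" "\<pi> y \<xi> \<in> carrier H" using F \<xi> by auto
    then show "ip H (c x \<odot>\<^bsub>H\<^esub> \<pi> x \<xi>) (c y \<odot>\<^bsub>H\<^esub> \<pi> y \<xi>) =
        c x * cnj (c y) * ip H (\<pi> (inv\<^bsub>G\<^esub> y \<otimes>\<^bsub>G\<^esub> x) \<xi>) \<xi>"
      by (simp add: semi.ip_smult_left semi.ip_smult_right *[OF xy])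
  qed
  finally have eq: "a * ip H ?v ?v = (\<Sum>x\<in>F. \<Sum>y\<in>F. c x * cnj (c y) *
      (if inv\<^bsub>G\<^esub> y \<otimes>\<^bsub>G\<^esub> x \<in> carrier G then a * ip H (\<pi> (inv\<^bsub>G\<^esub> y \<otimes>\<^bsub>G\<^esub> x) \<xi>) \<xi> else 0))"
    using F by (auto simp: sum_distrib_left subset_iff intro!: sum.cong)
  have "0 \<le> Re (a * ip H ?v ?v)"
    using a semi.ip_nonneg[OF v] by simp
  then show "0 \<le> Re (\<Sum>x\<in>F. \<Sum>y\<in>F. c x * cnj (c y) *
      (if inv\<^bsub>G\<^esub> y \<otimes>\<^bsub>G\<^esub> x \<in> carrier G then a * ip H (\<pi> (inv\<^bsub>G\<^esub> y \<otimes>\<^bsub>G\<^esub> x) \<xi>) \<xi> else 0))"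
    by (simp only: eq)
qed

end

section \<open>The GNS representation by left translation\<close>

locale gns = G: group G for G :: "('g, 'm) monoid_scheme" +
  fixes \<phi> :: "'g \<Rightarrow> complex"
  assumes pd: "positive_definite G \<phi>"

sublocale gns \<subseteq> psd_kernel "carrier G" "\<lambda>x y. \<phi> (inv\<^bsub>G\<^esub> y \<otimes>\<^bsub>G\<^esub> x)"
proof
  fix x y assume xy: "x \<in> carrier G" "y \<in> carrier G"
  then have "inv\<^bsub>G\<^esub> x \<otimes>\<^bsub>G\<^esub> y = inv\<^bsub>G\<^esub> (inv\<^bsub>G\<^esub> y \<otimes>\<^bsub>G\<^esub> x)" by (simp add: G.inv_mult_group)
  then show "\<phi> (inv\<^bsub>G\<^esub> x \<otimes>\<^bsub>G\<^esub> y) = cnj (\<phi> (inv\<^bsub>G\<^esub> y \<otimes>\<^bsub>G\<^esub> x))"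
    using pd xy by (simp add: positive_definite_def)
qed (use pd in \<open>simp add: positive_definite_def\<close>)

context gns
begin

text \<open>The same formula acts on \<open>V\<close> and on the functions in \<open>rkhs\<close>;
  \<open>represents_translate\<close> shows that the two actions agree.\<close>

definition translate :: "'g \<Rightarrow> ('g \<Rightarrow> complex) \<Rightarrow> 'g \<Rightarrow> complex" where
  "translate h F = (\<lambda>x. if x \<in> carrier G then F (inv\<^bsub>G\<^esub> h \<otimes>\<^bsub>G\<^esub> x) else 0)"

lemma translate_mult:
  "\<lbrakk>g \<in> carrier G; h \<in> carrier G\<rbrakk> \<Longrightarrow> translate (g \<otimes>\<^bsub>G\<^esub> h) F = translate g (translate h F)"
  by (auto simp: translate_def G.inv_mult_group G.m_assoc)

lemma translate_one: "(\<And>x. x \<notin> carrier G \<Longrightarrow> F x = 0) \<Longrightarrow> translate \<one>\<^bsub>G\<^esub> F = F"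
  by (auto simp: translate_def)

lemma support_translate:
  assumes "h \<in> carrier G" "{x. c x \<noteq> 0} \<subseteq> carrier G"
  shows "{x. translate h c x \<noteq> 0} = (\<lambda>x. h \<otimes>\<^bsub>G\<^esub> x) ` {x. c x \<noteq> 0}"
proof (intro equalityI subsetI)
  fix x assume "x \<in> {x. translate h c x \<noteq> 0}"
  then have x: "x \<in> carrier G" "c (inv\<^bsub>G\<^esub> h \<otimes>\<^bsub>G\<^esub> x) \<noteq> 0" by (auto simp: translate_def split: if_splits)
  then have "x = h \<otimes>\<^bsub>G\<^esub> (inv\<^bsub>G\<^esub> h \<otimes>\<^bsub>G\<^esub> x)" using assms by (simp add: G.m_assoc[symmetric])
  with x show "x \<in> (\<lambda>x. h \<otimes>\<^bsub>G\<^esub> x) ` {x. c x \<noteq> 0}" by blast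
next
  fix x assume "x \<in> (\<lambda>x. h \<otimes>\<^bsub>G\<^esub> x) ` {x. c x \<noteq> 0}"
  then obtain y where y: "c y \<noteq> 0" "x = h \<otimes>\<^bsub>G\<^esub> y" by auto
  then have "y \<in> carrier G" using assms by auto
  then show "x \<in> {x. translate h c x \<noteq> 0}"
    using y assms by (simp add: translate_def G.m_assoc[symmetric])
qed

lemma translate_V: "\<lbrakk>h \<in> carrier G; c \<in> V\<rbrakk> \<Longrightarrow> translate h c \<in> V"
  unfolding V_def using support_translate[of h c] by auto

text \<open>The kernel is invariant,
  \<open>(h y)\<^sup>-\<^sup>1 (h x) = y\<^sup>-\<^sup>1 x\<close>, so reindexing both supports by
  left multiplication leaves the sum unchanged.\<close>

lemma translate_form:
  assumes h: "h \<in> carrier G" and c: "c \<in> V" and d: "d \<in> V"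
  shows "form (translate h c) (translate h d) = form c d"
proof -
  have sc: "{x. c x \<noteq> 0} \<subseteq> carrier G" and sd: "{x. d x \<noteq> 0} \<subseteq> carrier G"
    using c d by (auto simp: V_def)
  have inj: "inj_on (\<lambda>x. h \<otimes>\<^bsub>G\<^esub> x) A" if "A \<subseteq> carrier G" for A
    using that h by (auto simp: inj_on_def subset_iff)
  have t: "translate h f (h \<otimes>\<^bsub>G\<^esub> x) = f x" if "x \<in> carrier G" for f x
    using that h by (simp add: translate_def G.m_assoc[symmetric])
  have k: "inv\<^bsub>G\<^esub> (h \<otimes>\<^bsub>G\<^esub> y) \<otimes>\<^bsub>G\<^esub> (h \<otimes>\<^bsub>G\<^esub> x) = inv\<^bsub>G\<^esub> y \<otimes>\<^bsub>G\<^esub> x"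
    if "x \<in> carrier G" "y \<in> carrier G" for x y
  proof -
    have "inv\<^bsub>G\<^esub> (h \<otimes>\<^bsub>G\<^esub> y) \<otimes>\<^bsub>G\<^esub> (h \<otimes>\<^bsub>G\<^esub> x) = inv\<^bsub>G\<^esub> y \<otimes>\<^bsub>G\<^esub> (inv\<^bsub>G\<^esub> h \<otimes>\<^bsub>G\<^esub> (h \<otimes>\<^bsub>G\<^esub> x))"
      using that h by (simp add: G.inv_mult_group G.m_assoc)
    also have "inv\<^bsub>G\<^esub> h \<otimes>\<^bsub>G\<^esub> (h \<otimes>\<^bsub>G\<^esub> x) = x"
      using that h by (simp add: G.m_assoc[symmetric])
    finally show ?thesis .
  qed
  have "form (translate h c) (translate h d) = (\<Sum>x | c x \<noteq> 0. \<Sum>y | d y \<noteq> 0.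
      translate h c (h \<otimes>\<^bsub>G\<^esub> x) * cnj (translate h d (h \<otimes>\<^bsub>G\<^esub> y)) *
      \<phi> (inv\<^bsub>G\<^esub> (h \<otimes>\<^bsub>G\<^esub> y) \<otimes>\<^bsub>G\<^esub> (h \<otimes>\<^bsub>G\<^esub> x)))"
    unfolding form_def support_translate[OF h sc] support_translate[OF h sd]
    by (simp add: sum.reindex[OF inj[OF sc]] sum.reindex[OF inj[OF sd]])
  also have "\<dots> = form c d"
    unfolding form_def using sc sd by (intro sum.cong refl) (auto simp: t k subset_iff)
  finally show ?thesis .
qed

lemma translate_delta:
  "\<lbrakk>h \<in> carrier G; x \<in> carrier G\<rbrakk> \<Longrightarrow> translate h (delta x) = delta (h \<otimes>\<^bsub>G\<^esub> x)"
  by (auto simp: translate_def delta_def fun_eq_iff G.m_assoc[symmetric])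

text \<open>Invariance of the form moves the translation from \<open>c n\<close> to
  \<open>delta x\<close>, where it becomes evaluation at \<open>h\<^sup>-\<^sup>1 x\<close>.\<close>

lemma represents_translate:
  assumes h: "h \<in> carrier G" and c: "represents c F"
  shows "represents (\<lambda>n. translate h (c n)) (translate h F)"
proof -
  have V: "c n \<in> V" for n using c by (rule represents_V)
  have eq: "(\<lambda>x. translate h a x - translate h b x) = translate h (\<lambda>x. a x - b x)" for a b
    by (auto simp: translate_def)
  have nrm: "nrm (translate h a) = nrm a" if "a \<in> V" for a
    using translate_form[OF h that that] by (simp add: nrm_def hnorm_def)
  have "cauchy (\<lambda>n. translate h (c n))"
    using c V h by (simp add: represents_def cauchy_def translate_V eq nrm V_diff)
  moreover have "(\<lambda>n. form (translate h (c n)) (delta x)) \<longlonglongrightarrow> translate h F x" if x: "x \<in> carrier G" for x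
  proof -
    have i: "inv\<^bsub>G\<^esub> h \<otimes>\<^bsub>G\<^esub> x \<in> carrier G" using h x by simp
    have "translate h (delta (inv\<^bsub>G\<^esub> h \<otimes>\<^bsub>G\<^esub> x)) = delta x"
      using h x by (simp add: translate_delta G.m_assoc[symmetric])
    then have "form (translate h (c n)) (delta x) = form (c n) (delta (inv\<^bsub>G\<^esub> h \<otimes>\<^bsub>G\<^esub> x))" for n
      using translate_form[OF h V V_delta[OF i], of n] by simp
    then show ?thesis using c i x by (simp add: represents_def translate_def)
  qed
  ultimately show ?thesis by (simp add: represents_def translate_def)
qed

lemma translate_carrier: "\<lbrakk>h \<in> carrier G; F \<in> carrier rkhs\<rbrakk> \<Longrightarrow> translate h F \<in> carrier rkhs"
  using represents_translate by (auto simp: rkhs_carrier)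

lemma rkhs_support: "\<lbrakk>F \<in> carrier rkhs; x \<notin> carrier G\<rbrakk> \<Longrightarrow> F x = 0"
  by (auto simp: rkhs_carrier represents_def)

lemma unitary_map_translate:
  assumes h: "h \<in> carrier G"
  shows "unitary_map rkhs rkhs (translate h)"
  unfolding unitary_map_def complex_linear_map_def
proof (intro conjI ballI allI)
  show "translate h \<in> carrier rkhs \<rightarrow> carrier rkhs" using h translate_carrier by auto
  show "translate h (F1 \<oplus>\<^bsub>rkhs\<^esub> F2) = translate h F1 \<oplus>\<^bsub>rkhs\<^esub> translate h F2" for F1 F2
    by (auto simp: translate_def)
  show "translate h (a \<odot>\<^bsub>rkhs\<^esub> F1) = a \<odot>\<^bsub>rkhs\<^esub> translate h F1" for a F1
    by (auto simp: translate_def)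
  have i: "inv\<^bsub>G\<^esub> h \<in> carrier G" using h by simp
  have inv1: "translate h (translate (inv\<^bsub>G\<^esub> h) F) = F" if "F \<in> carrier rkhs" for F
    using translate_mult[OF h i, of F] translate_one[of F] rkhs_support[OF that] h by simp
  have inv2: "translate (inv\<^bsub>G\<^esub> h) (translate h F) = F" if "F \<in> carrier rkhs" for F
    using translate_mult[OF i h, of F] translate_one[of F] rkhs_support[OF that] h by simp
  show "bij_betw (translate h) (carrier rkhs) (carrier rkhs)"
    by (rule bij_betw_byWitness[where f' = "translate (inv\<^bsub>G\<^esub> h)"])
      (use inv1 inv2 translate_carrier h i in auto)
  fix F1 F2 assume "F1 \<in> carrier rkhs" "F2 \<in> carrier rkhs"
  then obtain c d where c: "represents c F1" and d: "represents d F2" by (auto simp: rkhs_carrier)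
  have "(\<lambda>n. form (c n) (d n)) \<longlonglongrightarrow> ip rkhs (translate h F1) (translate h F2)"
    using ip_lim[OF represents_translate[OF h c] represents_translate[OF h d]]
    by (simp add: translate_form[OF h represents_V[OF c] represents_V[OF d]])
  then show "ip rkhs (translate h F1) (translate h F2) = ip rkhs F1 F2"
    using ip_lim[OF c d] by (rule LIMSEQ_unique)
qed

lemma unitary_rep_gns: "unitary_rep G (rkhs, translate)"
  unfolding unitary_rep_def
  using unitary_map_translate hilbert_space_axioms translate_one rkhs_support translate_mult by auto

sublocale unitary_representation G rkhs translate
  by unfold_locales (rule unitary_rep_gns)

text \<open>The cyclic vector of the GNS construction; as a function on the group it is
  \<open>x \<mapsto> \<phi> (x\<^sup>-\<^sup>1)\<close>.\<close>

definition cyc :: "'g \<Rightarrow> complex" where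
  "cyc = embed (delta \<one>\<^bsub>G\<^esub>)"

lemma form_delta: "form (delta x) (delta y) = \<phi> (inv\<^bsub>G\<^esub> y \<otimes>\<^bsub>G\<^esub> x)"
proof -
  have "{z. delta w z \<noteq> 0} = {w}" for w :: 'g by (auto simp: delta_def)
  then show ?thesis by (simp add: form_def) (simp add: delta_def)
qed

lemma cyc_carrier [simp]: "cyc \<in> carrier rkhs"
  by (simp add: cyc_def embed_carrier V_delta)

lemma translate_cyc: "g \<in> carrier G \<Longrightarrow> translate g cyc = embed (delta g)"
  by (auto simp: translate_def cyc_def embed_def form_delta G.inv_mult_group fun_eq_iff)

text \<open>The reproducing property, read along the orbit of \<open>cyc\<close>. It shows that a
  vector orthogonal to the orbit is the zero function, and lets vectors be identified by their
  values.\<close>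

lemma ip_translate_cyc: "\<lbrakk>F \<in> carrier rkhs; g \<in> carrier G\<rbrakk> \<Longrightarrow> ip rkhs F (translate g cyc) = F g"
  by (simp add: translate_cyc reproducing)

lemma coefficient_cyc: "g \<in> carrier G \<Longrightarrow> ip rkhs (translate g cyc) cyc = \<phi> g"
  using ip_translate_cyc[of "translate g cyc" "\<one>\<^bsub>G\<^esub>"] rep_one[of cyc]
  by (simp add: translate_carrier) (simp add: translate_def cyc_def embed_def form_delta)

lemma rkhs_eqI: "\<lbrakk>F1 \<in> carrier rkhs; F2 \<in> carrier rkhs; \<And>g. g \<in> carrier G \<Longrightarrow> F1 g = F2 g\<rbrakk> \<Longrightarrow> F1 = F2"
  using rkhs_support by (metis ext)

text \<open>The component of \<open>F\<close> orthogonal to \<open>W\<close> is orthogonal to the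
  orbit of \<open>cyc\<close>, so its value at every group element is 0.\<close>

lemma cyclic:
  assumes W: "submodule W complex_ring rkhs"
    and cl: "closedin (Metric_space.mtopology (carrier rkhs) (hdist rkhs)) W"
    and inv: "\<forall>g\<in>carrier G. translate g ` W \<subseteq> W" and cyc: "cyc \<in> W"
  shows "W = carrier rkhs"
proof
  show sub: "W \<subseteq> carrier rkhs" using submoduleE[OF W] by auto
  show "carrier rkhs \<subseteq> W"
  proof
    fix F assume F: "F \<in> carrier rkhs"
    obtain p where p: "p \<in> W" and orth: "\<And>w. w \<in> W \<Longrightarrow> ip rkhs (F \<ominus>\<^bsub>rkhs\<^esub> p) w = 0"
      using orthogonal_projection[OF W cl F] by blast
    have pH: "p \<in> carrier rkhs" using p sub by auto
    have "F g = p g" if g: "g \<in> carrier G" for g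
    proof -
      have "translate g cyc \<in> W" using inv g cyc by blast
      then have "(F \<ominus>\<^bsub>rkhs\<^esub> p) g = 0" using orth ip_translate_cyc[of "F \<ominus>\<^bsub>rkhs\<^esub> p" g] F pH g by simp
      then show ?thesis using F pH by (simp add: rkhs_minus)
    qed
    then have "F = p" by (rule rkhs_eqI[OF F pH])
    with p show "F \<in> W" by simp
  qed
qed

text \<open>The projection of the cyclic vector to a closed invariant subspace splits \<open>\<phi>\<close> into two functions of
  positive type; if \<open>\<phi>\<close> is extreme, both are multiples of \<open>\<phi>\<close>, so that the projected vector is a
  multiple of the cyclic vector.\<close>

lemma irreducible_gns:
  assumes pure: "pure_pd G \<phi>"
  shows "irreducible_rep G (rkhs, translate)"
proof -
  have norm1: "\<phi> \<one>\<^bsub>G\<^esub> = 1" and supp: "\<And>x. x \<notin> carrier G \<Longrightarrow> \<phi> x = 0"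
    using pure by (auto simp: pure_pd_def normalized_pd_def)
  have cyc1: "ip rkhs cyc cyc = 1" using coefficient_cyc[of "\<one>\<^bsub>G\<^esub>"] norm1 by (simp add: rep_one)
  then have nz: "carrier rkhs \<noteq> {\<zero>\<^bsub>rkhs\<^esub>}"
    using cyc_carrier semi.ip_zero_left[of cyc] by (metis singletonD zero_neq_one)
  have "W = {\<zero>\<^bsub>rkhs\<^esub>} \<or> W = carrier rkhs"
    if W: "submodule W complex_ring rkhs"
      and cl: "closedin (Metric_space.mtopology (carrier rkhs) (hdist rkhs)) W"
      and inv: "\<forall>g\<in>carrier G. translate g ` W \<subseteq> W" for W
  proof -
    have sub: "W \<subseteq> carrier rkhs" and smW: "\<And>a w. w \<in> W \<Longrightarrow> a \<odot>\<^bsub>rkhs\<^esub> w \<in> W" and neW: "W \<noteq> {}"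
      using submoduleE[OF W] by auto
    obtain p where p: "p \<in> W" and orth: "\<And>w. w \<in> W \<Longrightarrow> ip rkhs (cyc \<ominus>\<^bsub>rkhs\<^esub> p) w = 0"
      using orthogonal_projection[OF W cl cyc_carrier] by blast
    define q where "q = cyc \<ominus>\<^bsub>rkhs\<^esub> p"
    have pH: "p \<in> carrier rkhs" using p sub by auto
    have qH: "q \<in> carrier rkhs" using pH by (simp add: q_def)
    have tW: "translate g w \<in> W" if "g \<in> carrier G" "w \<in> W" for g w using inv that by blast
    have qW: "ip rkhs (translate g q) w = 0" if "g \<in> carrier G" "w \<in> W" for g w
      using rep_inv_left[of g q w] orth[OF tW[of "inv\<^bsub>G\<^esub> g" w]] that sub qH by (auto simp: q_def)
    have Wq: "ip rkhs w q = 0" if "w \<in> W" for w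
      using ip_commute[of q w] orth[OF that] that sub qH by (auto simp: q_def)
    have cyc_eq: "cyc = p \<oplus>\<^bsub>rkhs\<^esub> q"
      using pH by (simp add: q_def rkhs_minus)
    \<comment> \<open>The mixed terms vanish because \<open>W\<close> and its orthogonal complement
      are both invariant.\<close>
    have split: "\<phi> g = ip rkhs (translate g p) p + ip rkhs (translate g q) q" if g: "g \<in> carrier G" for g
    proof -
      have "\<phi> g = ip rkhs (translate g (p \<oplus>\<^bsub>rkhs\<^esub> q)) (p \<oplus>\<^bsub>rkhs\<^esub> q)"
        using coefficient_cyc[OF g] cyc_eq by simp
      also have "\<dots> = ip rkhs (translate g p \<oplus>\<^bsub>rkhs\<^esub> translate g q) (p \<oplus>\<^bsub>rkhs\<^esub> q)"
        using rep_add[OF g pH qH] by (simp only:)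
      also have "\<dots> = ip rkhs (translate g p) p + ip rkhs (translate g p) q
          + (ip rkhs (translate g q) p + ip rkhs (translate g q) q)"
        using g pH qH rep_closed[OF g pH] rep_closed[OF g qH]
        by (simp only: semi.ip_add_left semi.ip_add_right M.a_closed) (simp only: ac_simps)
      finally show ?thesis using qW[OF g p] Wq[OF tW[OF g p]] by simp
    qed
    define t where "t = (hnorm rkhs p)\<^sup>2"
    have t0: "0 \<le> t" by (simp add: t_def)
    have pp: "ip rkhs p p = of_real t" using semi.ip_self[OF pH] by (simp add: t_def)
    have qq: "ip rkhs q q = of_real (1 - t)"
      using split[of "\<one>\<^bsub>G\<^esub>"] pH qH norm1 pp by (simp add: rep_one algebra_simps)
    then have t1: "t \<le> 1" using semi.ip_nonneg[OF qH] by simp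
    consider "t = 0" | "t = 1" | "0 < t" "t < 1" using t0 t1 by linarith
    then show ?thesis
    proof cases
      case 1
      then have "p = \<zero>\<^bsub>rkhs\<^esub>" using hnorm_eq_0[OF pH] by (simp add: t_def)
      then have qc: "q = cyc" using pH by (simp add: q_def rkhs_minus)
      \<comment> \<open>In this case \<open>cyc\<close> itself is orthogonal to \<open>W\<close>, so
        each value of \<open>w\<close>, being an inner product with a vector of the orbit,
        vanishes.\<close>
      have "w = \<zero>\<^bsub>rkhs\<^esub>" if w: "w \<in> W" for w
      proof (rule rkhs_eqI)
        show wH: "w \<in> carrier rkhs" using w sub by auto
        fix g assume g: "g \<in> carrier G"
        have "w g = ip rkhs w (translate g cyc)" using ip_translate_cyc[OF wH g] by simp
        also have "\<dots> = cnj (ip rkhs (translate g q) w)"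
          using ip_commute[of "translate g q" w] wH qH g by (simp add: qc)
        finally show "w g = \<zero>\<^bsub>rkhs\<^esub> g" using qW[OF g w] by simp
      qed (rule M.zero_closed)
      then show ?thesis using neW by blast
    next
      case 2
      then have "q = \<zero>\<^bsub>rkhs\<^esub>" using ip_pos[OF qH] qq by force
      then have "cyc = p" using cyc_eq by simp
      then show ?thesis using cyclic[OF W cl inv] p by blast
    next
      case 3
      \<comment> \<open>The squared norms of the two components are \<open>t\<close> and
        \<open>1 - t\<close>; dividing by them gives the value 1 at the identity.\<close>
      define \<phi>1 where "\<phi>1 g = (if g \<in> carrier G then of_real (1 / t) * ip rkhs (translate g p) p else 0)" for g
      define \<phi>2 where "\<phi>2 g = (if g \<in> carrier G then of_real (1 / (1 - t)) * ip rkhs (translate g q) q else 0)" for g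
      have "\<phi>1 \<in> normalized_pd G"
        using coefficient_positive_definite[OF pH refl, of "1 / t"] 3 pp pH
        by (simp add: normalized_pd_def \<phi>1_def[abs_def] rep_one)
      moreover have "\<phi>2 \<in> normalized_pd G"
        using coefficient_positive_definite[OF qH refl, of "1 / (1 - t)"] 3 qq qH
        by (simp add: normalized_pd_def \<phi>2_def[abs_def] rep_one)
      moreover have "\<phi> x = of_real t * \<phi>1 x + of_real (1 - t) * \<phi>2 x" for x
      proof -
        have "complex_of_real t \<noteq> 0" "complex_of_real (1 - t) \<noteq> 0" using 3 by (simp_all del: of_real_diff)
        then show ?thesis
          using split[of x] supp[of x] by (simp add: \<phi>1_def \<phi>2_def del: of_real_diff)
      qed
      ultimately have "\<phi>1 = \<phi>" using pure 3 unfolding pure_pd_def by blast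
      then have \<phi>1: "ip rkhs (translate g p) p = of_real t * \<phi> g" if "g \<in> carrier G" for g
        using that 3 by (auto simp: \<phi>1_def fun_eq_iff field_simps split: if_splits)
      \<comment> \<open>Compare values: \<open>\<langle>\<pi>(g) cyc, p\<rangle> = \<langle>\<pi>(g)
        p, p\<rangle>\<close>, and by extremality this is \<open>t\<close> times
        \<open>\<langle>\<pi>(g) cyc, cyc\<rangle>\<close>.\<close>
      have "p = of_real t \<odot>\<^bsub>rkhs\<^esub> cyc"
      proof (rule rkhs_eqI)
        fix g assume g: "g \<in> carrier G"
        have tq: "translate g cyc = translate g p \<oplus>\<^bsub>rkhs\<^esub> translate g q"
          using cyc_eq rep_add[OF g pH qH] by (simp only:)
        have "p g = cnj (ip rkhs (translate g cyc) p)"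
          using ip_translate_cyc[OF pH g] ip_commute[of "translate g cyc" p] pH g by simp
        also have "ip rkhs (translate g cyc) p = ip rkhs (translate g p) p + ip rkhs (translate g q) p"
          unfolding tq using g pH qH by (intro semi.ip_add_left rep_closed)
        also have "\<dots> = of_real t * ip rkhs (translate g cyc) cyc"
          using \<phi>1[OF g] qW[OF g p] coefficient_cyc[OF g] by simp
        also have "cnj \<dots> = of_real t * ip rkhs cyc (translate g cyc)"
          using ip_commute[of "translate g cyc" cyc] g by simp
        finally show "p g = (of_real t \<odot>\<^bsub>rkhs\<^esub> cyc) g" using ip_translate_cyc[OF cyc_carrier g] by simp
      next
        show "of_real t \<odot>\<^bsub>rkhs\<^esub> cyc \<in> carrier rkhs"
          by (rule smult_closed) simp_all
      qed (rule pH)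
      then have "cyc = of_real (1 / t) \<odot>\<^bsub>rkhs\<^esub> p" using 3 by simp
      then have "cyc \<in> W" using smW[OF p] by metis
      then show ?thesis using cyclic[OF W cl inv] by blast
    qed
  qed
  then show ?thesis
    unfolding irreducible_rep_def using unitary_rep_gns nz by blast
qed

end

section \<open>Extreme points and Kazhdan's inequality\<close>

lemma normalized_pd_gns:
  assumes "group G" "\<phi> \<in> normalized_pd G"
  shows "gns G \<phi>"
  using assms by (simp add: gns_def gns_axioms_def normalized_pd_def)

text \<open>Cauchy-Schwarz in the GNS space, where \<open>\<phi> x\<close> is a coefficient of the
  unit vector \<open>cyc\<close>.\<close>

lemma normalized_pd_bounded:
  assumes G: "group G" and \<phi>: "\<phi> \<in> normalized_pd G"
  shows "cmod (\<phi> x) \<le> 1"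
proof (cases "x \<in> carrier G")
  case True
  interpret gns G \<phi> by (rule normalized_pd_gns[OF G \<phi>])
  have one: "\<phi> \<one>\<^bsub>G\<^esub> = 1" using \<phi> by (simp add: normalized_pd_def)
  have "ip rkhs cyc cyc = 1" using coefficient_cyc[of "\<one>\<^bsub>G\<^esub>"] one by (simp add: rep_one)
  then have h: "hnorm rkhs cyc = 1" by (simp add: hnorm_def)
  have "cmod (ip rkhs (translate x cyc) cyc) \<le> hnorm rkhs (translate x cyc) * hnorm rkhs cyc"
    by (intro semi.cauchy_schwarz rep_closed True cyc_carrier)
  then show ?thesis using True h by (simp add: coefficient_cyc rep_hnorm)
next
  case False
  then show ?thesis using \<phi> by (simp add: normalized_pd_def)
qed

lemma closed_Collect_ball:
  assumes "\<And>x. x \<in> A \<Longrightarrow> closed {\<phi>. P x \<phi>}"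
  shows "closed {\<phi>. \<forall>x\<in>A. P x \<phi>}"
proof -
  have "{\<phi>. \<forall>x\<in>A. P x \<phi>} = (\<Inter>x\<in>A. {\<phi>. P x \<phi>})" by auto
  then show ?thesis using assms by (simp add: closed_INT)
qed

text \<open>Tychonoff: the bound by 1 places the functions in a product of closed discs, and each
  single defining condition involves finitely many coordinates, hence is closed in the product
  topology.\<close>

lemma compact_normalized_pd:
  assumes G: "group G"
  shows "compact (normalized_pd G)"
proof -
  have cont: "continuous_on UNIV (\<lambda>\<phi>::'a \<Rightarrow> complex. \<phi> x)" for x by simp
  let ?A = "{\<phi>. \<forall>x\<in>carrier G. \<phi> (inv\<^bsub>G\<^esub> x) = cnj (\<phi> x)}"
  let ?B = "{\<phi>. \<forall>F\<in>{F. finite F \<and> F \<subseteq> carrier G}. \<forall>c::'a \<Rightarrow> complex.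
      0 \<le> Re (\<Sum>x\<in>F. \<Sum>y\<in>F. c x * cnj (c y) * \<phi> (inv\<^bsub>G\<^esub> y \<otimes>\<^bsub>G\<^esub> x))}"
  let ?C = "{\<phi>. \<phi> \<one>\<^bsub>G\<^esub> = (1::complex)}" and ?D = "{\<phi>. \<forall>x\<in>- carrier G. \<phi> x = (0::complex)}"
  have "closed ?A"
    by (intro closed_Collect_ball closed_Collect_eq continuous_on_cnj cont)
  moreover have "closed ?B"
    by (intro closed_Collect_ball closed_Collect_all closed_Collect_le continuous_intros cont)
  moreover have "closed ?C" by (intro closed_Collect_eq cont continuous_on_const)
  moreover have "closed ?D" by (intro closed_Collect_ball closed_Collect_eq cont continuous_on_const)
  ultimately have cl: "closed (?A \<inter> ?B \<inter> ?C \<inter> ?D)" by (intro closed_Int)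
  have "compactin (product_topology (\<lambda>i::'a. euclidean) UNIV) (PiE UNIV (\<lambda>_. cball (0::complex) 1))"
    unfolding compactin_PiE by (auto simp: compact_cball)
  then have "compact (PiE UNIV (\<lambda>_::'a. cball (0::complex) 1))"
    by (simp add: euclidean_product_topology)
  then have "compact (PiE UNIV (\<lambda>_::'a. cball (0::complex) 1) \<inter> (?A \<inter> ?B \<inter> ?C \<inter> ?D))"
    using cl by (rule compact_Int_closed)
  moreover have "normalized_pd G = PiE UNIV (\<lambda>_::'a. cball (0::complex) 1) \<inter> (?A \<inter> ?B \<inter> ?C \<inter> ?D)"
  proof (intro equalityI subsetI)
    fix \<phi> assume \<phi>: "\<phi> \<in> normalized_pd G"
    then show "\<phi> \<in> PiE UNIV (\<lambda>_::'a. cball (0::complex) 1) \<inter> (?A \<inter> ?B \<inter> ?C \<inter> ?D)"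
      using normalized_pd_bounded[OF G \<phi>] by (auto simp: normalized_pd_def positive_definite_def)
  qed (auto simp: normalized_pd_def positive_definite_def)
  ultimately show ?thesis by simp
qed

text \<open>Nonempty closed faces. Closedness is expressed by a set \<open>T\<close> that is closed
  in the whole function space, the form in which \<open>compact_Int_closed\<close> and the finite
  intersection argument use it.\<close>

definition pd_face :: "('g, 'm) monoid_scheme \<Rightarrow> ('g \<Rightarrow> complex) set \<Rightarrow> bool" where
  "pd_face G F \<longleftrightarrow> F \<subseteq> normalized_pd G \<and> F \<noteq> {} \<and> (\<exists>T. closed T \<and> F = normalized_pd G \<inter> T) \<and>
     (\<forall>\<phi>1\<in>normalized_pd G. \<forall>\<phi>2\<in>normalized_pd G. \<forall>t::real. 0 < t \<longrightarrow> t < 1 \<longrightarrow>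
       (\<lambda>x. of_real t * \<phi>1 x + of_real (1 - t) * \<phi>2 x) \<in> F \<longrightarrow> \<phi>1 \<in> F \<and> \<phi>2 \<in> F)"

text \<open>Affine instead of linear, because the functional minimised in
  \<open>kazhdan_inequality\<close> has constant terms.\<close>

definition affine_functional :: "(('g \<Rightarrow> complex) \<Rightarrow> real) \<Rightarrow> bool" where
  "affine_functional L \<longleftrightarrow> continuous_on UNIV L \<and> (\<forall>\<phi>1 \<phi>2 t.
     L (\<lambda>x. of_real t * \<phi>1 x + of_real (1 - t) * \<phi>2 x) = t * L \<phi>1 + (1 - t) * L \<phi>2)"

text \<open>Compactness supplies the minimum. A proper convex combination of two values, both at
  least the minimum, equals the minimum only if both values do.\<close>

lemma pd_face_argmin:
  assumes G: "group G" and F: "pd_face G F" and L: "affine_functional L"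
  shows "pd_face G {\<phi> \<in> F. \<forall>\<psi>\<in>F. L \<phi> \<le> L \<psi>}"
proof -
  obtain T where T: "closed T" "F = normalized_pd G \<inter> T" using F by (auto simp: pd_face_def)
  have cont: "continuous_on UNIV L"
    and aff: "\<And>\<phi>1 \<phi>2 t. L (\<lambda>x. of_real t * \<phi>1 x + of_real (1 - t) * \<phi>2 x) = t * L \<phi>1 + (1 - t) * L \<phi>2"
    using L by (auto simp: affine_functional_def)
  have "compact F" unfolding T(2) by (rule compact_Int_closed[OF compact_normalized_pd[OF G] T(1)])
  moreover have "F \<noteq> {}" using F by (simp add: pd_face_def)
  ultimately obtain \<phi>0 where \<phi>0: "\<phi>0 \<in> F" "\<And>\<psi>. \<psi> \<in> F \<Longrightarrow> L \<phi>0 \<le> L \<psi>"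
    using continuous_attains_inf[of F L] continuous_on_subset[OF cont] by blast
  have eq: "{\<phi> \<in> F. \<forall>\<psi>\<in>F. L \<phi> \<le> L \<psi>} = {\<phi> \<in> F. L \<phi> \<le> L \<phi>0}"
    using \<phi>0 by (auto intro: order_trans)
  show ?thesis
    unfolding eq pd_face_def
  proof (intro conjI ballI allI impI)
    show "{\<phi> \<in> F. L \<phi> \<le> L \<phi>0} \<subseteq> normalized_pd G" using F by (auto simp: pd_face_def)
    show "{\<phi> \<in> F. L \<phi> \<le> L \<phi>0} \<noteq> {}" using \<phi>0 by auto
    have "closed (T \<inter> {\<phi>. L \<phi> \<le> L \<phi>0})"
      by (intro closed_Int T(1) closed_Collect_le cont continuous_on_const)
    then show "\<exists>T. closed T \<and> {\<phi> \<in> F. L \<phi> \<le> L \<phi>0} = normalized_pd G \<inter> T"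
      using T(2) by (intro exI[of _ "T \<inter> {\<phi>. L \<phi> \<le> L \<phi>0}"]) auto
  next
    fix \<phi>1 \<phi>2 and t :: real
    assume \<phi>: "\<phi>1 \<in> normalized_pd G" "\<phi>2 \<in> normalized_pd G" and t: "0 < t" "t < 1"
      and mem: "(\<lambda>x. of_real t * \<phi>1 x + of_real (1 - t) * \<phi>2 x) \<in> {\<phi> \<in> F. L \<phi> \<le> L \<phi>0}"
    have F12: "\<phi>1 \<in> F" "\<phi>2 \<in> F" using F \<phi> t mem unfolding pd_face_def by blast+
    have le: "t * L \<phi>1 + (1 - t) * L \<phi>2 \<le> L \<phi>0" using mem aff by auto
    have l1: "L \<phi>0 \<le> L \<phi>1" and l2: "L \<phi>0 \<le> L \<phi>2" using \<phi>0 F12 by auto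
    have "t * (L \<phi>1 - L \<phi>0) + (1 - t) * (L \<phi>2 - L \<phi>0) \<le> 0" using le by (simp add: algebra_simps)
    moreover have "0 \<le> t * (L \<phi>1 - L \<phi>0)" "0 \<le> (1 - t) * (L \<phi>2 - L \<phi>0)" using t l1 l2 by simp_all
    ultimately have "t * (L \<phi>1 - L \<phi>0) = 0" "(1 - t) * (L \<phi>2 - L \<phi>0) = 0" by linarith+
    then show "\<phi>1 \<in> {\<phi> \<in> F. L \<phi> \<le> L \<phi>0}" "\<phi>2 \<in> {\<phi> \<in> F. L \<phi> \<le> L \<phi>0}"
      using t F12 by auto
  qed
qed

text \<open>Bauer's maximum principle, for a minimum: a minimal closed face of the argmin set is a point,
  since the coordinate functionals separate points.\<close>

lemma pure_minimum:
  assumes G: "group G" and \<psi>: "\<psi> \<in> normalized_pd G" and L: "affine_functional L"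
  obtains \<phi> where "pure_pd G \<phi>" "L \<phi> \<le> L \<psi>"
proof -
  have "pd_face G (normalized_pd G)"
    using \<psi> by (auto simp: pd_face_def intro!: exI[of _ UNIV])
  then have F0: "pd_face G {\<phi> \<in> normalized_pd G. \<forall>\<psi>\<in>normalized_pd G. L \<phi> \<le> L \<psi>}" (is "pd_face G ?F0")
    by (rule pd_face_argmin[OF G _ L])
  \<comment> \<open>Complements, so that the upward form of Zorn's lemma yields a minimal
    face.\<close>
  define \<A> where "\<A> = {- F | F. pd_face G F \<and> F \<subseteq> ?F0}"
  have "\<exists>M\<in>\<A>. \<forall>Z\<in>\<A>. M \<subseteq> Z \<longrightarrow> Z = M"
  proof (rule subset_Zorn_nonempty)
    show "\<A> \<noteq> {}" using F0 by (auto simp: \<A>_def)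
    fix \<C> assume ne: "\<C> \<noteq> {}" and ch: "subset.chain \<A> \<C>"
    define \<F> where "\<F> = uminus ` \<C>"
    have face: "pd_face G F" "F \<subseteq> ?F0" if "F \<in> \<F>" for F
      using that ch unfolding \<F>_def \<A>_def subset.chain_def by auto
    have lin: "F \<subseteq> F' \<or> F' \<subseteq> F" if "F \<in> \<F>" "F' \<in> \<F>" for F F'
      using that ch unfolding \<F>_def subset_chain_def by auto
    have neF: "\<F> \<noteq> {}" using ne by (simp add: \<F>_def)
    obtain cl where cl: "\<And>F. F \<in> \<F> \<Longrightarrow> closed (cl F) \<and> F = normalized_pd G \<inter> cl F"
      using face(1) unfolding pd_face_def by metis
    \<comment> \<open>A nonempty finite subfamily of the chain has a least member, and faces are
      nonempty; compactness extends this to the whole chain.\<close>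
    have "normalized_pd G \<inter> \<Inter> (cl ` \<F>) \<noteq> {}"
    proof (rule compact_imp_fip_image[OF compact_normalized_pd[OF G]])
      show "closed (cl F)" if "F \<in> \<F>" for F using cl that by blast
      fix I' assume I': "finite I'" "I' \<subseteq> \<F>"
      show "normalized_pd G \<inter> \<Inter> (cl ` I') \<noteq> {}"
      proof (cases "I' = {}")
        case True then show ?thesis using \<psi> by auto
      next
        case False
        have "\<exists>m\<in>I'. \<forall>F\<in>I'. m \<subseteq> F"
          using I'(1) False I'(2)
        proof (induction I' rule: finite_ne_induct)
          case (insert F I')
          then obtain m where m: "m \<in> I'" "\<forall>F\<in>I'. m \<subseteq> F" by auto
          from lin[of m F] insert.prems m(1) consider "m \<subseteq> F" | "F \<subseteq> m" by auto
          then show ?case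
          proof cases
            case 1
            then show ?thesis using m by auto
          next
            case 2
            then have "\<forall>F'\<in>insert F I'. F \<subseteq> F'" using m by auto
            then show ?thesis by auto
          qed
        qed simp
        then obtain m where m: "m \<in> I'" "\<And>F. F \<in> I' \<Longrightarrow> m \<subseteq> F" by blast
        then have "m \<noteq> {}" using face(1)[of m] I' by (auto simp: pd_face_def)
        then obtain \<eta> where "\<eta> \<in> m" by auto
        then have "\<eta> \<in> normalized_pd G" "\<And>F. F \<in> I' \<Longrightarrow> \<eta> \<in> cl F"
          using m cl I' by blast+
        then show ?thesis by blast
      qed
    qed
    then obtain \<eta> where \<eta>: "\<eta> \<in> normalized_pd G" "\<And>F. F \<in> \<F> \<Longrightarrow> \<eta> \<in> cl F" by auto
    have "pd_face G (\<Inter>\<F>)"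
      unfolding pd_face_def
    proof (intro conjI ballI allI impI)
      show "\<Inter>\<F> \<subseteq> normalized_pd G" using face(1) neF by (force simp: pd_face_def)
      have "\<eta> \<in> \<Inter>\<F>" using \<eta> cl by blast
      then show "\<Inter>\<F> \<noteq> {}" by auto
      show "\<exists>T. closed T \<and> \<Inter>\<F> = normalized_pd G \<inter> T"
      proof (intro exI conjI)
        show "closed (\<Inter> (cl ` \<F>))" using cl by (intro closed_INT) auto
        show "\<Inter>\<F> = normalized_pd G \<inter> \<Inter> (cl ` \<F>)" using cl neF by blast
      qed
      fix \<phi>1 \<phi>2 and t :: real
      assume \<phi>: "\<phi>1 \<in> normalized_pd G" "\<phi>2 \<in> normalized_pd G" and t: "0 < t" "t < 1"
        and mem: "(\<lambda>x. of_real t * \<phi>1 x + of_real (1 - t) * \<phi>2 x) \<in> \<Inter>\<F>"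
      have *: "\<phi>1 \<in> F \<and> \<phi>2 \<in> F" if "F \<in> \<F>" for F
        using face(1)[OF that] \<phi> t mem that unfolding pd_face_def by blast
      then show "\<phi>1 \<in> \<Inter>\<F>" "\<phi>2 \<in> \<Inter>\<F>" by auto
    qed
    moreover have "\<Inter>\<F> \<subseteq> ?F0" using face(2) neF by blast
    moreover have "\<Union>\<C> = - \<Inter>\<F>" by (auto simp: \<F>_def)
    ultimately show "\<Union>\<C> \<in> \<A>" unfolding \<A>_def by blast
  qed
  then obtain M where M: "pd_face G M" "M \<subseteq> ?F0"
    and min: "\<And>F. pd_face G F \<Longrightarrow> F \<subseteq> M \<Longrightarrow> F = M"
  proof -
    assume *: "\<And>M. pd_face G M \<Longrightarrow> M \<subseteq> ?F0 \<Longrightarrow> (\<And>F. pd_face G F \<Longrightarrow> F \<subseteq> M \<Longrightarrow> F = M) \<Longrightarrow> thesis"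
    assume "\<exists>M\<in>\<A>. \<forall>Z\<in>\<A>. M \<subseteq> Z \<longrightarrow> Z = M"
    then obtain M where M: "pd_face G M" "M \<subseteq> ?F0" and max: "\<forall>Z\<in>\<A>. - M \<subseteq> Z \<longrightarrow> Z = - M"
      by (auto simp: \<A>_def)
    show thesis
    proof (rule *[OF M])
      fix F assume F: "pd_face G F" "F \<subseteq> M"
      then have "- F \<in> \<A>" using M(2) unfolding \<A>_def by blast
      then have "- F = - M" using max F(2) by blast
      then show "F = M" by simp
    qed
  qed
  obtain \<phi> where \<phi>: "\<phi> \<in> M" using M(1) by (auto simp: pd_face_def)
  \<comment> \<open>The points of \<open>M\<close> where \<open>L'\<close> is least form a face
    inside \<open>M\<close>, by minimality all of \<open>M\<close>; so \<open>L'\<close> is constant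
    there.\<close>
  have const: "L' \<eta> = L' \<phi>" if "affine_functional L'" "\<eta> \<in> M" for L' \<eta>
  proof -
    have "{\<phi> \<in> M. \<forall>\<psi>\<in>M. L' \<phi> \<le> L' \<psi>} = M"
      by (rule min[OF pd_face_argmin[OF G M(1) that(1)]]) auto
    then have "\<forall>\<psi>\<in>M. L' \<phi> \<le> L' \<psi>" "\<forall>\<psi>\<in>M. L' \<eta> \<le> L' \<psi>" using \<phi> that by blast+
    then show ?thesis using \<phi> that by (metis order_antisym)
  qed
  have single: "\<eta> = \<phi>" if \<eta>: "\<eta> \<in> M" for \<eta>
  proof
    fix x :: 'a
    have "affine_functional (\<lambda>\<phi>. Re (\<phi> x))" "affine_functional (\<lambda>\<phi>. Im (\<phi> x))"
      by (auto simp: affine_functional_def intro!: continuous_intros)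
    then have "Re (\<eta> x) = Re (\<phi> x)" "Im (\<eta> x) = Im (\<phi> x)" using const \<eta> by blast+
    then show "\<eta> x = \<phi> x" by (rule complex_eqI)
  qed
  show thesis
  proof
    have "\<phi> \<in> normalized_pd G" using M(1) \<phi> by (auto simp: pd_face_def)
    moreover have "\<phi>1 = \<phi>"
      if "\<phi>1 \<in> normalized_pd G" "\<phi>2 \<in> normalized_pd G" "0 < t" "t < 1"
        "\<forall>x. \<phi> x = of_real t * \<phi>1 x + of_real (1 - t) * \<phi>2 x" for \<phi>1 \<phi>2 and t :: real
    proof -
      have "(\<lambda>x. of_real t * \<phi>1 x + of_real (1 - t) * \<phi>2 x) = \<phi>" using that(5) by auto
      then have "\<phi>1 \<in> M" using M(1) \<phi> that unfolding pd_face_def by blast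
      then show ?thesis by (rule single)
    qed
    ultimately show "pure_pd G \<phi>" unfolding pure_pd_def by blast
    show "L \<phi> \<le> L \<psi>" using M(2) \<phi> \<psi> by blast
  qed
qed

section \<open>Fell neighbourhoods of the trivial representation\<close>

definition dual_class :: "('g, 'm) monoid_scheme \<Rightarrow> ('g, 'g \<Rightarrow> complex) rep \<Rightarrow> ('g, 'g \<Rightarrow> complex) rep set" where
  "dual_class G \<rho> = {\<sigma> \<in> irreps G. unitarily_equivalent G \<rho> \<sigma>}"

lemma unitary_dual_eq: "unitary_dual G = dual_class G ` irreps G"
  by (auto simp: unitary_dual_def dual_class_def quotient_def)

lemma irrep_unitary_representation:
  assumes "group G" "(H, \<pi>) \<in> irreps G"
  shows "unitary_representation G H \<pi>"
proof -
  have r: "unitary_rep G (H, \<pi>)" using assms(2) by (simp add: irreps_def irreducible_rep_def)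
  then have "hilbert_space H" by (simp add: unitary_rep_def)
  then show ?thesis
    using assms(1) r by (simp add: unitary_representation_def unitary_representation_axioms_def)
qed

lemma dual_class_self:
  assumes "\<rho> \<in> irreps G"
  shows "\<rho> \<in> dual_class G \<rho>"
proof -
  obtain H \<pi> where \<rho>: "\<rho> = (H, \<pi>)" by (cases \<rho>)
  have "unitary_map H H (\<lambda>x. x)"
    by (auto simp: unitary_map_def complex_linear_map_def bij_betw_def)
  then show ?thesis
    using assms unfolding \<rho> dual_class_def unitarily_equivalent_def by auto
qed

text \<open>Off \<open>carrier G\<close> a representation is arbitrary, so diagonal coefficients are compared on \<open>carrier G\<close>.\<close>

lemma diag_coeffs_equivalent:
  assumes G: "group G" and \<rho>: "\<rho> \<in> irreps G" and eq: "unitarily_equivalent G \<rho> \<sigma>"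
    and \<psi>: "\<psi> \<in> diag_coeffs \<rho>"
  obtains \<psi>' where "\<psi>' \<in> diag_coeffs \<sigma>" "\<And>g. g \<in> carrier G \<Longrightarrow> \<psi>' g = \<psi> g"
proof -
  obtain H \<pi> where r: "\<rho> = (H, \<pi>)" by (cases \<rho>)
  obtain K \<tau> where s: "\<sigma> = (K, \<tau>)" by (cases \<sigma>)
  interpret unitary_representation G H \<pi>
    using irrep_unitary_representation[OF G] \<rho> r by simp
  obtain U where U: "unitary_map H K U" "\<And>g x. \<lbrakk>g \<in> carrier G; x \<in> carrier H\<rbrakk> \<Longrightarrow> U (\<pi> g x) = \<tau> g (U x)"
    using eq unfolding r s unitarily_equivalent_def by auto
  have Uc: "\<And>x. x \<in> carrier H \<Longrightarrow> U x \<in> carrier K"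
    and Ui: "\<And>x y. \<lbrakk>x \<in> carrier H; y \<in> carrier H\<rbrakk> \<Longrightarrow> ip K (U x) (U y) = ip H x y"
    using U(1) by (auto simp: unitary_map_def complex_linear_map_def)
  obtain \<xi> where \<xi>: "\<xi> \<in> carrier H" "\<psi> = (\<lambda>g. ip H (\<pi> g \<xi>) \<xi>)"
    using \<psi> unfolding r diag_coeffs_def by auto
  show thesis
  proof
    show "(\<lambda>g. ip K (\<tau> g (U \<xi>)) (U \<xi>)) \<in> diag_coeffs \<sigma>"
      using Uc[OF \<xi>(1)] unfolding s diag_coeffs_def by auto
    show "ip K (\<tau> g (U \<xi>)) (U \<xi>) = \<psi> g" if g: "g \<in> carrier G" for g
      using U(2)[OF g \<xi>(1)] Ui[of "\<pi> g \<xi>" \<xi>] g \<xi> by simp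
  qed
qed

text \<open>Scale the vector by \<open>sqrt r\<close>. This is needed because the functions that
  define a basic neighbourhood of the trivial class are close to constants which may differ from
  1.\<close>

lemma diag_coeffs_scale:
  assumes G: "group G" and \<rho>: "\<rho> \<in> irreps G" and \<psi>: "\<psi> \<in> diag_coeffs \<rho>" and r: "0 \<le> r"
  obtains \<psi>' where "\<psi>' \<in> diag_coeffs \<rho>" "\<And>g. g \<in> carrier G \<Longrightarrow> \<psi>' g = of_real r * \<psi> g"
proof -
  obtain H \<pi> where \<rho>': "\<rho> = (H, \<pi>)" by (cases \<rho>)
  interpret unitary_representation G H \<pi>
    using irrep_unitary_representation[OF G] \<rho> \<rho>' by simp
  obtain \<xi> where \<xi>: "\<xi> \<in> carrier H" "\<psi> = (\<lambda>g. ip H (\<pi> g \<xi>) \<xi>)"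
    using \<psi> unfolding \<rho>' diag_coeffs_def by auto
  let ?\<eta> = "of_real (sqrt r) \<odot>\<^bsub>H\<^esub> \<xi>"
  have \<eta>: "?\<eta> \<in> carrier H" using \<xi> by simp
  show thesis
  proof
    show "(\<lambda>g. ip H (\<pi> g ?\<eta>) ?\<eta>) \<in> diag_coeffs \<rho>"
      using \<eta> unfolding \<rho>' diag_coeffs_def by auto
    fix g assume g: "g \<in> carrier G"
    have "ip H (\<pi> g ?\<eta>) ?\<eta> = of_real (sqrt r) * (of_real (sqrt r) * ip H (\<pi> g \<xi>) \<xi>)"
      using rep_smult[OF g \<xi>(1)] rep_closed[OF g \<xi>(1)] \<xi>(1)
      by (simp add: ip_smult_left semi.ip_smult_right)
    also have "\<dots> = of_real (sqrt r * sqrt r) * ip H (\<pi> g \<xi>) \<xi>" by (simp only: of_real_mult mult.assoc)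
    finally show "ip H (\<pi> g ?\<eta>) ?\<eta> = of_real r * \<psi> g" using r \<xi> by simp
  qed
qed

lemma trivial_class_fixed:
  assumes "(H, \<pi>) \<in> trivial_class G" "g \<in> carrier G" "x \<in> carrier H"
  shows "\<pi> g x = x"
proof -
  obtain U where U: "unitary_map complex_line H U"
    and eq: "\<And>g z. \<lbrakk>g \<in> carrier G; z \<in> carrier complex_line\<rbrakk> \<Longrightarrow> U z = \<pi> g (U z)"
    using assms(1) unfolding trivial_class_def unitarily_equivalent_def by auto
  have "U ` carrier complex_line = carrier H"
    using U by (simp add: unitary_map_def bij_betw_def)
  then obtain z where "z \<in> carrier complex_line" "x = U z"
    using assms(3) by blast
  then show ?thesis using eq[OF assms(2)] by simp
qed

text \<open>A coefficient of an invariant vector is constantly its squared norm. Hence membership of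
  the trivial class in a basic set says that the functions defining the set are near nonnegative
  constants on \<open>Q\<close>.\<close>

lemma trivial_class_sum_coeffs:
  assumes G: "group G" and \<sigma>: "\<sigma> \<in> trivial_class G" and \<psi>s: "set \<psi>s \<subseteq> diag_coeffs \<sigma>"
  obtains r where "0 \<le> r" "\<And>g. g \<in> carrier G \<Longrightarrow> (\<Sum>\<psi>\<leftarrow>\<psi>s. \<psi> g) = of_real r"
proof -
  obtain H \<pi> where s: "\<sigma> = (H, \<pi>)" by (cases \<sigma>)
  have irr: "(H, \<pi>) \<in> irreps G" using \<sigma> s by (simp add: trivial_class_def)
  interpret unitary_representation G H \<pi> by (rule irrep_unitary_representation[OF G irr])
  have "\<exists>r\<ge>0. \<forall>g\<in>carrier G. (\<Sum>\<psi>\<leftarrow>\<psi>s. \<psi> g) = complex_of_real r"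
    using \<psi>s
  proof (induction \<psi>s)
    case Nil
    then show ?case by (intro exI[of _ 0]) simp
  next
    case (Cons \<psi> \<psi>s)
    then obtain r where r: "r \<ge> 0" "\<forall>g\<in>carrier G. (\<Sum>\<psi>\<leftarrow>\<psi>s. \<psi> g) = complex_of_real r" by auto
    obtain \<xi> where \<xi>: "\<xi> \<in> carrier H" "\<psi> = (\<lambda>g. ip H (\<pi> g \<xi>) \<xi>)"
      using Cons.prems unfolding s diag_coeffs_def by auto
    have "\<psi> g = of_real ((hnorm H \<xi>)\<^sup>2)" if "g \<in> carrier G" for g
      using trivial_class_fixed[of H \<pi> G g \<xi>] \<sigma> s that \<xi> semi.ip_self[OF \<xi>(1)] by simp
    then show ?case using r by (intro exI[of _ "(hnorm H \<xi>)\<^sup>2 + r"]) simp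
  qed
  then show thesis using that by blast
qed

text \<open>Induction over the generation of \<open>U\<close>. In a basic set each defining function
  is within \<open>\<epsilon>\<close> of a constant \<open>r\<close> on \<open>Q\<close>; if
  \<open>\<psi>\<close> is close enough to 1 there, then \<open>r \<psi>\<close> is again a
  coefficient and still within \<open>\<epsilon>\<close>.\<close>

lemma fell_neighbourhood_of_trivial:
  assumes G: "group G"
    and U: "openin (fell_topology G) U" and mem: "trivial_class G \<in> U"
  obtains Q \<delta> where "finite Q" "Q \<subseteq> carrier G" "\<delta> > 0"
    "\<And>\<rho> \<psi>. \<lbrakk>\<rho> \<in> irreps G; \<psi> \<in> diag_coeffs \<rho>; \<forall>s\<in>Q. cmod (\<psi> s - 1) < \<delta>\<rbrakk> \<Longrightarrow> dual_class G \<rho> \<in> U"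
proof -
  define near where "near Q \<delta> U \<longleftrightarrow> finite Q \<and> Q \<subseteq> carrier G \<and> \<delta> > 0 \<and>
    (\<forall>\<rho>\<in>irreps G. \<forall>\<psi>\<in>diag_coeffs \<rho>. (\<forall>s\<in>Q. cmod (\<psi> s - 1) < \<delta>) \<longrightarrow> dual_class G \<rho> \<in> U)"
    for Q and \<delta> :: real and U
  have "generate_topology_on {fell_nbhd G \<Phi> Q \<epsilon> | \<Phi> Q \<epsilon>. (\<exists>\<rho>\<in>irreps G. \<Phi> \<subseteq> diag_coeffs \<rho>) \<and>
      finite \<Phi> \<and> Q \<subseteq> carrier G \<and> finite Q \<and> \<epsilon> > 0} U"
    using U unfolding fell_topology_def by (rule openin_topology_generated_by)
  then have "\<exists>Q \<delta>. near Q \<delta> U"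
    using mem
  proof (induction rule: generate_topology_on.induct)
    case Empty
    then show ?case by simp
  next
    case (Int a b)
    then obtain Q1 \<delta>1 Q2 \<delta>2 where *: "near Q1 \<delta>1 a" "near Q2 \<delta>2 b" by auto
    have "near (Q1 \<union> Q2) (min \<delta>1 \<delta>2) (a \<inter> b)"
      unfolding near_def
    proof (intro conjI ballI impI)
      show "finite (Q1 \<union> Q2)" "Q1 \<union> Q2 \<subseteq> carrier G" "min \<delta>1 \<delta>2 > 0"
        using * by (simp_all add: near_def)
      fix \<rho> \<psi>
      assume \<rho>: "\<rho> \<in> irreps G" "\<psi> \<in> diag_coeffs \<rho>"
        and c: "\<forall>s\<in>Q1 \<union> Q2. cmod (\<psi> s - 1) < min \<delta>1 \<delta>2"
      have "\<forall>s\<in>Q1. cmod (\<psi> s - 1) < \<delta>1" "\<forall>s\<in>Q2. cmod (\<psi> s - 1) < \<delta>2" using c by simp_all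
      then show "dual_class G \<rho> \<in> a \<inter> b" using * \<rho> unfolding near_def by blast
    qed
    then show ?case by blast
  next
    case (UN K)
    then obtain k where "k \<in> K" "trivial_class G \<in> k" by auto
    then obtain Q \<delta> where "near Q \<delta> k" using UN by blast
    then have "near Q \<delta> (\<Union>K)" using \<open>k \<in> K\<close> unfolding near_def by blast
    then show ?case by blast
  next
    case (Basis S)
    then obtain \<Phi> Q \<epsilon> where S: "S = fell_nbhd G \<Phi> Q \<epsilon>" and fin: "finite \<Phi>" "finite Q"
      and Q: "Q \<subseteq> carrier G" and \<epsilon>: "\<epsilon> > 0" by auto
    have "trivial_class G \<in> unitary_dual G" using Basis S by (simp add: fell_nbhd_def)
    then obtain \<sigma> where \<sigma>: "\<sigma> \<in> trivial_class G"
      unfolding unitary_dual_eq using dual_class_self by blast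
    have "\<exists>r\<ge>0. \<forall>g\<in>Q. cmod (\<phi> g - of_real r) < \<epsilon>" if "\<phi> \<in> \<Phi>" for \<phi>
    proof -
      have "\<exists>\<psi>s. set \<psi>s \<subseteq> diag_coeffs \<sigma> \<and> (\<forall>g\<in>Q. cmod (\<phi> g - (\<Sum>\<psi>\<leftarrow>\<psi>s. \<psi> g)) < \<epsilon>)"
      proof -
        have "\<forall>\<sigma>\<in>trivial_class G. \<forall>\<phi>\<in>\<Phi>. \<exists>\<psi>s. set \<psi>s \<subseteq> diag_coeffs \<sigma> \<and>
            (\<forall>g\<in>Q. cmod (\<phi> g - (\<Sum>\<psi>\<leftarrow>\<psi>s. \<psi> g)) < \<epsilon>)"
          using Basis.prems unfolding S fell_nbhd_def by simp
        then show ?thesis using \<sigma> that by simp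
      qed
      then obtain \<psi>s where \<psi>s: "set \<psi>s \<subseteq> diag_coeffs \<sigma>"
        "\<forall>g\<in>Q. cmod (\<phi> g - (\<Sum>\<psi>\<leftarrow>\<psi>s. \<psi> g)) < \<epsilon>" by blast
      obtain r where "0 \<le> r" "\<And>g. g \<in> carrier G \<Longrightarrow> (\<Sum>\<psi>\<leftarrow>\<psi>s. \<psi> g) = of_real r"
        using trivial_class_sum_coeffs[OF G \<sigma> \<psi>s(1)] by blast
      moreover from this(2) have "\<forall>g\<in>Q. (\<Sum>\<psi>\<leftarrow>\<psi>s. \<psi> g) = of_real r" using Q by blast
      ultimately show ?thesis using \<psi>s(2) by (intro exI[of _ r]) auto
    qed
    then obtain r where r0: "\<And>\<phi>. \<phi> \<in> \<Phi> \<Longrightarrow> 0 \<le> r \<phi>"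
      and r: "\<And>\<phi> g. \<lbrakk>\<phi> \<in> \<Phi>; g \<in> Q\<rbrakk> \<Longrightarrow> cmod (\<phi> g - of_real (r \<phi>)) < \<epsilon>" by metis
    \<comment> \<open>The inequalities are strict at \<open>\<delta> = 0\<close> and finite in
      number, so one positive \<open>\<delta>\<close> keeps them all.\<close>
    have "\<forall>\<^sub>F \<delta> in at_right 0. \<forall>\<phi>\<in>\<Phi>. \<forall>g\<in>Q. cmod (\<phi> g - of_real (r \<phi>)) + r \<phi> * \<delta> < \<epsilon>"
    proof (intro eventually_ball_finite fin ballI)
      fix \<phi> g assume "\<phi> \<in> \<Phi>" "g \<in> Q"
      have "((\<lambda>\<delta>. cmod (\<phi> g - of_real (r \<phi>)) + r \<phi> * \<delta>) \<longlongrightarrow> cmod (\<phi> g - of_real (r \<phi>)) + r \<phi> * 0) (at_right 0)"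
        by (intro tendsto_intros)
      then show "\<forall>\<^sub>F \<delta> in at_right 0. cmod (\<phi> g - of_real (r \<phi>)) + r \<phi> * \<delta> < \<epsilon>"
        by (rule order_tendstoD(2)) (use r \<open>\<phi> \<in> \<Phi>\<close> \<open>g \<in> Q\<close> in simp)
    qed
    then have "\<forall>\<^sub>F \<delta> in at_right (0::real). (\<forall>\<phi>\<in>\<Phi>. \<forall>g\<in>Q. cmod (\<phi> g - of_real (r \<phi>)) + r \<phi> * \<delta> < \<epsilon>) \<and> 0 < \<delta>"
      using eventually_at_right_less by (rule eventually_conj)
    then obtain \<delta> :: real where \<delta>: "\<delta> > 0"
      "\<And>\<phi> g. \<lbrakk>\<phi> \<in> \<Phi>; g \<in> Q\<rbrakk> \<Longrightarrow> cmod (\<phi> g - of_real (r \<phi>)) + r \<phi> * \<delta> < \<epsilon>"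
      using eventually_happens'[OF trivial_limit_at_right_real] by blast
    have "dual_class G \<rho> \<in> S"
      if \<rho>: "\<rho> \<in> irreps G" and \<psi>: "\<psi> \<in> diag_coeffs \<rho>" and close: "\<forall>s\<in>Q. cmod (\<psi> s - 1) < \<delta>" for \<rho> \<psi>
      unfolding S fell_nbhd_def
    proof (intro CollectI conjI ballI)
      show "dual_class G \<rho> \<in> unitary_dual G" using \<rho> by (simp add: unitary_dual_eq)
      fix \<sigma>' \<phi> assume \<sigma>': "\<sigma>' \<in> dual_class G \<rho>" and \<phi>: "\<phi> \<in> \<Phi>"
      have irr: "\<sigma>' \<in> irreps G" and eq: "unitarily_equivalent G \<rho> \<sigma>'"
        using \<sigma>' by (auto simp: dual_class_def)
      obtain \<psi>' where \<psi>': "\<psi>' \<in> diag_coeffs \<sigma>'" "\<And>g. g \<in> carrier G \<Longrightarrow> \<psi>' g = \<psi> g"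
        using diag_coeffs_equivalent[OF G \<rho> eq \<psi>] by blast
      obtain \<psi>'' where \<psi>'': "\<psi>'' \<in> diag_coeffs \<sigma>'" "\<And>g. g \<in> carrier G \<Longrightarrow> \<psi>'' g = of_real (r \<phi>) * \<psi>' g"
        using diag_coeffs_scale[OF G irr \<psi>'(1) r0[OF \<phi>]] by blast
      show "\<exists>\<psi>s. set \<psi>s \<subseteq> diag_coeffs \<sigma>' \<and> (\<forall>g\<in>Q. cmod (\<phi> g - (\<Sum>\<psi>\<leftarrow>\<psi>s. \<psi> g)) < \<epsilon>)"
      proof (intro exI[of _ "[\<psi>'']"] conjI ballI)
        show "set [\<psi>''] \<subseteq> diag_coeffs \<sigma>'" using \<psi>'' by simp
        fix g assume g: "g \<in> Q"
        have "\<phi> g - \<psi>'' g = (\<phi> g - of_real (r \<phi>)) - of_real (r \<phi>) * (\<psi> g - 1)"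
          using \<psi>'(2)[of g] \<psi>''(2)[of g] g Q by (auto simp: algebra_simps)
        also have "cmod \<dots> \<le> cmod (\<phi> g - of_real (r \<phi>)) + cmod (of_real (r \<phi>) * (\<psi> g - 1))"
          by (rule norm_triangle_ineq4)
        also have "\<dots> \<le> cmod (\<phi> g - of_real (r \<phi>)) + r \<phi> * \<delta>"
          using mult_left_mono[of "cmod (\<psi> g - 1)" \<delta> "r \<phi>"] r0[OF \<phi>] close g
          by (auto simp: norm_mult intro: less_imp_le)
        also have "\<dots> < \<epsilon>" by (rule \<delta>(2)[OF \<phi> g])
        finally show "cmod (\<phi> g - (\<Sum>\<psi>\<leftarrow>[\<psi>'']. \<psi> g)) < \<epsilon>" by simp
      qed
    qed
    then have "near Q \<delta> S" unfolding near_def using fin Q \<delta>(1) by blast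
    then show ?case by blast
  qed
  then show thesis using that unfolding near_def by blast
qed

text \<open>The GNS representation of a pure \<open>\<phi>\<close> near 1 on \<open>Q\<close> falls
  into the isolated class and is therefore trivial; its cyclic vector is fixed, which makes
  \<open>\<phi>\<close> constant on the group.\<close>

lemma property_T_pure:
  assumes G: "group G" and T: "property_T G"
  obtains Q \<delta> where "finite Q" "Q \<subseteq> carrier G" "\<delta> > 0"
    "\<And>\<phi> g. \<lbrakk>pure_pd G \<phi>; \<forall>s\<in>Q. cmod (\<phi> s - 1) < \<delta>; g \<in> carrier G\<rbrakk> \<Longrightarrow> \<phi> g = 1"
proof -
  have op: "openin (fell_topology G) {trivial_class G}" using T by (simp add: property_T_def)
  obtain Q \<delta> where Q: "finite Q" "Q \<subseteq> carrier G" "\<delta> > 0"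
    and near: "\<And>\<rho> \<psi>. \<lbrakk>\<rho> \<in> irreps G; \<psi> \<in> diag_coeffs \<rho>; \<forall>s\<in>Q. cmod (\<psi> s - 1) < \<delta>\<rbrakk>
      \<Longrightarrow> dual_class G \<rho> \<in> {trivial_class G}"
    using fell_neighbourhood_of_trivial[OF G op] by blast
  have "\<phi> g = 1" if pure: "pure_pd G \<phi>" and close: "\<forall>s\<in>Q. cmod (\<phi> s - 1) < \<delta>" and g: "g \<in> carrier G" for \<phi> g
  proof -
    have norm: "\<phi> \<in> normalized_pd G" using pure by (simp add: pure_pd_def)
    interpret gns G \<phi> by (rule normalized_pd_gns[OF G norm])
    have irr: "(rkhs, translate) \<in> irreps G" using irreducible_gns[OF pure] by (simp add: irreps_def)
    have "(\<lambda>g. ip rkhs (translate g cyc) cyc) \<in> diag_coeffs (rkhs, translate)"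
      unfolding diag_coeffs_def using cyc_carrier by blast
    moreover have "\<forall>s\<in>Q. cmod (ip rkhs (translate s cyc) cyc - 1) < \<delta>"
      using close Q by (auto simp: coefficient_cyc)
    ultimately have "dual_class G (rkhs, translate) = trivial_class G"
      using near[OF irr] by blast
    then have "(rkhs, translate) \<in> trivial_class G" using dual_class_self[OF irr] by simp
    then have "translate g cyc = cyc" using g cyc_carrier by (rule trivial_class_fixed)
    then have "\<phi> g = \<phi> \<one>\<^bsub>G\<^esub>"
      using coefficient_cyc[OF g] coefficient_cyc[of "\<one>\<^bsub>G\<^esub>"] by (simp add: rep_one)
    then show ?thesis using norm by (simp add: normalized_pd_def)
  qed
  then show thesis using that Q by blast
qed

text \<open>The difference of the two sides is a continuous affine functional of \<open>\<phi>\<close>, so it suffices to consider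
  pure functions of positive type, which either are trivial or are far from \<open>1\<close> somewhere on \<open>Q\<close>.\<close>

theorem kazhdan_inequality:
  assumes G: "group G" and T: "property_T G"
  obtains Q C where "finite Q" "Q \<subseteq> carrier G" "0 \<le> C"
    "\<And>\<phi> h. \<lbrakk>\<phi> \<in> normalized_pd G; h \<in> carrier G\<rbrakk> \<Longrightarrow> 1 - Re (\<phi> h) \<le> C * (\<Sum>s\<in>Q. 1 - Re (\<phi> s))"
proof -
  obtain Q \<delta> where Q: "finite Q" "Q \<subseteq> carrier G" and \<delta>: "\<delta> > 0"
    and pure1: "\<And>\<phi> g. \<lbrakk>pure_pd G \<phi>; \<forall>s\<in>Q. cmod (\<phi> s - 1) < \<delta>; g \<in> carrier G\<rbrakk> \<Longrightarrow> \<phi> g = 1"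
    using property_T_pure[OF G T] by blast
  \<comment> \<open>If \<open>\<bar>\<phi> s - 1\<bar> \<ge> \<delta>\<close> for some
    \<open>s\<close> in \<open>Q\<close>, then
    \<open>1 - Re (\<phi> s) \<ge> \<delta>\<^sup>2 / 2\<close>, whereas the left side of the
    inequality never exceeds 2; this \<open>C\<close> makes
    \<open>C \<delta>\<^sup>2 / 2 = 2\<close>.\<close>
  define C where "C = 4 / \<delta>\<^sup>2"
  have C: "C > 0" using \<delta> by (simp add: C_def)
  have "1 - Re (\<psi> h) \<le> C * (\<Sum>s\<in>Q. 1 - Re (\<psi> s))" if \<psi>: "\<psi> \<in> normalized_pd G" and h: "h \<in> carrier G" for \<psi> h
  proof -
    let ?L = "\<lambda>\<phi>::'a \<Rightarrow> complex. C * (\<Sum>s\<in>Q. 1 - Re (\<phi> s)) - (1 - Re (\<phi> h))"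
    have "affine_functional ?L"
      unfolding affine_functional_def
    proof (intro conjI allI)
      show "continuous_on UNIV ?L" by (intro continuous_intros) simp_all
      fix \<phi>1 \<phi>2 :: "'a \<Rightarrow> complex" and t :: real
      have "(\<Sum>s\<in>Q. 1 - Re (of_real t * \<phi>1 s + of_real (1 - t) * \<phi>2 s)) =
        t * (\<Sum>s\<in>Q. 1 - Re (\<phi>1 s)) + (1 - t) * (\<Sum>s\<in>Q. 1 - Re (\<phi>2 s))"
        unfolding sum_distrib_left sum.distrib[symmetric]
        by (intro sum.cong refl) (simp add: algebra_simps)
      then show "C * (\<Sum>s\<in>Q. 1 - Re (of_real t * \<phi>1 s + of_real (1 - t) * \<phi>2 s)) -
          (1 - Re (of_real t * \<phi>1 h + of_real (1 - t) * \<phi>2 h)) = t * ?L \<phi>1 + (1 - t) * ?L \<phi>2"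
        by (simp only:) (simp add: algebra_simps)
    qed
    then obtain \<phi> where \<phi>: "pure_pd G \<phi>" and le: "?L \<phi> \<le> ?L \<psi>"
      by (rule pure_minimum[OF G \<psi>])
    have norm: "\<phi> \<in> normalized_pd G" using \<phi> by (simp add: pure_pd_def)
    have b: "cmod (\<phi> x) \<le> 1" for x by (rule normalized_pd_bounded[OF G norm])
    have nn: "0 \<le> 1 - Re (\<phi> x)" for x using b[of x] complex_Re_le_cmod[of "\<phi> x"] by linarith
    have "0 \<le> ?L \<phi>"
    proof (cases "\<forall>s\<in>Q. cmod (\<phi> s - 1) < \<delta>")
      case True
      then have "\<phi> h = 1" using pure1[OF \<phi> _ h] by blast
      then show ?thesis using C nn by (simp add: sum_nonneg)
    next
      case False
      then obtain s where s: "s \<in> Q" "\<delta> \<le> cmod (\<phi> s - 1)" by auto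
      have "\<delta>\<^sup>2 \<le> (cmod (\<phi> s - 1))\<^sup>2" using s \<delta> by (intro power_mono) auto
      also have "\<dots> = (cmod (\<phi> s))\<^sup>2 + 1 - 2 * Re (\<phi> s)"
        unfolding cmod_power2 by (simp add: power2_eq_square algebra_simps)
      also have "\<dots> \<le> 2 * (1 - Re (\<phi> s))" using b[of s] by (simp add: power_le_one)
      finally have "\<delta>\<^sup>2 / 2 \<le> 1 - Re (\<phi> s)" by simp
      also have "\<dots> \<le> (\<Sum>s\<in>Q. 1 - Re (\<phi> s))"
        using s Q nn by (intro member_le_sum) auto
      finally have "C * (\<delta>\<^sup>2 / 2) \<le> C * (\<Sum>s\<in>Q. 1 - Re (\<phi> s))" using C by (intro mult_left_mono) auto
      moreover have "C * (\<delta>\<^sup>2 / 2) = 2" using \<delta> by (simp add: C_def)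
      moreover have "1 - Re (\<phi> h) \<le> 2" using b[of h] abs_Re_le_cmod[of "\<phi> h"] by linarith
      ultimately show ?thesis by linarith
    qed
    then show ?thesis using le by linarith
  qed
  then show thesis using that[of Q C] Q C by (meson less_imp_le)
qed

section \<open>The left regular representation\<close>

lemma l2_space_simps [simp]:
  "zero (l2_space S) = (\<lambda>x. 0)" "add (l2_space S) = (\<lambda>\<xi> \<eta> x. \<xi> x + \<eta> x)"
  "smult (l2_space S) = (\<lambda>a \<xi> x. a * \<xi> x)"
  "ip (l2_space S) = (\<lambda>\<xi> \<eta>. \<Sum>\<^sub>\<infinity>x\<in>S. \<xi> x * cnj (\<eta> x))"
  by (simp_all add: l2_space_def)

lemma l2_carrier_iff:
  "\<xi> \<in> carrier (l2_space S) \<longleftrightarrow> (\<forall>x. x \<notin> S \<longrightarrow> \<xi> x = 0) \<and> (\<lambda>x. (cmod (\<xi> x))\<^sup>2) summable_on S"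
  by (simp add: l2_space_def)

lemma l2_add:
  assumes "\<xi> \<in> carrier (l2_space S)" "\<eta> \<in> carrier (l2_space S)"
  shows "(\<lambda>x. \<xi> x + \<eta> x) \<in> carrier (l2_space S)"
proof -
  have "(\<lambda>x. (cmod (\<xi> x + \<eta> x))\<^sup>2) summable_on S"
  proof (rule summable_on_comparison_test)
    show "(\<lambda>x. 2 * (cmod (\<xi> x))\<^sup>2 + 2 * (cmod (\<eta> x))\<^sup>2) summable_on S"
      using assms by (intro summable_on_add summable_on_cmult_right) (simp_all add: l2_carrier_iff)
    show "(cmod (\<xi> x + \<eta> x))\<^sup>2 \<le> 2 * (cmod (\<xi> x))\<^sup>2 + 2 * (cmod (\<eta> x))\<^sup>2" for x
    proof -
      have "(cmod (\<xi> x + \<eta> x))\<^sup>2 \<le> (cmod (\<xi> x) + cmod (\<eta> x))\<^sup>2"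
        by (intro power_mono norm_triangle_ineq) simp
      also have "\<dots> \<le> 2 * (cmod (\<xi> x))\<^sup>2 + 2 * (cmod (\<eta> x))\<^sup>2"
        using sum_squares_bound[of "cmod (\<xi> x)" "cmod (\<eta> x)"] by (simp add: power2_sum)
      finally show ?thesis .
    qed
  qed simp
  then show ?thesis using assms by (simp add: l2_carrier_iff)
qed

lemma l2_smult:
  assumes "\<xi> \<in> carrier (l2_space S)"
  shows "(\<lambda>x. a * \<xi> x) \<in> carrier (l2_space S)"
  using assms by (auto simp: l2_carrier_iff norm_mult power_mult_distrib intro: summable_on_cmult_right)

lemma module_l2: "module complex_ring (l2_space S)"
  by (rule function_module) (simp_all add: l2_add l2_smult, simp add: l2_carrier_iff)

lemma l2_minus: "\<lbrakk>\<xi> \<in> carrier (l2_space S); \<eta> \<in> carrier (l2_space S)\<rbrakk>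
    \<Longrightarrow> \<xi> \<ominus>\<^bsub>l2_space S\<^esub> \<eta> = (\<lambda>x. \<xi> x - \<eta> x)"
  by (rule function_module_minus[OF module_l2]) simp_all

lemma l2_product_summable:
  assumes "\<xi> \<in> carrier (l2_space S)" "\<eta> \<in> carrier (l2_space S)"
  shows "(\<lambda>x. \<xi> x * cnj (\<eta> x)) summable_on S"
proof (rule abs_summable_summable, rule abs_summable_product)
  show "(\<lambda>x. norm (\<xi> x * \<xi> x)) summable_on S" "(\<lambda>x. norm (cnj (\<eta> x) * cnj (\<eta> x))) summable_on S"
    using assms by (simp_all add: l2_carrier_iff norm_mult power2_eq_square)
qed

lemma l2_ip_self:
  assumes "\<xi> \<in> carrier (l2_space S)"
  shows "Re (ip (l2_space S) \<xi> \<xi>) = (\<Sum>\<^sub>\<infinity>x\<in>S. (cmod (\<xi> x))\<^sup>2)"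
proof -
  have "Re (ip (l2_space S) \<xi> \<xi>) = (\<Sum>\<^sub>\<infinity>x\<in>S. Re (\<xi> x * cnj (\<xi> x)))"
    using infsum_Re[OF l2_product_summable[OF assms assms]] by simp
  also have "\<dots> = (\<Sum>\<^sub>\<infinity>x\<in>S. (cmod (\<xi> x))\<^sup>2)"
    by (intro infsum_cong) (metis Re_complex_of_real complex_norm_square)
  finally show ?thesis .
qed

lemma l2_sum_le:
  assumes "\<xi> \<in> carrier (l2_space S)" "finite F" "F \<subseteq> S"
  shows "(\<Sum>x\<in>F. (cmod (\<xi> x))\<^sup>2) \<le> (hnorm (l2_space S) \<xi>)\<^sup>2"
proof -
  have "(\<Sum>x\<in>F. (cmod (\<xi> x))\<^sup>2) \<le> (\<Sum>\<^sub>\<infinity>x\<in>S. (cmod (\<xi> x))\<^sup>2)"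
    using assms by (intro finite_sum_le_infsum) (simp_all add: l2_carrier_iff)
  moreover have "0 \<le> (\<Sum>\<^sub>\<infinity>x\<in>S. (cmod (\<xi> x))\<^sup>2)" by (rule infsum_nonneg) simp
  ultimately show ?thesis by (simp only: hnorm_def l2_ip_self[OF assms(1)] real_sqrt_pow2)
qed

lemma pre_hilbert_l2: "pre_hilbert_space (l2_space S)"
proof -
  interpret module complex_ring "l2_space S" by (rule module_l2)
  show ?thesis
  proof
    fix \<xi> assume \<xi>: "\<xi> \<in> carrier (l2_space S)"
    {
      fix \<eta> \<zeta> assume "\<eta> \<in> carrier (l2_space S)" "\<zeta> \<in> carrier (l2_space S)"
      then show "ip (l2_space S) (\<xi> \<oplus>\<^bsub>l2_space S\<^esub> \<eta>) \<zeta> = ip (l2_space S) \<xi> \<zeta> + ip (l2_space S) \<eta> \<zeta>"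
        using infsum_add[OF l2_product_summable l2_product_summable, of \<xi> S \<zeta> \<eta> \<zeta>] \<xi>
        by (simp add: distrib_right)
    next
      fix \<eta> a
      show "ip (l2_space S) (a \<odot>\<^bsub>l2_space S\<^esub> \<xi>) \<eta> = a * ip (l2_space S) \<xi> \<eta>"
        by (simp add: infsum_cmult_right'[symmetric] mult.assoc)
    next
      fix \<eta>
      show "ip (l2_space S) \<eta> \<xi> = cnj (ip (l2_space S) \<xi> \<eta>)"
        by (simp add: infsum_cnj[symmetric] mult.commute del: infsum_cnj)
    }
    assume "\<xi> \<noteq> \<zero>\<^bsub>l2_space S\<^esub>"
    then obtain x where x: "\<xi> x \<noteq> 0" by auto
    then have "x \<in> S" using \<xi> by (auto simp: l2_carrier_iff)
    then have "(cmod (\<xi> x))\<^sup>2 \<le> (\<Sum>\<^sub>\<infinity>x\<in>S. (cmod (\<xi> x))\<^sup>2)"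
      using \<xi> finite_sum_le_infsum[of "\<lambda>x. (cmod (\<xi> x))\<^sup>2" S "{x}"] by (simp add: l2_carrier_iff)
    moreover have "0 < (cmod (\<xi> x))\<^sup>2" using x by simp
    ultimately show "0 < Re (ip (l2_space S) \<xi> \<xi>)" unfolding l2_ip_self[OF \<xi>] by linarith
  qed
qed

text \<open>Coordinates converge. Bounds on finite partial sums for
  \<open>\<sigma> n - \<sigma> m\<close> survive the limit in \<open>m\<close>, and give square
  summability of \<open>\<sigma> n - \<xi>\<close> together with convergence in norm.\<close>

lemma hilbert_l2: "hilbert_space (l2_space S)"
proof -
  interpret pre_hilbert_space "l2_space S" by (rule pre_hilbert_l2)
  let ?H = "l2_space S"
  show ?thesis
  proof (rule hilbert_spaceI)
    fix \<sigma> :: "nat \<Rightarrow> 'a \<Rightarrow> complex"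
    assume in_H: "\<And>n. \<sigma> n \<in> carrier ?H"
      and cau: "\<And>e. e > 0 \<Longrightarrow> \<exists>N. \<forall>m\<ge>N. \<forall>n\<ge>N. hnorm ?H (\<sigma> m \<ominus>\<^bsub>?H\<^esub> \<sigma> n) < e"
    have d: "(\<lambda>x. \<sigma> m x - \<sigma> n x) \<in> carrier ?H" for m n
      using minus_closed[OF in_H in_H, of m n] l2_minus[OF in_H in_H, of m n] by simp
    have nn: "0 \<le> hnorm ?H (\<sigma> m \<ominus>\<^bsub>?H\<^esub> \<sigma> n)" for m n
      by (intro semi.hnorm_nonneg minus_closed in_H)
    have fin: "(\<Sum>x\<in>F. (cmod (\<sigma> m x - \<sigma> n x))\<^sup>2) \<le> (hnorm ?H (\<sigma> m \<ominus>\<^bsub>?H\<^esub> \<sigma> n))\<^sup>2"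
      if "finite F" "F \<subseteq> S" for F m n
      using l2_sum_le[OF d that] l2_minus[OF in_H in_H] by simp
    have "convergent (\<lambda>n. \<sigma> n x)" for x
    proof (cases "x \<in> S")
      case True
      show ?thesis
      proof (rule Cauchy_convergent, rule CauchyI)
        fix e :: real assume "e > 0"
        then obtain N where N: "\<And>m n. m \<ge> N \<Longrightarrow> n \<ge> N \<Longrightarrow> hnorm ?H (\<sigma> m \<ominus>\<^bsub>?H\<^esub> \<sigma> n) < e"
          using cau by meson
        have "cmod (\<sigma> m x - \<sigma> n x) \<le> hnorm ?H (\<sigma> m \<ominus>\<^bsub>?H\<^esub> \<sigma> n)" for m n
          using fin[of "{x}" m n] True by (intro power2_le_imp_le[OF _ nn]) simp
        then show "\<exists>M. \<forall>m\<ge>M. \<forall>n\<ge>M. norm (\<sigma> m x - \<sigma> n x) < e"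
          using N by (meson le_less_trans)
      qed
    next
      case False
      then have "(\<lambda>n. \<sigma> n x) = (\<lambda>n. 0)" using in_H by (auto simp: l2_carrier_iff)
      then show ?thesis by (simp add: convergent_const)
    qed
    then obtain \<xi> where \<xi>: "\<And>x. (\<lambda>n. \<sigma> n x) \<longlonglongrightarrow> \<xi> x"
      unfolding convergent_def by metis
    have \<xi>0: "\<xi> x = 0" if "x \<notin> S" for x
    proof -
      have "(\<lambda>n. \<sigma> n x) = (\<lambda>n. 0)" using in_H that by (auto simp: l2_carrier_iff)
      then show ?thesis using \<xi>[of x] LIMSEQ_unique[OF _ tendsto_const] by metis
    qed
    have tail: "\<exists>N. \<forall>n\<ge>N. (\<lambda>x. \<sigma> n x - \<xi> x) \<in> carrier ?H \<and> hnorm ?H (\<lambda>x. \<sigma> n x - \<xi> x) \<le> e"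
      if e: "e > 0" for e
    proof -
      obtain N where N: "\<And>m n. m \<ge> N \<Longrightarrow> n \<ge> N \<Longrightarrow> hnorm ?H (\<sigma> m \<ominus>\<^bsub>?H\<^esub> \<sigma> n) < e"
        using cau[OF e] by meson
      have "(\<lambda>x. \<sigma> n x - \<xi> x) \<in> carrier ?H \<and> hnorm ?H (\<lambda>x. \<sigma> n x - \<xi> x) \<le> e" if n: "n \<ge> N" for n
      proof -
        have b: "(\<Sum>x\<in>F. (cmod (\<sigma> n x - \<xi> x))\<^sup>2) \<le> e\<^sup>2" if F: "finite F" "F \<subseteq> S" for F
        proof (rule LIMSEQ_le_const2)
          show "(\<lambda>m. \<Sum>x\<in>F. (cmod (\<sigma> n x - \<sigma> m x))\<^sup>2) \<longlonglongrightarrow> (\<Sum>x\<in>F. (cmod (\<sigma> n x - \<xi> x))\<^sup>2)"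
            by (intro tendsto_intros \<xi>)
          have "(\<Sum>x\<in>F. (cmod (\<sigma> n x - \<sigma> m x))\<^sup>2) \<le> e\<^sup>2" if "m \<ge> N" for m
          proof -
            have "(hnorm ?H (\<sigma> n \<ominus>\<^bsub>?H\<^esub> \<sigma> m))\<^sup>2 \<le> e\<^sup>2"
              by (intro power_mono less_imp_le[OF N[OF n that]] nn)
            then show ?thesis using fin[OF F, of n m] by linarith
          qed
          then show "\<exists>N. \<forall>m\<ge>N. (\<Sum>x\<in>F. (cmod (\<sigma> n x - \<sigma> m x))\<^sup>2) \<le> e\<^sup>2" by blast
        qed
        have s: "(\<lambda>x. (cmod (\<sigma> n x - \<xi> x))\<^sup>2) summable_on S"
        proof (rule nonneg_bdd_above_summable_on)
          show "bdd_above (sum (\<lambda>x. (cmod (\<sigma> n x - \<xi> x))\<^sup>2) ` {F. F \<subseteq> S \<and> finite F})"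
            using b by (intro bdd_aboveI2[of _ _ "e\<^sup>2"]) auto
        qed simp
        have c: "(\<lambda>x. \<sigma> n x - \<xi> x) \<in> carrier ?H"
          using s \<xi>0 in_H[of n] by (simp add: l2_carrier_iff)
        have "(\<Sum>\<^sub>\<infinity>x\<in>S. (cmod (\<sigma> n x - \<xi> x))\<^sup>2) \<le> e\<^sup>2"
          using s b by (intro infsum_le_finite_sums) auto
        then have "hnorm ?H (\<lambda>x. \<sigma> n x - \<xi> x) \<le> e"
          unfolding hnorm_def l2_ip_self[OF c] using e by (intro real_le_lsqrt) auto
        with c show ?thesis by blast
      qed
      then show ?thesis by blast
    qed
    \<comment> \<open>The limit lies in the space, being \<open>\<sigma> n\<close> minus a square
      summable difference.\<close>
    obtain n where "(\<lambda>x. \<sigma> n x - \<xi> x) \<in> carrier ?H" using tail[of 1] by auto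
    from minus_closed[OF in_H[of n] this] have \<xi>H: "\<xi> \<in> carrier ?H"
      using l2_minus[OF in_H[of n] \<open>(\<lambda>x. \<sigma> n x - \<xi> x) \<in> carrier ?H\<close>] by simp
    have "(\<lambda>n. hnorm ?H (\<sigma> n \<ominus>\<^bsub>?H\<^esub> \<xi>)) \<longlonglongrightarrow> 0"
    proof (rule LIMSEQ_I)
      fix e :: real assume e: "e > 0"
      then obtain N where "\<forall>n\<ge>N. hnorm ?H (\<lambda>x. \<sigma> n x - \<xi> x) \<le> e/2" using tail[of "e/2"] by auto
      then have "hnorm ?H (\<sigma> n \<ominus>\<^bsub>?H\<^esub> \<xi>) < e" if "n \<ge> N" for n
        using that e l2_minus[OF in_H \<xi>H, of n] by fastforce
      moreover have "0 \<le> hnorm ?H (\<sigma> n \<ominus>\<^bsub>?H\<^esub> \<xi>)" for n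
        by (intro semi.hnorm_nonneg minus_closed in_H \<xi>H)
      ultimately show "\<exists>no. \<forall>n\<ge>no. norm (hnorm ?H (\<sigma> n \<ominus>\<^bsub>?H\<^esub> \<xi>) - 0) < e" by auto
    qed
    with \<xi>H show "\<exists>\<xi>\<in>carrier ?H. (\<lambda>n. hnorm ?H (\<sigma> n \<ominus>\<^bsub>?H\<^esub> \<xi>)) \<longlonglongrightarrow> 0" by blast
  qed
qed

text \<open>Besides serving the reduced norm, this places the left regular representation among
  those over which the full norm is a supremum, so that the full norm dominates coefficients
  too.\<close>

lemma unitary_rep_left_regular:
  assumes G: "group G"
  shows "unitary_rep G (left_regular G)"
proof -
  interpret G: group G by fact
  let ?H = "l2_space (carrier G)"
  define \<pi> where "\<pi> = (\<lambda>g (\<xi>::'a \<Rightarrow> complex) x. if x \<in> carrier G then \<xi> (inv\<^bsub>G\<^esub> g \<otimes>\<^bsub>G\<^esub> x) else 0)"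
  have reg: "left_regular G = (?H, \<pi>)" by (simp add: left_regular_def \<pi>_def)
  have bij: "bij_betw (\<lambda>x. inv\<^bsub>G\<^esub> g \<otimes>\<^bsub>G\<^esub> x) (carrier G) (carrier G)" if g: "g \<in> carrier G" for g
  proof (rule bij_betw_byWitness[where f' = "\<lambda>x. g \<otimes>\<^bsub>G\<^esub> x"])
    show "\<forall>x\<in>carrier G. g \<otimes>\<^bsub>G\<^esub> (inv\<^bsub>G\<^esub> g \<otimes>\<^bsub>G\<^esub> x) = x"
      using g by (simp add: G.m_assoc[symmetric])
    show "\<forall>x\<in>carrier G. inv\<^bsub>G\<^esub> g \<otimes>\<^bsub>G\<^esub> (g \<otimes>\<^bsub>G\<^esub> x) = x"
      using g by (simp add: G.m_assoc[symmetric])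
  qed (use g in auto)
  have mult: "\<pi> (g \<otimes>\<^bsub>G\<^esub> h) \<xi> = \<pi> g (\<pi> h \<xi>)" if "g \<in> carrier G" "h \<in> carrier G" for g h \<xi>
    using that by (auto simp: \<pi>_def G.inv_mult_group G.m_assoc fun_eq_iff)
  have one: "\<pi> \<one>\<^bsub>G\<^esub> \<xi> = \<xi>" if "\<xi> \<in> carrier ?H" for \<xi>
    using that by (auto simp: \<pi>_def l2_carrier_iff fun_eq_iff)
  have closed: "\<pi> g \<xi> \<in> carrier ?H" if g: "g \<in> carrier G" and \<xi>: "\<xi> \<in> carrier ?H" for g \<xi>
  proof -
    have "(\<lambda>x. (cmod (\<xi> (inv\<^bsub>G\<^esub> g \<otimes>\<^bsub>G\<^esub> x)))\<^sup>2) summable_on carrier G"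
      using summable_on_reindex_bij_betw[OF bij[OF g], of "\<lambda>x. (cmod (\<xi> x))\<^sup>2"] \<xi>
      by (simp add: l2_carrier_iff)
    moreover have "(\<lambda>x. (cmod (\<pi> g \<xi> x))\<^sup>2) summable_on carrier G \<longleftrightarrow>
        (\<lambda>x. (cmod (\<xi> (inv\<^bsub>G\<^esub> g \<otimes>\<^bsub>G\<^esub> x)))\<^sup>2) summable_on carrier G"
      by (rule summable_on_cong) (simp add: \<pi>_def)
    ultimately show ?thesis by (simp add: l2_carrier_iff \<pi>_def)
  qed
  have "unitary_map ?H ?H (\<pi> g)" if g: "g \<in> carrier G" for g
    unfolding unitary_map_def complex_linear_map_def
  proof (intro conjI ballI allI)
    show "\<pi> g \<in> carrier ?H \<rightarrow> carrier ?H" using closed[OF g] by auto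
    have i: "inv\<^bsub>G\<^esub> g \<in> carrier G" using g by simp
    have inv1: "\<pi> g (\<pi> (inv\<^bsub>G\<^esub> g) \<xi>) = \<xi>" if "\<xi> \<in> carrier ?H" for \<xi>
      using one[OF that] g by (simp add: mult[OF g i, symmetric])
    have inv2: "\<pi> (inv\<^bsub>G\<^esub> g) (\<pi> g \<xi>) = \<xi>" if "\<xi> \<in> carrier ?H" for \<xi>
      using one[OF that] g by (simp add: mult[OF i g, symmetric])
    show "bij_betw (\<pi> g) (carrier ?H) (carrier ?H)"
      by (rule bij_betw_byWitness[where f' = "\<pi> (inv\<^bsub>G\<^esub> g)"])
        (use closed[OF g] closed[OF i] inv1 inv2 in blast)+
    show "\<pi> g (\<xi> \<oplus>\<^bsub>?H\<^esub> \<eta>) = \<pi> g \<xi> \<oplus>\<^bsub>?H\<^esub> \<pi> g \<eta>" for \<xi> \<eta> by (auto simp: \<pi>_def)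
    show "\<pi> g (a \<odot>\<^bsub>?H\<^esub> \<xi>) = a \<odot>\<^bsub>?H\<^esub> \<pi> g \<xi>" for a \<xi> by (auto simp: \<pi>_def)
    fix \<xi> \<eta> :: "'a \<Rightarrow> complex"
    have "(\<Sum>\<^sub>\<infinity>x\<in>carrier G. \<pi> g \<xi> x * cnj (\<pi> g \<eta> x)) =
        (\<Sum>\<^sub>\<infinity>x\<in>carrier G. \<xi> (inv\<^bsub>G\<^esub> g \<otimes>\<^bsub>G\<^esub> x) * cnj (\<eta> (inv\<^bsub>G\<^esub> g \<otimes>\<^bsub>G\<^esub> x)))"
      by (rule infsum_cong) (simp add: \<pi>_def)
    also have "\<dots> = (\<Sum>\<^sub>\<infinity>x\<in>carrier G. \<xi> x * cnj (\<eta> x))"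
      by (rule infsum_reindex_bij_betw[OF bij[OF g]])
    finally show "ip ?H (\<pi> g \<xi>) (\<pi> g \<eta>) = ip ?H \<xi> \<eta>" by simp
  qed
  then show ?thesis
    unfolding reg unitary_rep_def using hilbert_l2 one mult by auto
qed

lemma delta_l2:
  assumes "x \<in> S"
  shows "delta x \<in> carrier (l2_space S)" "\<xi> \<in> carrier (l2_space S) \<Longrightarrow> ip (l2_space S) \<xi> (delta x) = \<xi> x"
proof -
  have "(\<lambda>y. (cmod (delta x y))\<^sup>2) summable_on S \<longleftrightarrow> (\<lambda>y. (cmod (delta x y))\<^sup>2) summable_on {x}"
    by (rule summable_on_cong_neutral) (use assms in \<open>auto simp: delta_def\<close>)
  then show "delta x \<in> carrier (l2_space S)"
    using assms by (auto simp: l2_carrier_iff delta_def)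
  have "(\<Sum>\<^sub>\<infinity>y\<in>S. \<xi> y * cnj (delta x y)) = (\<Sum>\<^sub>\<infinity>y\<in>{x}. \<xi> y * cnj (delta x y))"
    by (rule infsum_cong_neutral) (use assms in \<open>auto simp: delta_def\<close>)
  then show "ip (l2_space S) \<xi> (delta x) = \<xi> x" by (simp add: delta_def)
qed

section \<open>Norms on the group algebra\<close>

text \<open>With \<open>conv\<close> and \<open>star\<close>, a name for the data of
  \<open>group_algebra\<close> that all norms share.\<close>

definition supported :: "('g, 'm) monoid_scheme \<Rightarrow> ('g \<Rightarrow> complex) set" where
  "supported G = {f. finite {x. f x \<noteq> 0} \<and> {x. f x \<noteq> 0} \<subseteq> carrier G}"

definition conv :: "('g, 'm) monoid_scheme \<Rightarrow> ('g \<Rightarrow> complex) \<Rightarrow> ('g \<Rightarrow> complex) \<Rightarrow> 'g \<Rightarrow> complex" where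
  "conv G f h x = (if x \<in> carrier G then \<Sum>y | f y \<noteq> 0. f y * h (inv\<^bsub>G\<^esub> y \<otimes>\<^bsub>G\<^esub> x) else 0)"

definition star :: "('g, 'm) monoid_scheme \<Rightarrow> ('g \<Rightarrow> complex) \<Rightarrow> 'g \<Rightarrow> complex" where
  "star G f x = (if x \<in> carrier G then cnj (f (inv\<^bsub>G\<^esub> x)) else 0)"

lemma group_algebra_simps [simp]:
  "carrier (group_algebra G N) = supported G" "monoid.mult (group_algebra G N) = conv G"
  "one (group_algebra G N) = delta \<one>\<^bsub>G\<^esub>" "zero (group_algebra G N) = (\<lambda>x. 0)"
  "add (group_algebra G N) = (\<lambda>f h x. f x + h x)" "smult (group_algebra G N) = (\<lambda>a f x. a * f x)"
  "adj (group_algebra G N) = star G" "anorm (group_algebra G N) = N"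
  by (auto simp: group_algebra_def supported_def conv_def star_def delta_def fun_eq_iff)

lemma supported_add: "\<lbrakk>f \<in> supported G; h \<in> supported G\<rbrakk> \<Longrightarrow> (\<lambda>x. f x + h x) \<in> supported G"
proof -
  assume fh: "f \<in> supported G" "h \<in> supported G"
  have "{x. f x + h x \<noteq> 0} \<subseteq> {x. f x \<noteq> 0} \<union> {x. h x \<noteq> 0}" by auto
  then show ?thesis using fh unfolding supported_def by (blast intro: finite_subset)
qed

lemma supported_smult: "f \<in> supported G \<Longrightarrow> (\<lambda>x. a * f x) \<in> supported G"
proof -
  assume f: "f \<in> supported G"
  have "{x. a * f x \<noteq> 0} \<subseteq> {x. f x \<noteq> 0}" by auto
  then show ?thesis using f unfolding supported_def by (blast intro: finite_subset)
qed

lemma supported_zero: "(\<lambda>x. 0) \<in> supported G"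
  by (simp add: supported_def)

lemma supported_delta: "x \<in> carrier G \<Longrightarrow> delta x \<in> supported G"
  by (auto simp: supported_def delta_def)

lemma module_group_algebra: "module complex_ring (group_algebra G N)"
  by (rule function_module) (simp_all add: supported_add supported_smult supported_zero)

lemma group_algebra_minus: "\<lbrakk>f \<in> supported G; h \<in> supported G\<rbrakk>
    \<Longrightarrow> f \<ominus>\<^bsub>group_algebra G N\<^esub> h = (\<lambda>x. f x - h x)"
  by (rule function_module_minus[OF module_group_algebra]) simp_all

lemma supported_diff: "\<lbrakk>f \<in> supported G; h \<in> supported G\<rbrakk> \<Longrightarrow> (\<lambda>x. f x - h x) \<in> supported G"
  using supported_add[of f G "\<lambda>x. - h x"] supported_smult[of h G "-1"] by simp

lemma support_conv:
  assumes "group G" "f \<in> supported G" "h \<in> supported G"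
  shows "{x. conv G f h x \<noteq> 0} \<subseteq> (\<lambda>(y, k). y \<otimes>\<^bsub>G\<^esub> k) ` ({x. f x \<noteq> 0} \<times> {x. h x \<noteq> 0})"
proof
  interpret G: group G by fact
  fix x assume "x \<in> {x. conv G f h x \<noteq> 0}"
  then have x: "x \<in> carrier G" and "(\<Sum>y | f y \<noteq> 0. f y * h (inv\<^bsub>G\<^esub> y \<otimes>\<^bsub>G\<^esub> x)) \<noteq> 0"
    by (auto simp: conv_def split: if_splits)
  then obtain y where y: "f y \<noteq> 0" "f y * h (inv\<^bsub>G\<^esub> y \<otimes>\<^bsub>G\<^esub> x) \<noteq> 0"
    by (auto elim: sum.not_neutral_contains_not_neutral)
  then have "y \<in> carrier G" using assms by (auto simp: supported_def)
  then have "x = y \<otimes>\<^bsub>G\<^esub> (inv\<^bsub>G\<^esub> y \<otimes>\<^bsub>G\<^esub> x)" using x by (simp add: G.m_assoc[symmetric])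
  with y show "x \<in> (\<lambda>(y, k). y \<otimes>\<^bsub>G\<^esub> k) ` ({x. f x \<noteq> 0} \<times> {x. h x \<noteq> 0})"
    by (intro image_eqI[of _ _ "(y, inv\<^bsub>G\<^esub> y \<otimes>\<^bsub>G\<^esub> x)"]) auto
qed

lemma supported_conv:
  assumes "group G" "f \<in> supported G" "h \<in> supported G"
  shows "conv G f h \<in> supported G"
proof -
  have "finite ((\<lambda>(y, k). y \<otimes>\<^bsub>G\<^esub> k) ` ({x. f x \<noteq> 0} \<times> {x. h x \<noteq> 0}))"
    using assms by (intro finite_imageI finite_cartesian_product) (simp_all add: supported_def)
  then have "finite {x. conv G f h x \<noteq> 0}" using support_conv[OF assms] by (rule finite_subset[rotated])
  then show ?thesis by (auto simp: supported_def conv_def)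
qed

lemma support_star:
  assumes "group G" "f \<in> supported G"
  shows "{x. star G f x \<noteq> 0} = (\<lambda>x. inv\<^bsub>G\<^esub> x) ` {x. f x \<noteq> 0}"
proof (intro equalityI subsetI)
  interpret G: group G by fact
  fix x assume "x \<in> {x. star G f x \<noteq> 0}"
  then have x: "x \<in> carrier G" "f (inv\<^bsub>G\<^esub> x) \<noteq> 0" by (auto simp: star_def split: if_splits)
  then have "x = inv\<^bsub>G\<^esub> (inv\<^bsub>G\<^esub> x)" by simp
  with x show "x \<in> (\<lambda>x. inv\<^bsub>G\<^esub> x) ` {x. f x \<noteq> 0}" by blast
next
  interpret G: group G by fact
  fix x assume "x \<in> (\<lambda>x. inv\<^bsub>G\<^esub> x) ` {x. f x \<noteq> 0}"
  then obtain y where y: "f y \<noteq> 0" "x = inv\<^bsub>G\<^esub> y" by auto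
  then have "y \<in> carrier G" using assms by (auto simp: supported_def)
  then show "x \<in> {x. star G f x \<noteq> 0}" using y by (simp add: star_def)
qed

lemma supported_star:
  assumes "group G" "f \<in> supported G"
  shows "star G f \<in> supported G"
proof -
  have "finite {x. star G f x \<noteq> 0}"
    unfolding support_star[OF assms] using assms by (simp add: supported_def)
  then show ?thesis by (auto simp: supported_def star_def)
qed

context pre_hilbert_space
begin

text \<open>Turns identities between values of \<open>rep_ext\<close>, which are sums in
  \<open>H\<close>, into identities between finite sums of complex numbers.\<close>

lemma vector_eqI:
  assumes "x \<in> carrier H" "y \<in> carrier H" "\<And>z. z \<in> carrier H \<Longrightarrow> ip H x z = ip H y z"
  shows "x = y"
proof -
  have "ip H (x \<ominus> y) (x \<ominus> y) = 0"
    using assms(3)[of "x \<ominus> y"] assms(1,2) by (simp add: semi.ip_diff_left del: semi.ip_diff_right)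
  then have "x \<ominus> y = \<zero>" using ip_pos[of "x \<ominus> y"] assms(1,2) by fastforce
  then show ?thesis using diff_eq_0 assms by blast
qed

end

section \<open>Extending a unitary representation to the group algebra\<close>

context unitary_representation
begin

lemma rep_ext_closed:
  assumes "f \<in> supported G" "\<xi> \<in> carrier H"
  shows "rep_ext (H, \<pi>) f \<xi> \<in> carrier H"
  unfolding rep_ext_def prod.case
  using assms by (intro finsum_closed) (auto simp: supported_def)

lemma ip_rep_ext:
  assumes f: "f \<in> supported G" and \<xi>: "\<xi> \<in> carrier H" and \<eta>: "\<eta> \<in> carrier H"
    and F: "finite F" "{x. f x \<noteq> 0} \<subseteq> F"
  shows "ip H (rep_ext (H, \<pi>) f \<xi>) \<eta> = (\<Sum>g\<in>F. f g * ip H (\<pi> g \<xi>) \<eta>)"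
proof -
  have c: "\<pi> g \<xi> \<in> carrier H" if "f g \<noteq> 0" for g
    using that f \<xi> by (auto simp: supported_def)
  then have "(\<lambda>g. f g \<odot>\<^bsub>H\<^esub> \<pi> g \<xi>) \<in> {g. f g \<noteq> 0} \<rightarrow> carrier H" by auto
  then have "ip H (rep_ext (H, \<pi>) f \<xi>) \<eta> = (\<Sum>g | f g \<noteq> 0. ip H (f g \<odot>\<^bsub>H\<^esub> \<pi> g \<xi>) \<eta>)"
    unfolding rep_ext_def prod.case
    using f \<eta> by (intro semi.ip_finsum_left) (simp_all add: supported_def)
  also have "\<dots> = (\<Sum>g | f g \<noteq> 0. f g * ip H (\<pi> g \<xi>) \<eta>)"
    using c \<eta> by (intro sum.cong refl) (simp add: ip_smult_left)
  also have "\<dots> = (\<Sum>g\<in>F. f g * ip H (\<pi> g \<xi>) \<eta>)"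
    using F by (intro sum.mono_neutral_left) auto
  finally show ?thesis .
qed

lemma rep_ext_bound:
  assumes f: "f \<in> supported G" and \<xi>: "\<xi> \<in> carrier H"
  shows "hnorm H (rep_ext (H, \<pi>) f \<xi>) \<le> (\<Sum>g | f g \<noteq> 0. cmod (f g)) * hnorm H \<xi>"
proof -
  have c: "g \<in> carrier G" if "f g \<noteq> 0" for g
    using that f by (auto simp: supported_def)
  then have "(\<lambda>g. f g \<odot>\<^bsub>H\<^esub> \<pi> g \<xi>) \<in> {g. f g \<noteq> 0} \<rightarrow> carrier H" using \<xi> by auto
  then have "hnorm H (rep_ext (H, \<pi>) f \<xi>) \<le> (\<Sum>g | f g \<noteq> 0. hnorm H (f g \<odot>\<^bsub>H\<^esub> \<pi> g \<xi>))"
    unfolding rep_ext_def prod.case using f by (intro semi.hnorm_finsum) (simp_all add: supported_def)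
  also have "\<dots> = (\<Sum>g | f g \<noteq> 0. cmod (f g) * hnorm H \<xi>)"
    using c \<xi> by (intro sum.cong refl) (simp add: semi.hnorm_smult rep_hnorm)
  finally show ?thesis by (simp add: sum_distrib_right)
qed

lemma rep_ext_vector_smult:
  assumes f: "f \<in> supported G" and \<xi>: "\<xi> \<in> carrier H"
  shows "rep_ext (H, \<pi>) f (a \<odot>\<^bsub>H\<^esub> \<xi>) = a \<odot>\<^bsub>H\<^esub> rep_ext (H, \<pi>) f \<xi>"
proof (rule vector_eqI)
  fix \<eta> assume \<eta>: "\<eta> \<in> carrier H"
  let ?F = "{x. f x \<noteq> 0}"
  have F: "finite ?F" "?F \<subseteq> carrier G" using f by (auto simp: supported_def)
  have "ip H (rep_ext (H, \<pi>) f (a \<odot>\<^bsub>H\<^esub> \<xi>)) \<eta> = (\<Sum>g\<in>?F. f g * ip H (\<pi> g (a \<odot>\<^bsub>H\<^esub> \<xi>)) \<eta>)"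
    using f \<xi> \<eta> F by (intro ip_rep_ext) auto
  also have "\<dots> = (\<Sum>g\<in>?F. a * (f g * ip H (\<pi> g \<xi>) \<eta>))"
    using F \<xi> \<eta> by (intro sum.cong refl) (auto simp: rep_smult ip_smult_left subset_iff)
  also have "\<dots> = a * ip H (rep_ext (H, \<pi>) f \<xi>) \<eta>"
    using ip_rep_ext[OF f \<xi> \<eta> F(1) subset_refl] by (simp add: sum_distrib_left)
  finally show "ip H (rep_ext (H, \<pi>) f (a \<odot>\<^bsub>H\<^esub> \<xi>)) \<eta> = ip H (a \<odot>\<^bsub>H\<^esub> rep_ext (H, \<pi>) f \<xi>) \<eta>"
    using rep_ext_closed[OF f \<xi>] \<eta> by (simp add: ip_smult_left)
qed (use rep_ext_closed f \<xi> in auto)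

lemma rep_ext_add:
  assumes f: "f \<in> supported G" and h: "h \<in> supported G" and \<xi>: "\<xi> \<in> carrier H"
  shows "rep_ext (H, \<pi>) (\<lambda>x. f x + h x) \<xi> = rep_ext (H, \<pi>) f \<xi> \<oplus>\<^bsub>H\<^esub> rep_ext (H, \<pi>) h \<xi>"
proof (rule vector_eqI)
  have c: "rep_ext (H, \<pi>) f \<xi> \<in> carrier H" "rep_ext (H, \<pi>) h \<xi> \<in> carrier H"
    using rep_ext_closed f h \<xi> by auto
  show "rep_ext (H, \<pi>) (\<lambda>x. f x + h x) \<xi> \<in> carrier H"
    by (rule rep_ext_closed[OF supported_add[OF f h] \<xi>])
  show "rep_ext (H, \<pi>) f \<xi> \<oplus>\<^bsub>H\<^esub> rep_ext (H, \<pi>) h \<xi> \<in> carrier H" using c by simp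
  fix \<eta> assume \<eta>: "\<eta> \<in> carrier H"
  let ?F = "{x. f x \<noteq> 0} \<union> {x. h x \<noteq> 0}"
  have F: "finite ?F" using f h by (simp add: supported_def)
  have "ip H (rep_ext (H, \<pi>) (\<lambda>x. f x + h x) \<xi>) \<eta> = (\<Sum>g\<in>?F. (f g + h g) * ip H (\<pi> g \<xi>) \<eta>)"
    using F by (intro ip_rep_ext[OF supported_add[OF f h] \<xi> \<eta>]) auto
  moreover have "ip H (rep_ext (H, \<pi>) f \<xi>) \<eta> = (\<Sum>g\<in>?F. f g * ip H (\<pi> g \<xi>) \<eta>)"
    using F by (intro ip_rep_ext[OF f \<xi> \<eta>]) auto
  moreover have "ip H (rep_ext (H, \<pi>) h \<xi>) \<eta> = (\<Sum>g\<in>?F. h g * ip H (\<pi> g \<xi>) \<eta>)"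
    using F by (intro ip_rep_ext[OF h \<xi> \<eta>]) auto
  ultimately show "ip H (rep_ext (H, \<pi>) (\<lambda>x. f x + h x) \<xi>) \<eta> =
      ip H (rep_ext (H, \<pi>) f \<xi> \<oplus>\<^bsub>H\<^esub> rep_ext (H, \<pi>) h \<xi>) \<eta>"
    using c \<eta> by (simp add: ip_add_left distrib_right sum.distrib)
qed

lemma rep_ext_smult:
  assumes f: "f \<in> supported G" and \<xi>: "\<xi> \<in> carrier H"
  shows "rep_ext (H, \<pi>) (\<lambda>x. a * f x) \<xi> = a \<odot>\<^bsub>H\<^esub> rep_ext (H, \<pi>) f \<xi>"
proof (rule vector_eqI)
  have c: "rep_ext (H, \<pi>) f \<xi> \<in> carrier H" by (rule rep_ext_closed[OF f \<xi>])
  show "rep_ext (H, \<pi>) (\<lambda>x. a * f x) \<xi> \<in> carrier H"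
    by (rule rep_ext_closed[OF supported_smult[OF f] \<xi>])
  show "a \<odot>\<^bsub>H\<^esub> rep_ext (H, \<pi>) f \<xi> \<in> carrier H" using c by simp
  fix \<eta> assume \<eta>: "\<eta> \<in> carrier H"
  have F: "finite {x. f x \<noteq> 0}" using f by (simp add: supported_def)
  have "ip H (rep_ext (H, \<pi>) (\<lambda>x. a * f x) \<xi>) \<eta> = (\<Sum>g | f g \<noteq> 0. a * f g * ip H (\<pi> g \<xi>) \<eta>)"
    using F by (intro ip_rep_ext[OF supported_smult[OF f] \<xi> \<eta>]) auto
  then show "ip H (rep_ext (H, \<pi>) (\<lambda>x. a * f x) \<xi>) \<eta> = ip H (a \<odot>\<^bsub>H\<^esub> rep_ext (H, \<pi>) f \<xi>) \<eta>"
    using c \<eta> ip_rep_ext[OF f \<xi> \<eta> F subset_refl] by (simp add: ip_smult_left sum_distrib_left mult.assoc)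
qed

text \<open>After pairing with \<open>\<eta>\<close> and exchanging the sums, only the points
  \<open>x = y k\<close> with \<open>k\<close> in the support of \<open>h\<close> contribute for a
  fixed \<open>y\<close>. Moving \<open>\<pi> y\<close> to the other side of the inner product
  exposes the sum for \<open>h\<close>.\<close>

lemma rep_ext_conv:
  assumes f: "f \<in> supported G" and h: "h \<in> supported G" and \<xi>: "\<xi> \<in> carrier H"
  shows "rep_ext (H, \<pi>) (conv G f h) \<xi> = rep_ext (H, \<pi>) f (rep_ext (H, \<pi>) h \<xi>)"
proof (rule vector_eqI)
  let ?S = "{x. f x \<noteq> 0}" and ?T = "{x. h x \<noteq> 0}"
  have S: "finite ?S" "?S \<subseteq> carrier G" and T: "finite ?T" "?T \<subseteq> carrier G"
    using f h by (auto simp: supported_def)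
  have fh: "conv G f h \<in> supported G" by (rule supported_conv[OF G.group_axioms f h])
  have c: "rep_ext (H, \<pi>) h \<xi> \<in> carrier H" by (rule rep_ext_closed[OF h \<xi>])
  show "rep_ext (H, \<pi>) (conv G f h) \<xi> \<in> carrier H" by (rule rep_ext_closed[OF fh \<xi>])
  show "rep_ext (H, \<pi>) f (rep_ext (H, \<pi>) h \<xi>) \<in> carrier H" by (rule rep_ext_closed[OF f c])
  fix \<eta> assume \<eta>: "\<eta> \<in> carrier H"
  let ?P = "(\<lambda>(y, k). y \<otimes>\<^bsub>G\<^esub> k) ` (?S \<times> ?T)"
  have P: "finite ?P" "?P \<subseteq> carrier G" using S T by (auto simp: subset_iff)
  have "ip H (rep_ext (H, \<pi>) (conv G f h) \<xi>) \<eta> = (\<Sum>x\<in>?P. conv G f h x * ip H (\<pi> x \<xi>) \<eta>)"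
    by (rule ip_rep_ext[OF fh \<xi> \<eta> P(1) support_conv[OF G.group_axioms f h]])
  also have "\<dots> = (\<Sum>x\<in>?P. \<Sum>y\<in>?S. f y * h (inv\<^bsub>G\<^esub> y \<otimes>\<^bsub>G\<^esub> x) * ip H (\<pi> x \<xi>) \<eta>)"
    using P by (intro sum.cong refl) (auto simp: conv_def sum_distrib_right subset_iff)
  also have "\<dots> = (\<Sum>y\<in>?S. \<Sum>x\<in>?P. f y * h (inv\<^bsub>G\<^esub> y \<otimes>\<^bsub>G\<^esub> x) * ip H (\<pi> x \<xi>) \<eta>)"
    by (rule sum.swap)
  also have "\<dots> = (\<Sum>y\<in>?S. f y * ip H (\<pi> y (rep_ext (H, \<pi>) h \<xi>)) \<eta>)"
  proof (rule sum.cong[OF refl])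
    fix y assume y: "y \<in> ?S"
    then have yc: "y \<in> carrier G" using S by auto
    have cancel: "inv\<^bsub>G\<^esub> y \<otimes>\<^bsub>G\<^esub> (y \<otimes>\<^bsub>G\<^esub> k) = k" if "k \<in> carrier G" for k
      using yc that by (simp add: G.m_assoc[symmetric])
    have cancel': "y \<otimes>\<^bsub>G\<^esub> (inv\<^bsub>G\<^esub> y \<otimes>\<^bsub>G\<^esub> k) = k" if "k \<in> carrier G" for k
      using yc that by (simp add: G.m_assoc[symmetric])
    have inj: "inj_on (\<lambda>k. y \<otimes>\<^bsub>G\<^esub> k) ?T"
      using cancel T(2) by (intro inj_on_inverseI[of _ "\<lambda>x. inv\<^bsub>G\<^esub> y \<otimes>\<^bsub>G\<^esub> x"]) auto
    have "(\<Sum>x\<in>?P. f y * h (inv\<^bsub>G\<^esub> y \<otimes>\<^bsub>G\<^esub> x) * ip H (\<pi> x \<xi>) \<eta>) =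
      (\<Sum>x\<in>(\<lambda>k. y \<otimes>\<^bsub>G\<^esub> k) ` ?T. f y * h (inv\<^bsub>G\<^esub> y \<otimes>\<^bsub>G\<^esub> x) * ip H (\<pi> x \<xi>) \<eta>)"
    proof (rule sum.mono_neutral_right[OF P(1)])
      show "(\<lambda>k. y \<otimes>\<^bsub>G\<^esub> k) ` ?T \<subseteq> ?P" using y by auto
      show "\<forall>x\<in>?P - (\<lambda>k. y \<otimes>\<^bsub>G\<^esub> k) ` ?T. f y * h (inv\<^bsub>G\<^esub> y \<otimes>\<^bsub>G\<^esub> x) * ip H (\<pi> x \<xi>) \<eta> = 0"
      proof
        fix x assume x: "x \<in> ?P - (\<lambda>k. y \<otimes>\<^bsub>G\<^esub> k) ` ?T"
        then have "x = y \<otimes>\<^bsub>G\<^esub> (inv\<^bsub>G\<^esub> y \<otimes>\<^bsub>G\<^esub> x)" using cancel' P(2) by auto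
        then have "inv\<^bsub>G\<^esub> y \<otimes>\<^bsub>G\<^esub> x \<notin> ?T" using x by blast
        then show "f y * h (inv\<^bsub>G\<^esub> y \<otimes>\<^bsub>G\<^esub> x) * ip H (\<pi> x \<xi>) \<eta> = 0" by simp
      qed
    qed
    also have "\<dots> = (\<Sum>k\<in>?T. f y * (h k * ip H (\<pi> k \<xi>) (\<pi> (inv\<^bsub>G\<^esub> y) \<eta>)))"
      unfolding sum.reindex[OF inj] comp_def
    proof (rule sum.cong[OF refl])
      fix k assume "k \<in> ?T"
      then have k: "k \<in> carrier G" using T by auto
      have "ip H (\<pi> (y \<otimes>\<^bsub>G\<^esub> k) \<xi>) \<eta> = ip H (\<pi> k \<xi>) (\<pi> (inv\<^bsub>G\<^esub> y) \<eta>)"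
        using rep_mult[OF yc k \<xi>] rep_inv_left[OF yc rep_closed[OF k \<xi>] \<eta>] by simp
      then show "f y * h (inv\<^bsub>G\<^esub> y \<otimes>\<^bsub>G\<^esub> (y \<otimes>\<^bsub>G\<^esub> k)) * ip H (\<pi> (y \<otimes>\<^bsub>G\<^esub> k) \<xi>) \<eta> =
          f y * (h k * ip H (\<pi> k \<xi>) (\<pi> (inv\<^bsub>G\<^esub> y) \<eta>))"
        using cancel[OF k] by simp
    qed
    also have "\<dots> = f y * ip H (rep_ext (H, \<pi>) h \<xi>) (\<pi> (inv\<^bsub>G\<^esub> y) \<eta>)"
      using ip_rep_ext[OF h \<xi> _ T(1) subset_refl, of "\<pi> (inv\<^bsub>G\<^esub> y) \<eta>"] yc \<eta>
      by (simp add: sum_distrib_left)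
    also have "ip H (rep_ext (H, \<pi>) h \<xi>) (\<pi> (inv\<^bsub>G\<^esub> y) \<eta>) = ip H (\<pi> y (rep_ext (H, \<pi>) h \<xi>)) \<eta>"
      using rep_inv_left[OF yc c \<eta>] by simp
    finally show "(\<Sum>x\<in>?P. f y * h (inv\<^bsub>G\<^esub> y \<otimes>\<^bsub>G\<^esub> x) * ip H (\<pi> x \<xi>) \<eta>) =
      f y * ip H (\<pi> y (rep_ext (H, \<pi>) h \<xi>)) \<eta>" .
  qed
  also have "\<dots> = ip H (rep_ext (H, \<pi>) f (rep_ext (H, \<pi>) h \<xi>)) \<eta>"
    using ip_rep_ext[OF f c \<eta> S(1) subset_refl] by simp
  finally show "ip H (rep_ext (H, \<pi>) (conv G f h) \<xi>) \<eta> = ip H (rep_ext (H, \<pi>) f (rep_ext (H, \<pi>) h \<xi>)) \<eta>" .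
qed

lemma rep_ext_star:
  assumes f: "f \<in> supported G" and \<xi>: "\<xi> \<in> carrier H" and \<eta>: "\<eta> \<in> carrier H"
  shows "ip H (rep_ext (H, \<pi>) (star G f) \<xi>) \<eta> = ip H \<xi> (rep_ext (H, \<pi>) f \<eta>)"
proof -
  let ?S = "{x. f x \<noteq> 0}"
  have S: "finite ?S" "?S \<subseteq> carrier G" using f by (auto simp: supported_def)
  have inj: "inj_on (\<lambda>x. inv\<^bsub>G\<^esub> x) ?S"
    using S(2) by (intro inj_on_inverseI[of _ "\<lambda>x. inv\<^bsub>G\<^esub> x"]) auto
  have "ip H (rep_ext (H, \<pi>) (star G f) \<xi>) \<eta> =
      (\<Sum>x\<in>(\<lambda>x. inv\<^bsub>G\<^esub> x) ` ?S. star G f x * ip H (\<pi> x \<xi>) \<eta>)"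
    using support_star[OF G.group_axioms f] S
    by (intro ip_rep_ext[OF supported_star[OF G.group_axioms f] \<xi> \<eta>]) auto
  also have "\<dots> = (\<Sum>x\<in>?S. cnj (f x * ip H (\<pi> x \<eta>) \<xi>))"
    unfolding sum.reindex[OF inj] comp_def
  proof (rule sum.cong[OF refl])
    fix x assume "x \<in> ?S"
    then have x: "x \<in> carrier G" using S by auto
    have "ip H (\<pi> (inv\<^bsub>G\<^esub> x) \<xi>) \<eta> = ip H \<xi> (\<pi> x \<eta>)"
      using rep_inv_left[of "inv\<^bsub>G\<^esub> x" \<xi> \<eta>] x \<xi> \<eta> by simp
    also have "\<dots> = cnj (ip H (\<pi> x \<eta>) \<xi>)" by (rule ip_commute) (use x \<xi> \<eta> in auto)
    finally show "star G f (inv\<^bsub>G\<^esub> x) * ip H (\<pi> (inv\<^bsub>G\<^esub> x) \<xi>) \<eta> = cnj (f x * ip H (\<pi> x \<eta>) \<xi>)"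
      using x by (simp add: star_def)
  qed
  also have "\<dots> = cnj (ip H (rep_ext (H, \<pi>) f \<eta>) \<xi>)"
    using ip_rep_ext[OF f \<eta> \<xi> S(1) subset_refl] by simp
  also have "\<dots> = ip H \<xi> (rep_ext (H, \<pi>) f \<eta>)"
    using ip_commute[of "rep_ext (H, \<pi>) f \<eta>" \<xi>] rep_ext_closed[OF f \<eta>] \<xi> by simp
  finally show ?thesis .
qed

lemma op_norm_le:
  assumes "\<And>\<xi>. \<xi> \<in> carrier H \<Longrightarrow> hnorm H (T \<xi>) \<le> c * hnorm H \<xi>" "0 \<le> c"
  shows "op_norm H T \<le> c"
  unfolding op_norm_def
proof (rule cSUP_least)
  show "{x \<in> carrier H. hnorm H x \<le> 1} \<noteq> {}" using semi.hnorm_zero by force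
  fix x assume "x \<in> {x \<in> carrier H. hnorm H x \<le> 1}"
  then show "hnorm H (T x) \<le> c"
    using assms(1)[of x] mult_left_mono[of "hnorm H x" 1 c] assms(2) by auto
qed

lemma op_norm_bound:
  assumes f: "f \<in> supported G" and \<xi>: "\<xi> \<in> carrier H"
  shows "hnorm H (rep_ext (H, \<pi>) f \<xi>) \<le> op_norm H (rep_ext (H, \<pi>) f) * hnorm H \<xi>"
proof (cases "hnorm H \<xi> = 0")
  case True
  then show ?thesis using rep_ext_bound[OF f \<xi>] by simp
next
  case False
  let ?r = "hnorm H \<xi>"
  have r: "?r > 0" using False semi.hnorm_nonneg[OF \<xi>] by simp
  let ?\<eta> = "of_real (1 / ?r) \<odot>\<^bsub>H\<^esub> \<xi>"
  have \<eta>: "?\<eta> \<in> carrier H" "hnorm H ?\<eta> \<le> 1" using \<xi> r by (simp_all add: semi.hnorm_smult norm_divide)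
  \<comment> \<open>A real supremum bounds its members only if the set is bounded; here the bound is
    the sum of the moduli of the values of \<open>f\<close>.\<close>
  have "bdd_above ((\<lambda>x. hnorm H (rep_ext (H, \<pi>) f x)) ` {x \<in> carrier H. hnorm H x \<le> 1})"
  proof (rule bdd_aboveI2)
    fix x assume x: "x \<in> {x \<in> carrier H. hnorm H x \<le> 1}"
    then have "hnorm H (rep_ext (H, \<pi>) f x) \<le> (\<Sum>g | f g \<noteq> 0. cmod (f g)) * hnorm H x"
      using rep_ext_bound[OF f] by auto
    also have "\<dots> \<le> (\<Sum>g | f g \<noteq> 0. cmod (f g)) * 1"
      using x by (intro mult_left_mono sum_nonneg) auto
    finally show "hnorm H (rep_ext (H, \<pi>) f x) \<le> (\<Sum>g | f g \<noteq> 0. cmod (f g)) * 1" .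
  qed
  then have "hnorm H (rep_ext (H, \<pi>) f ?\<eta>) \<le> op_norm H (rep_ext (H, \<pi>) f)"
    unfolding op_norm_def using \<eta> by (intro cSUP_upper) auto
  moreover have "hnorm H (rep_ext (H, \<pi>) f ?\<eta>) = hnorm H (rep_ext (H, \<pi>) f \<xi>) / ?r"
    using r by (simp add: rep_ext_vector_smult[OF f \<xi>] semi.hnorm_smult[OF rep_ext_closed[OF f \<xi>]] norm_divide)
  ultimately have "hnorm H (rep_ext (H, \<pi>) f \<xi>) / ?r \<le> op_norm H (rep_ext (H, \<pi>) f)" by simp
  then show ?thesis using r by (simp add: pos_divide_le_eq)
qed

end

text \<open>The laws common to the full and the reduced norm, through which the rest of the argument
  treats both. \<open>norm_coeff\<close> makes coefficients continuous and the norm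
  definite.\<close>

locale group_algebra_norm = G: group G for G :: "('g, 'm) monoid_scheme" +
  fixes N :: "('g \<Rightarrow> complex) \<Rightarrow> real"
  assumes norm_coeff: "f \<in> supported G \<Longrightarrow> cmod (f x) \<le> N f"
    and norm_add: "\<lbrakk>f \<in> supported G; h \<in> supported G\<rbrakk> \<Longrightarrow> N (\<lambda>x. f x + h x) \<le> N f + N h"
    and norm_smult: "f \<in> supported G \<Longrightarrow> N (\<lambda>x. a * f x) \<le> cmod a * N f"
    and norm_conv: "\<lbrakk>f \<in> supported G; h \<in> supported G\<rbrakk> \<Longrightarrow> N (conv G f h) \<le> N f * N h"
    and norm_star: "f \<in> supported G \<Longrightarrow> N (star G f) \<le> N f"

text \<open>The set \<open>R\<close> of all unitary representations on the fixed type gives the full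
  norm, the singleton of the left regular one gives the reduced norm.\<close>

definition rep_norm :: "('g, 'v) rep set \<Rightarrow> ('g \<Rightarrow> complex) \<Rightarrow> real" where
  "rep_norm R f = (SUP \<rho>\<in>R. op_norm (fst \<rho>) (rep_ext \<rho> f))"

text \<open>\<open>bound\<close> and \<open>least\<close> transfer each law from the corresponding
  operator estimate. Domination of coefficients comes from the left regular representation, where
  \<open>f y = \<langle>\<lambda>(f) \<delta>\<^sub>1, \<delta>\<^sub>y\<rangle>\<close>.\<close>

lemma group_algebra_norm_rep_norm:
  assumes G: "group G" and R: "\<And>\<rho>. \<rho> \<in> R \<Longrightarrow> unitary_rep G \<rho>" and reg: "left_regular G \<in> R"
  shows "group_algebra_norm G (rep_norm R)"
proof -
  interpret G: group G by fact
  have repR: "unitary_representation G H \<pi>" if "(H, \<pi>) \<in> R" for H \<pi>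
    using R[OF that] G
    by (simp add: unitary_representation_def unitary_representation_axioms_def unitary_rep_def)
  have bound: "hnorm H (rep_ext (H, \<pi>) f \<xi>) \<le> rep_norm R f * hnorm H \<xi>"
    if \<rho>: "(H, \<pi>) \<in> R" and f: "f \<in> supported G" and \<xi>: "\<xi> \<in> carrier H" for H \<pi> f \<xi>
  proof -
    interpret unitary_representation G H \<pi> by (rule repR[OF \<rho>])
    have "bdd_above ((\<lambda>\<rho>. op_norm (fst \<rho>) (rep_ext \<rho> f)) ` R)"
    proof (rule bdd_aboveI2)
      fix \<sigma> assume \<sigma>R: "\<sigma> \<in> R"
      obtain K \<tau> where \<sigma>: "\<sigma> = (K, \<tau>)" by (cases \<sigma>)
      interpret s: unitary_representation G K \<tau> by (rule repR) (use \<sigma>R \<sigma> in simp)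
      show "op_norm (fst \<sigma>) (rep_ext \<sigma> f) \<le> (\<Sum>g | f g \<noteq> 0. cmod (f g))"
        unfolding \<sigma> fst_conv by (rule s.op_norm_le[OF s.rep_ext_bound[OF f]]) (auto intro: sum_nonneg)
    qed
    then have "op_norm H (rep_ext (H, \<pi>) f) \<le> rep_norm R f"
      unfolding rep_norm_def using cSUP_upper[OF \<rho>, of "\<lambda>\<rho>. op_norm (fst \<rho>) (rep_ext \<rho> f)"] by simp
    then have "op_norm H (rep_ext (H, \<pi>) f) * hnorm H \<xi> \<le> rep_norm R f * hnorm H \<xi>"
      using semi.hnorm_nonneg[OF \<xi>] by (rule mult_right_mono)
    then show ?thesis using op_norm_bound[OF f \<xi>] by linarith
  qed
  have least: "rep_norm R f \<le> c"
    if c: "0 \<le> c" and b: "\<And>H \<pi> \<xi>. (H, \<pi>) \<in> R \<Longrightarrow> \<xi> \<in> carrier H \<Longrightarrow> hnorm H (rep_ext (H, \<pi>) f \<xi>) \<le> c * hnorm H \<xi>"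
    for f c
    unfolding rep_norm_def
  proof (rule cSUP_least)
    show "R \<noteq> {}" using reg by auto
    fix \<sigma> assume \<sigma>R: "\<sigma> \<in> R"
    obtain K \<tau> where \<sigma>: "\<sigma> = (K, \<tau>)" by (cases \<sigma>)
    interpret s: unitary_representation G K \<tau> by (rule repR) (use \<sigma>R \<sigma> in simp)
    show "op_norm (fst \<sigma>) (rep_ext \<sigma> f) \<le> c"
      using \<sigma>R b c unfolding \<sigma> fst_conv by (intro s.op_norm_le) auto
  qed
  have coeff: "cmod (f x) \<le> rep_norm R f" if f: "f \<in> supported G" for f x
  proof -
    obtain \<pi> where lr: "left_regular G = (l2_space (carrier G), \<pi>)"
      and \<pi>: "\<And>g \<xi>. \<pi> g \<xi> = (\<lambda>x. if x \<in> carrier G then \<xi> (inv\<^bsub>G\<^esub> g \<otimes>\<^bsub>G\<^esub> x) else 0)"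
      by (simp add: left_regular_def)
    let ?H = "l2_space (carrier G)"
    have \<rho>: "(?H, \<pi>) \<in> R" using reg lr by simp
    interpret unitary_representation G ?H \<pi> by (rule repR[OF \<rho>])
    have \<delta>1: "delta y \<in> carrier ?H" "hnorm ?H (delta y) = 1" if "y \<in> carrier G" for y
      using delta_l2[OF that] by (simp_all add: hnorm_def) (simp add: delta_def)
    have main: "cmod (f y) \<le> rep_norm R f" if y: "y \<in> carrier G" for y
    proof -
      let ?e = "rep_ext (?H, \<pi>) f (delta \<one>\<^bsub>G\<^esub>)"
      have F: "finite {x. f x \<noteq> 0}" "{x. f x \<noteq> 0} \<subseteq> carrier G" using f by (auto simp: supported_def)
      have e: "?e \<in> carrier ?H" using f \<delta>1 by (intro rep_ext_closed) auto
      \<comment> \<open>Left translation by \<open>g\<close> carries \<open>delta\<close> at the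
        identity to \<open>delta g\<close>.\<close>
      have tr: "ip ?H (\<pi> g (delta \<one>\<^bsub>G\<^esub>)) (delta y) = (if g = y then 1 else 0)" if g: "g \<in> carrier G" for g
      proof -
        have "inv\<^bsub>G\<^esub> g \<otimes>\<^bsub>G\<^esub> y = \<one>\<^bsub>G\<^esub> \<longleftrightarrow> y = g"
          using g y by (metis G.inv_closed G.inv_inv G.inv_solve_left G.l_inv G.one_closed G.r_one)
        then show ?thesis
          using delta_l2(2)[OF y rep_closed[OF g \<delta>1(1)[OF G.one_closed]]] y by (auto simp: \<pi> delta_def)
      qed
      have "ip ?H ?e (delta y) = (\<Sum>g | f g \<noteq> 0. f g * ip ?H (\<pi> g (delta \<one>\<^bsub>G\<^esub>)) (delta y))"
        using F \<delta>1 y by (intro ip_rep_ext[OF f]) auto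
      also have "\<dots> = (\<Sum>g | f g \<noteq> 0. if g = y then f g else 0)"
      proof (rule sum.cong[OF refl])
        fix g assume "g \<in> {g. f g \<noteq> 0}"
        then have "g \<in> carrier G" using F by auto
        from tr[OF this] show "f g * ip ?H (\<pi> g (delta \<one>\<^bsub>G\<^esub>)) (delta y) = (if g = y then f g else 0)"
          by (simp only: if_distrib[of "\<lambda>c. f g * c"] mult_1_right mult_zero_right)
      qed
      also have "\<dots> = f y" using F by simp
      finally have "cmod (f y) \<le> hnorm ?H ?e * hnorm ?H (delta y)"
        using semi.cauchy_schwarz[OF e \<delta>1(1)[OF y]] by simp
      also have "\<dots> \<le> rep_norm R f * hnorm ?H (delta \<one>\<^bsub>G\<^esub>)"
        using bound[OF \<rho> f \<delta>1(1)[OF G.one_closed]] \<delta>1(2)[OF y] by simp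
      finally show ?thesis using \<delta>1(2)[OF G.one_closed] by simp
    qed
    show ?thesis
    proof (cases "x \<in> carrier G")
      case False
      then have "f x = 0" using f by (auto simp: supported_def)
      then show ?thesis using order_trans[OF norm_ge_zero main[OF G.one_closed]] by simp
    qed (rule main)
  qed
  have nn: "0 \<le> rep_norm R f" if "f \<in> supported G" for f
    using coeff[OF that, of undefined] norm_ge_zero order_trans by blast
  show ?thesis
  proof
    show "cmod (f x) \<le> rep_norm R f" if "f \<in> supported G" for f x by (rule coeff[OF that])
  next
    fix f h assume f: "f \<in> supported G" and h: "h \<in> supported G"
    show "rep_norm R (\<lambda>x. f x + h x) \<le> rep_norm R f + rep_norm R h"
    proof (rule least)
      fix H \<pi> \<xi> assume \<rho>: "(H, \<pi>) \<in> R" and \<xi>: "\<xi> \<in> carrier H"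
      interpret unitary_representation G H \<pi> by (rule repR[OF \<rho>])
      show "hnorm H (rep_ext (H, \<pi>) (\<lambda>x. f x + h x) \<xi>) \<le> (rep_norm R f + rep_norm R h) * hnorm H \<xi>"
        unfolding rep_ext_add[OF f h \<xi>]
        using semi.hnorm_triangle[OF rep_ext_closed[OF f \<xi>] rep_ext_closed[OF h \<xi>]]
          bound[OF \<rho> f \<xi>] bound[OF \<rho> h \<xi>] by (simp add: distrib_right)
    qed (use nn f h in simp)
    show "rep_norm R (conv G f h) \<le> rep_norm R f * rep_norm R h"
    proof (rule least)
      fix H \<pi> \<xi> assume \<rho>: "(H, \<pi>) \<in> R" and \<xi>: "\<xi> \<in> carrier H"
      interpret unitary_representation G H \<pi> by (rule repR[OF \<rho>])
      have "hnorm H (rep_ext (H, \<pi>) f (rep_ext (H, \<pi>) h \<xi>)) \<le> rep_norm R f * hnorm H (rep_ext (H, \<pi>) h \<xi>)"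
        by (rule bound[OF \<rho> f rep_ext_closed[OF h \<xi>]])
      also have "\<dots> \<le> rep_norm R f * (rep_norm R h * hnorm H \<xi>)"
        by (rule mult_left_mono[OF bound[OF \<rho> h \<xi>] nn[OF f]])
      finally show "hnorm H (rep_ext (H, \<pi>) (conv G f h) \<xi>) \<le> rep_norm R f * rep_norm R h * hnorm H \<xi>"
        unfolding rep_ext_conv[OF f h \<xi>] by (simp add: mult.assoc)
    qed (use nn f h in simp)
  next
    fix f a assume f: "f \<in> supported G"
    show "rep_norm R (\<lambda>x. a * f x) \<le> cmod a * rep_norm R f"
    proof (rule least)
      fix H \<pi> \<xi> assume \<rho>: "(H, \<pi>) \<in> R" and \<xi>: "\<xi> \<in> carrier H"
      interpret unitary_representation G H \<pi> by (rule repR[OF \<rho>])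
      show "hnorm H (rep_ext (H, \<pi>) (\<lambda>x. a * f x) \<xi>) \<le> cmod a * rep_norm R f * hnorm H \<xi>"
        unfolding rep_ext_smult[OF f \<xi>] semi.hnorm_smult[OF rep_ext_closed[OF f \<xi>]]
        using mult_left_mono[OF bound[OF \<rho> f \<xi>], of "cmod a"] by (simp add: mult.assoc)
    qed (use nn f in simp)
    show "rep_norm R (star G f) \<le> rep_norm R f"
    proof (rule least)
      fix H \<pi> \<xi> assume \<rho>: "(H, \<pi>) \<in> R" and \<xi>: "\<xi> \<in> carrier H"
      interpret unitary_representation G H \<pi> by (rule repR[OF \<rho>])
      let ?e = "rep_ext (H, \<pi>) (star G f) \<xi>"
      have e: "?e \<in> carrier H" by (rule rep_ext_closed[OF supported_star[OF G f] \<xi>])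
      \<comment> \<open>\<open>\<parallel>T\<^sup>* \<xi>\<parallel>\<^sup>2 = \<langle>\<xi>, T
        T\<^sup>* \<xi>\<rangle> \<le> \<parallel>\<xi>\<parallel> \<parallel>T\<parallel>
        \<parallel>T\<^sup>* \<xi>\<parallel>\<close>, after which one factor is cancelled.\<close>
      have "(hnorm H ?e)\<^sup>2 = cmod (ip H ?e ?e)"
        using semi.ip_self[OF e] by (simp add: norm_power)
      also have "\<dots> = cmod (ip H \<xi> (rep_ext (H, \<pi>) f ?e))" by (simp add: rep_ext_star[OF f \<xi> e])
      also have "\<dots> \<le> hnorm H \<xi> * hnorm H (rep_ext (H, \<pi>) f ?e)"
        by (rule semi.cauchy_schwarz[OF \<xi> rep_ext_closed[OF f e]])
      also have "\<dots> \<le> hnorm H \<xi> * (rep_norm R f * hnorm H ?e)"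
        by (rule mult_left_mono[OF bound[OF \<rho> f e] semi.hnorm_nonneg[OF \<xi>]])
      finally have sq: "hnorm H ?e * hnorm H ?e \<le> (rep_norm R f * hnorm H \<xi>) * hnorm H ?e"
        by (simp add: power2_eq_square mult_ac)
      show "hnorm H ?e \<le> rep_norm R f * hnorm H \<xi>"
      proof (cases "hnorm H ?e = 0")
        case True
        then show ?thesis using nn[OF f] semi.hnorm_nonneg[OF \<xi>] by simp
      next
        case False
        then have "hnorm H ?e > 0" using semi.hnorm_nonneg[OF e] by linarith
        with sq show ?thesis by (rule mult_right_le_imp_le)
      qed
    qed (use nn f in simp)
  qed
qed

lemma group_algebra_norm_full:
  assumes "group G"
  shows "group_algebra_norm G (full_norm G)"
proof -
  have "full_norm G = rep_norm {\<rho> :: ('a, 'a \<Rightarrow> complex) rep. unitary_rep G \<rho>}" by (simp add: full_norm_def rep_norm_def fun_eq_iff)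
  then show ?thesis
    using group_algebra_norm_rep_norm[OF assms, of "{\<rho>. unitary_rep G \<rho>}"] unitary_rep_left_regular[OF assms]
    by simp
qed

lemma group_algebra_norm_reduced:
  assumes "group G"
  shows "group_algebra_norm G (reduced_norm G)"
proof -
  have "reduced_norm G = rep_norm {left_regular G}"
    by (simp add: reduced_norm_def rep_norm_def left_regular_def fun_eq_iff)
  then show ?thesis
    using group_algebra_norm_rep_norm[OF assms, of "{left_regular G}"] unitary_rep_left_regular[OF assms]
    by simp
qed

section \<open>Coefficients of elements of a completed group algebra\<close>

lemma conv_superset:
  assumes "finite F" "{x. f x \<noteq> 0} \<subseteq> F"
  shows "conv G f h x = (if x \<in> carrier G then \<Sum>y\<in>F. f y * h (inv\<^bsub>G\<^esub> y \<otimes>\<^bsub>G\<^esub> x) else 0)"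
proof -
  have "(\<Sum>y | f y \<noteq> 0. f y * h (inv\<^bsub>G\<^esub> y \<otimes>\<^bsub>G\<^esub> x)) = (\<Sum>y\<in>F. f y * h (inv\<^bsub>G\<^esub> y \<otimes>\<^bsub>G\<^esub> x))"
    using assms by (intro sum.mono_neutral_left) auto
  then show ?thesis by (simp add: conv_def)
qed

lemma conv_diff_left:
  assumes "f \<in> supported G" "f' \<in> supported G"
  shows "conv G (\<lambda>x. f x - f' x) h = (\<lambda>x. conv G f h x - conv G f' h x)"
proof
  fix x
  let ?F = "{x. f x \<noteq> 0} \<union> {x. f' x \<noteq> 0}"
  have F: "finite ?F" using assms by (simp add: supported_def)
  have "conv G (\<lambda>x. f x - f' x) h x = (if x \<in> carrier G then \<Sum>y\<in>?F. (f y - f' y) * h (inv\<^bsub>G\<^esub> y \<otimes>\<^bsub>G\<^esub> x) else 0)"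
    by (rule conv_superset[OF F]) auto
  moreover have "conv G f h x = (if x \<in> carrier G then \<Sum>y\<in>?F. f y * h (inv\<^bsub>G\<^esub> y \<otimes>\<^bsub>G\<^esub> x) else 0)"
    by (rule conv_superset[OF F]) auto
  moreover have "conv G f' h x = (if x \<in> carrier G then \<Sum>y\<in>?F. f' y * h (inv\<^bsub>G\<^esub> y \<otimes>\<^bsub>G\<^esub> x) else 0)"
    by (rule conv_superset[OF F]) auto
  ultimately show "conv G (\<lambda>x. f x - f' x) h x = conv G f h x - conv G f' h x"
    by (simp add: left_diff_distrib sum_subtractf)
qed

lemma conv_diff_right: "conv G f (\<lambda>x. h x - h' x) = (\<lambda>x. conv G f h x - conv G f h' x)"
  by (auto simp: conv_def right_diff_distrib sum_subtractf)

lemma star_diff: "star G (\<lambda>x. f x - f' x) = (\<lambda>x. star G f x - star G f' x)"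
  by (auto simp: star_def)

text \<open>Summing over inverses turns the convolution into a correlation of \<open>f\<close> and
  \<open>h\<close>, the form in which positivity becomes visible.\<close>

lemma conv_star:
  assumes G: "group G" and f: "f \<in> supported G" and g: "g \<in> carrier G"
  shows "conv G (star G f) h g = (\<Sum>x | f x \<noteq> 0. cnj (f x) * h (x \<otimes>\<^bsub>G\<^esub> g))"
proof -
  interpret G: group G by fact
  have S: "{x. f x \<noteq> 0} \<subseteq> carrier G" using f by (auto simp: supported_def)
  have inj: "inj_on (\<lambda>x. inv\<^bsub>G\<^esub> x) {x. f x \<noteq> 0}"
    using S by (intro inj_on_inverseI[of _ "\<lambda>x. inv\<^bsub>G\<^esub> x"]) auto
  have "conv G (star G f) h g = (\<Sum>y\<in>(\<lambda>x. inv\<^bsub>G\<^esub> x) ` {x. f x \<noteq> 0}. star G f y * h (inv\<^bsub>G\<^esub> y \<otimes>\<^bsub>G\<^esub> g))"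
    using g by (simp add: conv_def support_star[OF G f])
  also have "\<dots> = (\<Sum>x | f x \<noteq> 0. cnj (f x) * h (x \<otimes>\<^bsub>G\<^esub> g))"
    unfolding sum.reindex[OF inj] comp_def
    using S by (intro sum.cong refl) (auto simp: star_def subset_iff)
  finally show ?thesis .
qed

lemma conv_star_delta:
  assumes G: "group G" and "x \<in> carrier G" "y \<in> carrier G"
  shows "conv G (star G (delta x)) (delta y) = delta (inv\<^bsub>G\<^esub> x \<otimes>\<^bsub>G\<^esub> y)"
proof
  interpret G: group G by fact
  fix g
  have s: "{z. delta x z \<noteq> 0} = {x}" by (auto simp: delta_def)
  show "conv G (star G (delta x)) (delta y) g = delta (inv\<^bsub>G\<^esub> x \<otimes>\<^bsub>G\<^esub> y) g"
  proof (cases "g \<in> carrier G")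
    case True
    have "x \<otimes>\<^bsub>G\<^esub> g = y \<longleftrightarrow> g = inv\<^bsub>G\<^esub> x \<otimes>\<^bsub>G\<^esub> y"
      using assms True by (metis G.inv_solve_left)
    then show ?thesis
      using conv_star[OF G supported_delta[OF assms(2)] True, of "delta y"]
      by (simp add: s) (simp add: delta_def)
  next
    case False
    then show ?thesis using assms by (auto simp: conv_def delta_def)
  qed
qed

text \<open>The substitution \<open>x = z h\<^sub>i\<close> exhibits the double sum as a sum of squares.\<close>

lemma conv_star_positive:
  fixes n :: nat
  assumes G: "group G" and y: "\<And>i. i < n \<Longrightarrow> y i \<in> supported G" and h: "\<And>i. i < n \<Longrightarrow> h i \<in> carrier G"
  shows "0 \<le> Re (\<Sum>i<n. \<Sum>j<n. cnj (c i) * c j * conv G (star G (y i)) (y j) (inv\<^bsub>G\<^esub> (h i) \<otimes>\<^bsub>G\<^esub> h j))"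
proof -
  interpret G: group G by fact
  \<comment> \<open>All \<open>z\<close> for which some \<open>y i (z h\<^sub>i)\<close> is nonzero:
    one finite range of summation for every pair \<open>i\<close>, \<open>j\<close>.\<close>
  define F where "F = (\<Union>i<n. (\<lambda>x. x \<otimes>\<^bsub>G\<^esub> inv\<^bsub>G\<^esub> (h i)) ` {x. y i x \<noteq> 0})"
  have S: "{x. y i x \<noteq> 0} \<subseteq> carrier G" "finite {x. y i x \<noteq> 0}" if "i < n" for i
    using y[OF that] by (auto simp: supported_def)
  have F: "finite F" "F \<subseteq> carrier G"
  proof -
    show "finite F" unfolding F_def using S(2) by (intro finite_UN_I finite_lessThan finite_imageI) auto
    show "F \<subseteq> carrier G"
    proof
      fix z assume "z \<in> F"
      then obtain i x where i: "i < n" and x: "y i x \<noteq> 0" and z: "z = x \<otimes>\<^bsub>G\<^esub> inv\<^bsub>G\<^esub> (h i)"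
        by (auto simp: F_def)
      have "x \<in> carrier G" using S(1)[OF i] x by auto
      then show "z \<in> carrier G" using h[OF i] z by simp
    qed
  qed
  have eq: "conv G (star G (y i)) (y j) (inv\<^bsub>G\<^esub> (h i) \<otimes>\<^bsub>G\<^esub> h j) =
      (\<Sum>z\<in>F. cnj (y i (z \<otimes>\<^bsub>G\<^esub> h i)) * y j (z \<otimes>\<^bsub>G\<^esub> h j))" if i: "i < n" and j: "j < n" for i j
  proof -
    have c: "(x \<otimes>\<^bsub>G\<^esub> inv\<^bsub>G\<^esub> (h i)) \<otimes>\<^bsub>G\<^esub> h i = x" "(x \<otimes>\<^bsub>G\<^esub> h i) \<otimes>\<^bsub>G\<^esub> inv\<^bsub>G\<^esub> (h i) = x" if "x \<in> carrier G" for x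
      using that h[OF i] by (simp_all add: G.m_assoc)
    have inj: "inj_on (\<lambda>x. x \<otimes>\<^bsub>G\<^esub> inv\<^bsub>G\<^esub> (h i)) {x. y i x \<noteq> 0}"
      using c S[OF i] by (intro inj_on_inverseI[of _ "\<lambda>x. x \<otimes>\<^bsub>G\<^esub> h i"]) auto
    have "conv G (star G (y i)) (y j) (inv\<^bsub>G\<^esub> (h i) \<otimes>\<^bsub>G\<^esub> h j) =
        (\<Sum>x | y i x \<noteq> 0. cnj (y i x) * y j (x \<otimes>\<^bsub>G\<^esub> (inv\<^bsub>G\<^esub> (h i) \<otimes>\<^bsub>G\<^esub> h j)))"
      using h i j by (intro conv_star[OF G y[OF i]]) simp
    also have "\<dots> = (\<Sum>z\<in>(\<lambda>x. x \<otimes>\<^bsub>G\<^esub> inv\<^bsub>G\<^esub> (h i)) ` {x. y i x \<noteq> 0}.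
        cnj (y i (z \<otimes>\<^bsub>G\<^esub> h i)) * y j (z \<otimes>\<^bsub>G\<^esub> h j))"
      unfolding sum.reindex[OF inj] comp_def
    proof (rule sum.cong[OF refl])
      fix x assume "x \<in> {x. y i x \<noteq> 0}"
      then have x: "x \<in> carrier G" using S[OF i] by auto
      show "cnj (y i x) * y j (x \<otimes>\<^bsub>G\<^esub> (inv\<^bsub>G\<^esub> (h i) \<otimes>\<^bsub>G\<^esub> h j)) =
        cnj (y i (x \<otimes>\<^bsub>G\<^esub> inv\<^bsub>G\<^esub> (h i) \<otimes>\<^bsub>G\<^esub> h i)) * y j (x \<otimes>\<^bsub>G\<^esub> inv\<^bsub>G\<^esub> (h i) \<otimes>\<^bsub>G\<^esub> h j)"
        unfolding c(1)[OF x] using x h[OF i] h[OF j] by (simp add: G.m_assoc)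
    qed
    also have "\<dots> = (\<Sum>z\<in>F. cnj (y i (z \<otimes>\<^bsub>G\<^esub> h i)) * y j (z \<otimes>\<^bsub>G\<^esub> h j))"
    proof (rule sum.mono_neutral_left[OF F(1)])
      show "(\<lambda>x. x \<otimes>\<^bsub>G\<^esub> inv\<^bsub>G\<^esub> (h i)) ` {x. y i x \<noteq> 0} \<subseteq> F" using i by (auto simp: F_def)
      show "\<forall>z\<in>F - (\<lambda>x. x \<otimes>\<^bsub>G\<^esub> inv\<^bsub>G\<^esub> (h i)) ` {x. y i x \<noteq> 0}.
          cnj (y i (z \<otimes>\<^bsub>G\<^esub> h i)) * y j (z \<otimes>\<^bsub>G\<^esub> h j) = 0"
      proof
        fix z assume z: "z \<in> F - (\<lambda>x. x \<otimes>\<^bsub>G\<^esub> inv\<^bsub>G\<^esub> (h i)) ` {x. y i x \<noteq> 0}"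
        then have "z = (z \<otimes>\<^bsub>G\<^esub> h i) \<otimes>\<^bsub>G\<^esub> inv\<^bsub>G\<^esub> (h i)" using c(2) F(2) by auto
        then have "z \<otimes>\<^bsub>G\<^esub> h i \<notin> {x. y i x \<noteq> 0}" using z by blast
        then show "cnj (y i (z \<otimes>\<^bsub>G\<^esub> h i)) * y j (z \<otimes>\<^bsub>G\<^esub> h j) = 0" by simp
      qed
    qed
    finally show ?thesis .
  qed
  have "(\<Sum>i<n. \<Sum>j<n. cnj (c i) * c j * conv G (star G (y i)) (y j) (inv\<^bsub>G\<^esub> (h i) \<otimes>\<^bsub>G\<^esub> h j)) =
      (\<Sum>i<n. \<Sum>j<n. \<Sum>z\<in>F. cnj (c i * y i (z \<otimes>\<^bsub>G\<^esub> h i)) * (c j * y j (z \<otimes>\<^bsub>G\<^esub> h j)))"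
    by (intro sum.cong refl) (simp add: eq sum_distrib_left mult_ac)
  also have "\<dots> = (\<Sum>i<n. \<Sum>z\<in>F. \<Sum>j<n. cnj (c i * y i (z \<otimes>\<^bsub>G\<^esub> h i)) * (c j * y j (z \<otimes>\<^bsub>G\<^esub> h j)))"
    by (intro sum.cong refl) (rule sum.swap)
  also have "\<dots> = (\<Sum>z\<in>F. \<Sum>i<n. \<Sum>j<n. cnj (c i * y i (z \<otimes>\<^bsub>G\<^esub> h i)) * (c j * y j (z \<otimes>\<^bsub>G\<^esub> h j)))"
    by (rule sum.swap)
  also have "\<dots> = (\<Sum>z\<in>F. cnj (\<Sum>i<n. c i * y i (z \<otimes>\<^bsub>G\<^esub> h i)) * (\<Sum>j<n. c j * y j (z \<otimes>\<^bsub>G\<^esub> h j)))"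
    by (intro sum.cong refl) (simp only: cnj_sum sum_product)
  also have "\<dots> = (\<Sum>z\<in>F. of_real ((cmod (\<Sum>i<n. c i * y i (z \<otimes>\<^bsub>G\<^esub> h i)))\<^sup>2))"
  proof (rule sum.cong[OF refl])
    fix z
    have "cnj w * w = of_real ((cmod w)\<^sup>2)" for w :: complex
      using complex_norm_square[of w] by (simp add: mult.commute)
    then show "cnj (\<Sum>i<n. c i * y i (z \<otimes>\<^bsub>G\<^esub> h i)) * (\<Sum>j<n. c j * y j (z \<otimes>\<^bsub>G\<^esub> h j)) =
        of_real ((cmod (\<Sum>i<n. c i * y i (z \<otimes>\<^bsub>G\<^esub> h i)))\<^sup>2)" .
  qed
  finally show ?thesis by (simp add: sum_nonneg)
qed

text \<open>Both sides are one sum up to the shift \<open>x \<mapsto> x g\<close>. \<open>?U\<close>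
  collects the points where both factors are nonzero, so its translate carries every nonzero term of
  the other sum.\<close>

lemma conv_star_hermitian:
  assumes G: "group G" and f: "f \<in> supported G" and h: "h \<in> supported G" and g: "g \<in> carrier G"
  shows "conv G (star G h) f (inv\<^bsub>G\<^esub> g) = cnj (conv G (star G f) h g)"
proof -
  interpret G: group G by fact
  have S: "{x. f x \<noteq> 0} \<subseteq> carrier G" "finite {x. f x \<noteq> 0}" and T: "{x. h x \<noteq> 0} \<subseteq> carrier G" "finite {x. h x \<noteq> 0}"
    using f h by (auto simp: supported_def)
  let ?U = "{x. f x \<noteq> 0 \<and> h (x \<otimes>\<^bsub>G\<^esub> g) \<noteq> 0}"
  have U: "finite ?U" "?U \<subseteq> carrier G" using S by (auto intro: finite_subset)
  have inj: "inj_on (\<lambda>x. x \<otimes>\<^bsub>G\<^esub> g) ?U"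
    using U g by (auto simp: inj_on_def subset_iff)
  have c: "(x \<otimes>\<^bsub>G\<^esub> g) \<otimes>\<^bsub>G\<^esub> inv\<^bsub>G\<^esub> g = x" "(x \<otimes>\<^bsub>G\<^esub> inv\<^bsub>G\<^esub> g) \<otimes>\<^bsub>G\<^esub> g = x" if "x \<in> carrier G" for x
    using that g by (simp_all add: G.m_assoc)
  have "conv G (star G f) h g = (\<Sum>x\<in>?U. cnj (f x) * h (x \<otimes>\<^bsub>G\<^esub> g))"
    unfolding conv_star[OF G f g] using S by (intro sum.mono_neutral_right) auto
  then have 1: "cnj (conv G (star G f) h g) = (\<Sum>x\<in>?U. cnj (h (x \<otimes>\<^bsub>G\<^esub> g)) * f x)"
    by (simp add: mult.commute)
  have "conv G (star G h) f (inv\<^bsub>G\<^esub> g) = (\<Sum>x | h x \<noteq> 0. cnj (h x) * f (x \<otimes>\<^bsub>G\<^esub> inv\<^bsub>G\<^esub> g))"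
    using g by (intro conv_star[OF G h]) simp
  also have "\<dots> = (\<Sum>x\<in>(\<lambda>x. x \<otimes>\<^bsub>G\<^esub> g) ` ?U. cnj (h x) * f (x \<otimes>\<^bsub>G\<^esub> inv\<^bsub>G\<^esub> g))"
  proof (rule sum.mono_neutral_right[OF T(2)])
    show "(\<lambda>x. x \<otimes>\<^bsub>G\<^esub> g) ` ?U \<subseteq> {x. h x \<noteq> 0}" by auto
    show "\<forall>x\<in>{x. h x \<noteq> 0} - (\<lambda>x. x \<otimes>\<^bsub>G\<^esub> g) ` ?U. cnj (h x) * f (x \<otimes>\<^bsub>G\<^esub> inv\<^bsub>G\<^esub> g) = 0"
    proof
      fix x assume x: "x \<in> {x. h x \<noteq> 0} - (\<lambda>x. x \<otimes>\<^bsub>G\<^esub> g) ` ?U"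
      then have xc: "x = (x \<otimes>\<^bsub>G\<^esub> inv\<^bsub>G\<^esub> g) \<otimes>\<^bsub>G\<^esub> g" using c(2) T(1) by auto
      then have "x \<otimes>\<^bsub>G\<^esub> inv\<^bsub>G\<^esub> g \<notin> ?U" using x by blast
      then show "cnj (h x) * f (x \<otimes>\<^bsub>G\<^esub> inv\<^bsub>G\<^esub> g) = 0" using x xc by auto
    qed
  qed
  also have "\<dots> = (\<Sum>x\<in>?U. cnj (h (x \<otimes>\<^bsub>G\<^esub> g)) * f x)"
    unfolding sum.reindex[OF inj] comp_def using U(2) by (intro sum.cong refl) (auto simp: c subset_iff)
  finally show ?thesis using 1 by simp
qed

text \<open>The value at the identity is the sum of the squares
  \<open>\<bar>f x\<bar>\<^sup>2\<close>. Apply \<open>2 a b \<le> a\<^sup>2 + b\<^sup>2\<close> to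
  each product; shifting \<open>f\<close> by \<open>g\<close> does not increase the sum of squares
  over its support.\<close>

lemma conv_star_bound:
  assumes G: "group G" and f: "f \<in> supported G" and g: "g \<in> carrier G"
  shows "cmod (conv G (star G f) f g) \<le> Re (conv G (star G f) f \<one>\<^bsub>G\<^esub>)"
proof -
  interpret G: group G by fact
  let ?S = "{x. f x \<noteq> 0}"
  have S: "?S \<subseteq> carrier G" "finite ?S" using f by (auto simp: supported_def)
  have "conv G (star G f) f \<one>\<^bsub>G\<^esub> = (\<Sum>x\<in>?S. of_real ((cmod (f x))\<^sup>2))"
    unfolding conv_star[OF G f G.one_closed]
  proof (rule sum.cong[OF refl])
    fix x assume "x \<in> ?S"
    then have "x \<in> carrier G" using S by auto
    then show "cnj (f x) * f (x \<otimes>\<^bsub>G\<^esub> \<one>\<^bsub>G\<^esub>) = of_real ((cmod (f x))\<^sup>2)"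
      using complex_norm_square[of "f x"] by (simp add: mult.commute)
  qed
  then have one: "Re (conv G (star G f) f \<one>\<^bsub>G\<^esub>) = (\<Sum>x\<in>?S. (cmod (f x))\<^sup>2)" by simp
  let ?U = "{x \<in> ?S. f (x \<otimes>\<^bsub>G\<^esub> g) \<noteq> 0}"
  have inj: "inj_on (\<lambda>x. x \<otimes>\<^bsub>G\<^esub> g) ?U" using S g by (auto simp: inj_on_def subset_iff)
  have "(\<Sum>x\<in>?S. (cmod (f (x \<otimes>\<^bsub>G\<^esub> g)))\<^sup>2) = (\<Sum>x\<in>?U. (cmod (f (x \<otimes>\<^bsub>G\<^esub> g)))\<^sup>2)"
    using S by (intro sum.mono_neutral_right) auto
  also have "\<dots> = (\<Sum>x\<in>(\<lambda>x. x \<otimes>\<^bsub>G\<^esub> g) ` ?U. (cmod (f x))\<^sup>2)"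
    unfolding sum.reindex[OF inj] comp_def ..
  also have "\<dots> \<le> (\<Sum>x\<in>?S. (cmod (f x))\<^sup>2)"
    using S by (intro sum_mono2) auto
  finally have shift: "(\<Sum>x\<in>?S. (cmod (f (x \<otimes>\<^bsub>G\<^esub> g)))\<^sup>2) \<le> (\<Sum>x\<in>?S. (cmod (f x))\<^sup>2)" .
  have "cmod (conv G (star G f) f g) \<le> (\<Sum>x\<in>?S. cmod (cnj (f x) * f (x \<otimes>\<^bsub>G\<^esub> g)))"
    unfolding conv_star[OF G f g] by (rule norm_sum)
  also have "\<dots> \<le> (\<Sum>x\<in>?S. ((cmod (f x))\<^sup>2 + (cmod (f (x \<otimes>\<^bsub>G\<^esub> g)))\<^sup>2) / 2)"
  proof (rule sum_mono)
    fix x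
    show "cmod (cnj (f x) * f (x \<otimes>\<^bsub>G\<^esub> g)) \<le> ((cmod (f x))\<^sup>2 + (cmod (f (x \<otimes>\<^bsub>G\<^esub> g)))\<^sup>2) / 2"
      using sum_squares_bound[of "cmod (f x)" "cmod (f (x \<otimes>\<^bsub>G\<^esub> g))"] by (simp add: norm_mult)
  qed
  also have "\<dots> = ((\<Sum>x\<in>?S. (cmod (f x))\<^sup>2) + (\<Sum>x\<in>?S. (cmod (f (x \<otimes>\<^bsub>G\<^esub> g)))\<^sup>2)) / 2"
    by (simp add: sum.distrib sum_divide_distrib[symmetric])
  also have "\<dots> \<le> ((\<Sum>x\<in>?S. (cmod (f x))\<^sup>2) + (\<Sum>x\<in>?S. (cmod (f x))\<^sup>2)) / 2"
    using shift by (intro divide_right_mono add_left_mono) simp_all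
  finally show ?thesis unfolding one by simp
qed

section \<open>The completed group algebra by Cauchy sequences\<close>

context group_algebra_norm
begin

abbreviation P :: "('g \<Rightarrow> complex) normed_star_algebra" where
  "P \<equiv> group_algebra G N"

abbreviation B :: "(nat \<Rightarrow> 'g \<Rightarrow> complex) set normed_star_algebra" where
  "B \<equiv> completion P"

lemma norm_nonneg: "f \<in> supported G \<Longrightarrow> 0 \<le> N f"
  using norm_coeff[of f undefined] norm_ge_zero order_trans by blast

lemma norm_zero: "N (\<lambda>x. 0) = 0"
  using norm_smult[OF supported_zero, of 0] norm_nonneg[OF supported_zero] by simp

lemma norm_eq_0: "f \<in> supported G \<Longrightarrow> N f = 0 \<longleftrightarrow> f = (\<lambda>x. 0)"
  using norm_coeff[of f] norm_zero by (metis ext norm_le_zero_iff)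

lemma norm_minus_commute: 
  assumes "f \<in> supported G" "h \<in> supported G"
  shows "N (\<lambda>x. f x - h x) = N (\<lambda>x. h x - f x)"
  using norm_smult[OF supported_diff[OF assms], of "-1"] norm_smult[OF supported_diff[OF assms(2,1)], of "-1"]
  by simp

lemma norm_diff_triangle:
  assumes "f \<in> supported G" "h \<in> supported G" "k \<in> supported G"
  shows "N (\<lambda>x. f x - k x) \<le> N (\<lambda>x. f x - h x) + N (\<lambda>x. h x - k x)"
  using norm_add[OF supported_diff[OF assms(1,2)] supported_diff[OF assms(2,3)]] by simp

lemma adist_P: "\<lbrakk>f \<in> supported G; h \<in> supported G\<rbrakk> \<Longrightarrow> adist P f h = N (\<lambda>x. f x - h x)"
  by (simp add: adist_def group_algebra_minus)

lemma metric_P: "Metric_space (supported G) (adist P)"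
proof
  fix f h k
  show "0 \<le> adist P f h"
    by (auto simp: adist_def group_algebra_minus supported_diff norm_nonneg)
  show "adist P f h = adist P h f"
    using norm_minus_commute by (auto simp: adist_def group_algebra_minus)
  assume f: "f \<in> supported G" and h: "h \<in> supported G"
  show "adist P f h = 0 \<longleftrightarrow> f = h"
    using f h by (simp add: adist_P norm_eq_0 supported_diff fun_eq_iff)
  assume "k \<in> supported G"
  then show "adist P f k \<le> adist P f h + adist P h k"
    using f h norm_diff_triangle by (simp add: adist_P)
qed

abbreviation C :: "(nat \<Rightarrow> 'g \<Rightarrow> complex) set" where
  "C \<equiv> cauchy_seqs P"

lemma C_iff: "\<sigma> \<in> C \<longleftrightarrow> (\<forall>n. \<sigma> n \<in> supported G) \<and>
    (\<forall>e>0. \<exists>K. \<forall>m\<ge>K. \<forall>n\<ge>K. N (\<lambda>x. \<sigma> m x - \<sigma> n x) < e)"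
proof -
  have "\<sigma> \<in> C \<longleftrightarrow> range \<sigma> \<subseteq> supported G \<and>
      (\<forall>e>0. \<exists>K. \<forall>m n. K \<le> m \<longrightarrow> K \<le> n \<longrightarrow> adist P (\<sigma> m) (\<sigma> n) < e)"
    unfolding cauchy_seqs_def by (simp add: Metric_space.MCauchy_def[OF metric_P])
  also have "\<dots> \<longleftrightarrow> (\<forall>n. \<sigma> n \<in> supported G) \<and>
      (\<forall>e>0. \<exists>K. \<forall>m\<ge>K. \<forall>n\<ge>K. N (\<lambda>x. \<sigma> m x - \<sigma> n x) < e)"
  proof (cases "\<forall>n. \<sigma> n \<in> supported G")
    case True
    then have "range \<sigma> \<subseteq> supported G" by auto
    then show ?thesis using True by (simp add: adist_P)
  qed auto
  finally show ?thesis .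
qed

lemma C_supported: "\<sigma> \<in> C \<Longrightarrow> \<sigma> n \<in> supported G"
  by (simp add: C_iff)

lemma CD: "\<lbrakk>\<sigma> \<in> C; e > 0\<rbrakk> \<Longrightarrow> \<exists>K. \<forall>m\<ge>K. \<forall>n\<ge>K. N (\<lambda>x. \<sigma> m x - \<sigma> n x) < e"
  by (simp add: C_iff)

lemma C_const: "f \<in> supported G \<Longrightarrow> (\<lambda>n. f) \<in> C"
  by (simp add: C_iff norm_zero)

text \<open>One criterion for all operations: \<open>M\<close> and \<open>L\<close> are Lipschitz
  constants in the two arguments; for the product they are bounds of the two sequences.\<close>

lemma C_I:
  assumes \<rho>: "\<And>n. \<rho> n \<in> supported G" and \<sigma>: "\<sigma> \<in> C" and \<tau>: "\<tau> \<in> C" and M: "0 \<le> M" "0 \<le> L"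
    and b: "\<And>m n. N (\<lambda>x. \<rho> m x - \<rho> n x) \<le> M * N (\<lambda>x. \<sigma> m x - \<sigma> n x) + L * N (\<lambda>x. \<tau> m x - \<tau> n x)"
  shows "\<rho> \<in> C"
  unfolding C_iff
proof (intro conjI allI impI \<rho>)
  fix e :: real assume e: "e > 0"
  \<comment> \<open>The summand 1 keeps the denominator positive when both constants are 0.\<close>
  define d where "d = e / (M + L + 1)"
  have d: "d > 0" using e M by (simp add: d_def)
  obtain K1 where K1: "\<And>m n. m \<ge> K1 \<Longrightarrow> n \<ge> K1 \<Longrightarrow> N (\<lambda>x. \<sigma> m x - \<sigma> n x) < d"
    using CD[OF \<sigma> d] by blast
  obtain K2 where K2: "\<And>m n. m \<ge> K2 \<Longrightarrow> n \<ge> K2 \<Longrightarrow> N (\<lambda>x. \<tau> m x - \<tau> n x) < d"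
    using CD[OF \<tau> d] by blast
  have "N (\<lambda>x. \<rho> m x - \<rho> n x) < e" if "m \<ge> max K1 K2" "n \<ge> max K1 K2" for m n
  proof -
    have "M * N (\<lambda>x. \<sigma> m x - \<sigma> n x) \<le> M * d" "L * N (\<lambda>x. \<tau> m x - \<tau> n x) \<le> L * d"
      using K1[of m n] K2[of m n] that M by (simp_all add: mult_left_mono)
    then have "N (\<lambda>x. \<rho> m x - \<rho> n x) \<le> (M + L) * d" using b[of m n] by (simp add: distrib_right)
    also have "\<dots> < (M + L + 1) * d" using d by simp
    also have "\<dots> = e" using M by (simp add: d_def)
    finally show ?thesis .
  qed
  then show "\<exists>K. \<forall>m\<ge>K. \<forall>n\<ge>K. N (\<lambda>x. \<rho> m x - \<rho> n x) < e" by blast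
qed

lemma C_bounded:
  assumes \<sigma>: "\<sigma> \<in> C"
  obtains M where "0 \<le> M" "\<And>n. N (\<sigma> n) \<le> M"
proof -
  have s: "\<sigma> n \<in> supported G" for n using \<sigma> by (rule C_supported)
  obtain K where K: "\<And>m n. m \<ge> K \<Longrightarrow> n \<ge> K \<Longrightarrow> N (\<lambda>x. \<sigma> m x - \<sigma> n x) < 1"
    using CD[OF \<sigma>, of 1] by auto
  define M where "M = (\<Sum>i\<le>K. N (\<sigma> i)) + 1"
  have pos: "0 \<le> N (\<sigma> i)" for i using norm_nonneg s by blast
  have le: "N (\<sigma> i) \<le> (\<Sum>i\<le>K. N (\<sigma> i))" if "i \<le> K" for i
    using that pos by (intro member_le_sum) auto
  have "N (\<sigma> n) \<le> M" for n
  proof (cases "n \<le> K")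
    case True then show ?thesis using le[of n] by (simp add: M_def)
  next
    case False
    then have "N (\<lambda>x. \<sigma> n x - \<sigma> K x) < 1" using K by auto
    moreover have "N (\<sigma> n) \<le> N (\<lambda>x. \<sigma> n x - \<sigma> K x) + N (\<sigma> K)"
      using norm_add[of "\<lambda>x. \<sigma> n x - \<sigma> K x" "\<sigma> K"] s by (simp add: supported_diff)
    ultimately show ?thesis using le[of K] by (simp add: M_def)
  qed
  moreover have "0 \<le> M" unfolding M_def using pos by (simp add: sum_nonneg)
  ultimately show thesis using that by blast
qed

lemma supp_conv: "\<lbrakk>f \<in> supported G; h \<in> supported G\<rbrakk> \<Longrightarrow> conv G f h \<in> supported G"
  by (rule supported_conv[OF G.group_axioms])

lemma supp_star: "f \<in> supported G \<Longrightarrow> star G f \<in> supported G"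
  by (rule supported_star[OF G.group_axioms])

lemma norm_conv_diff:
  assumes "f \<in> supported G" "f' \<in> supported G" "h \<in> supported G" "h' \<in> supported G"
  shows "N (\<lambda>x. conv G f h x - conv G f' h' x) \<le>
    N (\<lambda>x. f x - f' x) * N h + N f' * N (\<lambda>x. h x - h' x)"
proof -
  have eq: "(\<lambda>x. conv G f h x - conv G f' h' x) =
      (\<lambda>x. conv G (\<lambda>x. f x - f' x) h x + conv G f' (\<lambda>x. h x - h' x) x)"
    using assms by (simp add: conv_diff_left conv_diff_right)
  have "N (\<lambda>x. conv G f h x - conv G f' h' x) \<le>
      N (conv G (\<lambda>x. f x - f' x) h) + N (conv G f' (\<lambda>x. h x - h' x))"
    unfolding eq using assms by (intro norm_add supp_conv supported_diff)
  also have "\<dots> \<le> N (\<lambda>x. f x - f' x) * N h + N f' * N (\<lambda>x. h x - h' x)"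
    using assms by (intro add_mono norm_conv supported_diff)
  finally show ?thesis .
qed

lemma norm_star_diff:
  "\<lbrakk>f \<in> supported G; f' \<in> supported G\<rbrakk> \<Longrightarrow> N (\<lambda>x. star G f x - star G f' x) \<le> N (\<lambda>x. f x - f' x)"
  using norm_star[of "\<lambda>x. f x - f' x"] by (simp add: star_diff supported_diff)

lemma C_add: "\<lbrakk>\<sigma> \<in> C; \<tau> \<in> C\<rbrakk> \<Longrightarrow> (\<lambda>n x. \<sigma> n x + \<tau> n x) \<in> C"
proof (rule C_I[where M = 1 and L = 1])
  assume s: "\<sigma> \<in> C" "\<tau> \<in> C"
  then have s': "\<sigma> n \<in> supported G" "\<tau> n \<in> supported G" for n by (simp_all add: C_supported)
  show "(\<lambda>x. \<sigma> n x + \<tau> n x) \<in> supported G" for n using s' by (intro supported_add)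
  fix m n
  have eq: "(\<lambda>x. \<sigma> m x + \<tau> m x - (\<sigma> n x + \<tau> n x)) = (\<lambda>x. (\<sigma> m x - \<sigma> n x) + (\<tau> m x - \<tau> n x))"
    by (simp add: algebra_simps)
  show "N (\<lambda>x. \<sigma> m x + \<tau> m x - (\<sigma> n x + \<tau> n x)) \<le>
      1 * N (\<lambda>x. \<sigma> m x - \<sigma> n x) + 1 * N (\<lambda>x. \<tau> m x - \<tau> n x)"
    unfolding eq using norm_add[OF supported_diff supported_diff] s' by simp
qed auto

lemma C_smult: "\<sigma> \<in> C \<Longrightarrow> (\<lambda>n x. a * \<sigma> n x) \<in> C"
proof (rule C_I[where M = "cmod a" and L = 0])
  assume s: "\<sigma> \<in> C"
  then have s': "\<sigma> n \<in> supported G" for n by (simp add: C_supported)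
  show "(\<lambda>x. a * \<sigma> n x) \<in> supported G" for n using s' by (intro supported_smult)
  show "N (\<lambda>x. a * \<sigma> m x - a * \<sigma> n x) \<le> cmod a * N (\<lambda>x. \<sigma> m x - \<sigma> n x) + 0 * N (\<lambda>x. \<sigma> m x - \<sigma> n x)" for m n
    using norm_smult[of "\<lambda>x. \<sigma> m x - \<sigma> n x" a] s' by (simp add: supported_diff right_diff_distrib)
qed auto

lemma C_conv: "\<lbrakk>\<sigma> \<in> C; \<tau> \<in> C\<rbrakk> \<Longrightarrow> (\<lambda>n. conv G (\<sigma> n) (\<tau> n)) \<in> C"
proof -
  assume s: "\<sigma> \<in> C" "\<tau> \<in> C"
  then have s': "\<sigma> n \<in> supported G" "\<tau> n \<in> supported G" for n by (simp_all add: C_supported)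
  obtain M where M: "0 \<le> M" "\<And>n. N (\<tau> n) \<le> M" using C_bounded[OF s(2)] by blast
  obtain L where L: "0 \<le> L" "\<And>n. N (\<sigma> n) \<le> L" using C_bounded[OF s(1)] by blast
  show ?thesis
  proof (rule C_I[OF _ s M(1) L(1)])
    show "conv G (\<sigma> n) (\<tau> n) \<in> supported G" for n using s' by (intro supp_conv)
    fix m n
    have "N (\<lambda>x. \<sigma> m x - \<sigma> n x) * N (\<tau> m) \<le> M * N (\<lambda>x. \<sigma> m x - \<sigma> n x)"
      using mult_left_mono[OF M(2)[of m] norm_nonneg[OF supported_diff[OF s'(1) s'(1)]]]
      by (simp add: mult.commute)
    moreover have "N (\<sigma> n) * N (\<lambda>x. \<tau> m x - \<tau> n x) \<le> L * N (\<lambda>x. \<tau> m x - \<tau> n x)"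
      by (rule mult_right_mono[OF L(2) norm_nonneg[OF supported_diff[OF s'(2) s'(2)]]])
    ultimately show "N (\<lambda>x. conv G (\<sigma> m) (\<tau> m) x - conv G (\<sigma> n) (\<tau> n) x) \<le>
        M * N (\<lambda>x. \<sigma> m x - \<sigma> n x) + L * N (\<lambda>x. \<tau> m x - \<tau> n x)"
      using norm_conv_diff[of "\<sigma> m" "\<sigma> n" "\<tau> m" "\<tau> n"] s' by simp
  qed
qed

lemma C_star: "\<sigma> \<in> C \<Longrightarrow> (\<lambda>n. star G (\<sigma> n)) \<in> C"
proof (rule C_I[where M = 1 and L = 0])
  assume s: "\<sigma> \<in> C"
  then have s': "\<sigma> n \<in> supported G" for n by (simp add: C_supported)
  show "star G (\<sigma> n) \<in> supported G" for n using s' by (rule supp_star)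
  show "N (\<lambda>x. star G (\<sigma> m) x - star G (\<sigma> n) x) \<le> 1 * N (\<lambda>x. \<sigma> m x - \<sigma> n x) + 0 * N (\<lambda>x. \<sigma> m x - \<sigma> n x)" for m n
    using norm_star_diff[OF s' s', of m n] by simp
qed auto

lemma null_rel_iff: "(\<sigma>, \<tau>) \<in> null_rel P \<longleftrightarrow> \<sigma> \<in> C \<and> \<tau> \<in> C \<and> (\<lambda>n. N (\<lambda>x. \<sigma> n x - \<tau> n x)) \<longlonglongrightarrow> 0"
proof -
  have "adist P (\<sigma> n) (\<tau> n) = N (\<lambda>x. \<sigma> n x - \<tau> n x)" if "\<sigma> \<in> C" "\<tau> \<in> C" for n
    using that by (simp add: adist_P C_supported)
  then show ?thesis by (auto simp: null_rel_def)
qed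

lemma null_relI:
  assumes "\<sigma> \<in> C" "\<tau> \<in> C" "z \<longlonglongrightarrow> 0" "\<And>n. N (\<lambda>x. \<sigma> n x - \<tau> n x) \<le> z n"
  shows "(\<sigma>, \<tau>) \<in> null_rel P"
proof -
  have nn: "0 \<le> N (\<lambda>x. \<sigma> n x - \<tau> n x)" for n
    using assms(1,2) by (intro norm_nonneg supported_diff C_supported)
  have "(\<lambda>n. N (\<lambda>x. \<sigma> n x - \<tau> n x)) \<longlonglongrightarrow> 0"
    by (rule Lim_null_comparison[OF always_eventually assms(3)]) (use nn assms(4) in simp)
  then show ?thesis using assms by (simp add: null_rel_iff)
qed

lemma equiv_null_rel: "equiv C (null_rel P)"
proof (rule equivI)
  show "null_rel P \<subseteq> C \<times> C" by (auto simp: null_rel_def)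
  show "refl_on C (null_rel P)" by (auto simp: refl_on_def null_rel_iff norm_zero)
  show "sym (null_rel P)"
  proof (rule symI)
    fix \<sigma> \<tau> assume st: "(\<sigma>, \<tau>) \<in> null_rel P"
    then have "\<sigma> \<in> C" "\<tau> \<in> C" "(\<lambda>n. N (\<lambda>x. \<sigma> n x - \<tau> n x)) \<longlonglongrightarrow> 0" by (simp_all add: null_rel_iff)
    then show "(\<tau>, \<sigma>) \<in> null_rel P"
      using norm_minus_commute[OF C_supported C_supported]
      by (intro null_relI[of \<tau> \<sigma> "\<lambda>n. N (\<lambda>x. \<sigma> n x - \<tau> n x)"]) auto
  qed
  show "trans (null_rel P)"
  proof (rule transI)
    fix \<sigma> \<tau> \<rho> assume "(\<sigma>, \<tau>) \<in> null_rel P" "(\<tau>, \<rho>) \<in> null_rel P"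
    then have st: "\<sigma> \<in> C" "\<tau> \<in> C" "\<rho> \<in> C" and l: "(\<lambda>n. N (\<lambda>x. \<sigma> n x - \<tau> n x)) \<longlonglongrightarrow> 0"
      "(\<lambda>n. N (\<lambda>x. \<tau> n x - \<rho> n x)) \<longlonglongrightarrow> 0" by (simp_all add: null_rel_iff)
    have "(\<lambda>n. N (\<lambda>x. \<sigma> n x - \<tau> n x) + N (\<lambda>x. \<tau> n x - \<rho> n x)) \<longlonglongrightarrow> 0"
      using tendsto_add[OF l] by simp
    then show "(\<sigma>, \<rho>) \<in> null_rel P"
      by (rule null_relI[OF st(1,3)]) (intro norm_diff_triangle C_supported st)
  qed
qed

abbreviation cls :: "(nat \<Rightarrow> 'g \<Rightarrow> complex) \<Rightarrow> (nat \<Rightarrow> 'g \<Rightarrow> complex) set" where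
  "cls \<sigma> \<equiv> null_rel P `` {\<sigma>}"

lemma cls_in_B: "\<sigma> \<in> C \<Longrightarrow> cls \<sigma> \<in> carrier B"
  by (auto simp: completion_def intro: quotientI)

lemma B_cases:
  assumes "c \<in> carrier B"
  obtains \<sigma> where "\<sigma> \<in> C" "c = cls \<sigma>"
  using assms by (auto simp: completion_def elim: quotientE)

text \<open>\<open>completion\<close> defines its operations as unions over representatives; these
  collapse to a single class once the operation respects \<open>null_rel\<close>. The next three
  lemmas follow the same pattern, with boundedness of Cauchy sequences entering for the
  product.\<close>

lemma B_add:
  assumes "\<sigma> \<in> C" "\<tau> \<in> C"
  shows "cls \<sigma> \<oplus>\<^bsub>B\<^esub> cls \<tau> = cls (\<lambda>n x. \<sigma> n x + \<tau> n x)"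
proof -
  have "congruent2 (null_rel P) (null_rel P) (\<lambda>\<sigma> \<tau>. cls (\<lambda>n. \<sigma> n \<oplus>\<^bsub>P\<^esub> \<tau> n))"
  proof (rule congruent2I'[of "null_rel P" "null_rel P" "\<lambda>\<sigma> \<tau>. cls (\<lambda>n. \<sigma> n \<oplus>\<^bsub>P\<^esub> \<tau> n)"])
    fix \<sigma> \<sigma>' \<tau> \<tau>' assume "(\<sigma>, \<sigma>') \<in> null_rel P" "(\<tau>, \<tau>') \<in> null_rel P"
    then have c: "\<sigma> \<in> C" "\<sigma>' \<in> C" "\<tau> \<in> C" "\<tau>' \<in> C" and l: "(\<lambda>n. N (\<lambda>x. \<sigma> n x - \<sigma>' n x)) \<longlonglongrightarrow> 0"
      "(\<lambda>n. N (\<lambda>x. \<tau> n x - \<tau>' n x)) \<longlonglongrightarrow> 0" by (simp_all add: null_rel_iff)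
    have "(\<lambda>n. N (\<lambda>x. \<sigma> n x - \<sigma>' n x) + N (\<lambda>x. \<tau> n x - \<tau>' n x)) \<longlonglongrightarrow> 0"
      using tendsto_add[OF l] by simp
    then have "((\<lambda>n x. \<sigma> n x + \<tau> n x), (\<lambda>n x. \<sigma>' n x + \<tau>' n x)) \<in> null_rel P"
    proof (rule null_relI[OF C_add[OF c(1,3)] C_add[OF c(2,4)]])
      fix n
      have eq: "(\<lambda>x. \<sigma> n x + \<tau> n x - (\<sigma>' n x + \<tau>' n x)) = (\<lambda>x. (\<sigma> n x - \<sigma>' n x) + (\<tau> n x - \<tau>' n x))"
        by (simp add: algebra_simps)
      show "N (\<lambda>x. \<sigma> n x + \<tau> n x - (\<sigma>' n x + \<tau>' n x)) \<le> N (\<lambda>x. \<sigma> n x - \<sigma>' n x) + N (\<lambda>x. \<tau> n x - \<tau>' n x)"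
        unfolding eq using c by (intro norm_add supported_diff C_supported)
    qed
    then show "cls (\<lambda>n. \<sigma> n \<oplus>\<^bsub>P\<^esub> \<tau> n) = cls (\<lambda>n. \<sigma>' n \<oplus>\<^bsub>P\<^esub> \<tau>' n)"
      using equiv_class_eq[OF equiv_null_rel] by simp
  qed
  from UN_equiv_class2[OF equiv_null_rel equiv_null_rel this assms]
  show ?thesis by (simp add: completion_def)
qed

lemma B_mult:
  assumes "\<sigma> \<in> C" "\<tau> \<in> C"
  shows "cls \<sigma> \<otimes>\<^bsub>B\<^esub> cls \<tau> = cls (\<lambda>n. conv G (\<sigma> n) (\<tau> n))"
proof -
  have "congruent2 (null_rel P) (null_rel P) (\<lambda>\<sigma> \<tau>. cls (\<lambda>n. \<sigma> n \<otimes>\<^bsub>P\<^esub> \<tau> n))"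
  proof (rule congruent2I'[of "null_rel P" "null_rel P" "\<lambda>\<sigma> \<tau>. cls (\<lambda>n. \<sigma> n \<otimes>\<^bsub>P\<^esub> \<tau> n)"])
    fix \<sigma> \<sigma>' \<tau> \<tau>' assume "(\<sigma>, \<sigma>') \<in> null_rel P" "(\<tau>, \<tau>') \<in> null_rel P"
    then have c: "\<sigma> \<in> C" "\<sigma>' \<in> C" "\<tau> \<in> C" "\<tau>' \<in> C" and l: "(\<lambda>n. N (\<lambda>x. \<sigma> n x - \<sigma>' n x)) \<longlonglongrightarrow> 0"
      "(\<lambda>n. N (\<lambda>x. \<tau> n x - \<tau>' n x)) \<longlonglongrightarrow> 0" by (simp_all add: null_rel_iff)
    obtain M where M: "0 \<le> M" "\<And>n. N (\<tau> n) \<le> M" using C_bounded[OF c(3)] by blast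
    obtain L where L: "0 \<le> L" "\<And>n. N (\<sigma>' n) \<le> L" using C_bounded[OF c(2)] by blast
    have "(\<lambda>n. N (\<lambda>x. \<sigma> n x - \<sigma>' n x) * M + L * N (\<lambda>x. \<tau> n x - \<tau>' n x)) \<longlonglongrightarrow> 0 * M + L * 0"
      by (intro tendsto_intros l)
    then have "(\<lambda>n. N (\<lambda>x. \<sigma> n x - \<sigma>' n x) * M + L * N (\<lambda>x. \<tau> n x - \<tau>' n x)) \<longlonglongrightarrow> 0" by simp
    then have "((\<lambda>n. conv G (\<sigma> n) (\<tau> n)), (\<lambda>n. conv G (\<sigma>' n) (\<tau>' n))) \<in> null_rel P"
    proof (rule null_relI[OF C_conv[OF c(1,3)] C_conv[OF c(2,4)]])
      fix n
      have "N (\<lambda>x. \<sigma> n x - \<sigma>' n x) * N (\<tau> n) \<le> N (\<lambda>x. \<sigma> n x - \<sigma>' n x) * M"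
        using c by (intro mult_left_mono M norm_nonneg supported_diff C_supported)
      moreover have "N (\<sigma>' n) * N (\<lambda>x. \<tau> n x - \<tau>' n x) \<le> L * N (\<lambda>x. \<tau> n x - \<tau>' n x)"
        using c by (intro mult_right_mono L norm_nonneg supported_diff C_supported)
      ultimately show "N (\<lambda>x. conv G (\<sigma> n) (\<tau> n) x - conv G (\<sigma>' n) (\<tau>' n) x) \<le>
          N (\<lambda>x. \<sigma> n x - \<sigma>' n x) * M + L * N (\<lambda>x. \<tau> n x - \<tau>' n x)"
        using norm_conv_diff[of "\<sigma> n" "\<sigma>' n" "\<tau> n" "\<tau>' n"] c C_supported by fastforce
    qed
    then show "cls (\<lambda>n. \<sigma> n \<otimes>\<^bsub>P\<^esub> \<tau> n) = cls (\<lambda>n. \<sigma>' n \<otimes>\<^bsub>P\<^esub> \<tau>' n)"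
      using equiv_class_eq[OF equiv_null_rel] by simp
  qed
  from UN_equiv_class2[OF equiv_null_rel equiv_null_rel this assms]
  show ?thesis by (simp add: completion_def)
qed

lemma B_smult:
  assumes "\<sigma> \<in> C"
  shows "a \<odot>\<^bsub>B\<^esub> cls \<sigma> = cls (\<lambda>n x. a * \<sigma> n x)"
proof -
  have "congruent (null_rel P) (\<lambda>\<sigma>. cls (\<lambda>n. a \<odot>\<^bsub>P\<^esub> \<sigma> n))"
  proof (rule congruentI)
    fix \<sigma> \<sigma>' assume "(\<sigma>, \<sigma>') \<in> null_rel P"
    then have c: "\<sigma> \<in> C" "\<sigma>' \<in> C" and l: "(\<lambda>n. N (\<lambda>x. \<sigma> n x - \<sigma>' n x)) \<longlonglongrightarrow> 0"
      by (simp_all add: null_rel_iff)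
    have "(\<lambda>n. cmod a * N (\<lambda>x. \<sigma> n x - \<sigma>' n x)) \<longlonglongrightarrow> 0"
      using tendsto_mult_left[OF l, of "cmod a"] by simp
    then have "((\<lambda>n x. a * \<sigma> n x), (\<lambda>n x. a * \<sigma>' n x)) \<in> null_rel P"
    proof (rule null_relI[OF C_smult[OF c(1)] C_smult[OF c(2)]])
      show "N (\<lambda>x. a * \<sigma> n x - a * \<sigma>' n x) \<le> cmod a * N (\<lambda>x. \<sigma> n x - \<sigma>' n x)" for n
        using norm_smult[of "\<lambda>x. \<sigma> n x - \<sigma>' n x" a] C_supported[OF c(1)] C_supported[OF c(2)]
        by (simp add: supported_diff right_diff_distrib)
    qed
    then show "cls (\<lambda>n. a \<odot>\<^bsub>P\<^esub> \<sigma> n) = cls (\<lambda>n. a \<odot>\<^bsub>P\<^esub> \<sigma>' n)"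
      using equiv_class_eq[OF equiv_null_rel] by simp
  qed
  from UN_equiv_class[OF equiv_null_rel this assms] show ?thesis by (simp add: completion_def)
qed

lemma B_adj:
  assumes "\<sigma> \<in> C"
  shows "adj B (cls \<sigma>) = cls (\<lambda>n. star G (\<sigma> n))"
proof -
  have "congruent (null_rel P) (\<lambda>\<sigma>. cls (\<lambda>n. adj P (\<sigma> n)))"
  proof (rule congruentI)
    fix \<sigma> \<sigma>' assume "(\<sigma>, \<sigma>') \<in> null_rel P"
    then have c: "\<sigma> \<in> C" "\<sigma>' \<in> C" and l: "(\<lambda>n. N (\<lambda>x. \<sigma> n x - \<sigma>' n x)) \<longlonglongrightarrow> 0"
      by (simp_all add: null_rel_iff)
    have "((\<lambda>n. star G (\<sigma> n)), (\<lambda>n. star G (\<sigma>' n))) \<in> null_rel P"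
      by (rule null_relI[OF C_star[OF c(1)] C_star[OF c(2)] l])
        (intro norm_star_diff C_supported c)
    then show "cls (\<lambda>n. adj P (\<sigma> n)) = cls (\<lambda>n. adj P (\<sigma>' n))"
      using equiv_class_eq[OF equiv_null_rel] by simp
  qed
  from UN_equiv_class[OF equiv_null_rel this assms] show ?thesis by (simp add: completion_def)
qed

lemma B_zero: "zero B = cls (\<lambda>n x. 0)" and B_one: "one B = cls (\<lambda>n. delta \<one>\<^bsub>G\<^esub>)"
  by (simp_all add: completion_def)

lemma C_zero: "(\<lambda>n x. 0) \<in> C"
  by (rule C_const[OF supported_zero])

text \<open>Makes the rules for \<open>finsum\<close> available for the sums in
  \<open>positive_matrix\<close>.\<close>

lemma abelian_monoid_B: "abelian_monoid B"
proof (rule abelian_monoidI)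
  fix c d e assume "c \<in> carrier B" "d \<in> carrier B" "e \<in> carrier B"
  then obtain \<sigma> \<tau> \<rho> where "\<sigma> \<in> C" "c = cls \<sigma>" "\<tau> \<in> C" "d = cls \<tau>" "\<rho> \<in> C" "e = cls \<rho>"
    by (metis B_cases)
  then show "c \<oplus>\<^bsub>B\<^esub> d \<oplus>\<^bsub>B\<^esub> e = c \<oplus>\<^bsub>B\<^esub> (d \<oplus>\<^bsub>B\<^esub> e)" "c \<oplus>\<^bsub>B\<^esub> d = d \<oplus>\<^bsub>B\<^esub> c"
    by (simp_all add: B_add C_add add_ac)
qed (auto elim!: B_cases simp: B_add B_zero C_add C_zero cls_in_B)

sublocale B: abelian_monoid B by (rule abelian_monoid_B)

lemma B_mult_closed: "\<lbrakk>c \<in> carrier B; d \<in> carrier B\<rbrakk> \<Longrightarrow> c \<otimes>\<^bsub>B\<^esub> d \<in> carrier B"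
  by (auto elim!: B_cases simp: B_mult C_conv cls_in_B)

lemma B_smult_closed: "c \<in> carrier B \<Longrightarrow> a \<odot>\<^bsub>B\<^esub> c \<in> carrier B"
  by (auto elim!: B_cases simp: B_smult C_smult cls_in_B)

lemma B_adj_closed: "c \<in> carrier B \<Longrightarrow> adj B c \<in> carrier B"
  by (auto elim!: B_cases simp: B_adj C_star cls_in_B)

section \<open>Coefficient functionals and positivity\<close>

definition coeff :: "(nat \<Rightarrow> 'g \<Rightarrow> complex) set \<Rightarrow> 'g \<Rightarrow> complex" where
  "coeff c g = lim (\<lambda>n. (SOME \<sigma>. \<sigma> \<in> c) n g)"

text \<open>By \<open>norm_coeff\<close>, Cauchy sequences in the norm converge at each group
  element, and equivalent ones have the same limit; so the representative chosen in
  \<open>coeff\<close> is immaterial.\<close>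

lemma coeff_lim:
  assumes \<sigma>: "\<sigma> \<in> C"
  shows "(\<lambda>n. \<sigma> n g) \<longlonglongrightarrow> coeff (cls \<sigma>) g"
proof -
  define \<tau> where "\<tau> = (SOME \<tau>. \<tau> \<in> cls \<sigma>)"
  have "\<sigma> \<in> cls \<sigma>" using equiv_class_self[OF equiv_null_rel \<sigma>] .
  then have "\<tau> \<in> cls \<sigma>" unfolding \<tau>_def by (rule someI[of "\<lambda>\<tau>. \<tau> \<in> cls \<sigma>"])
  then have \<tau>: "\<tau> \<in> C" and l: "(\<lambda>n. N (\<lambda>x. \<sigma> n x - \<tau> n x)) \<longlonglongrightarrow> 0" by (simp_all add: null_rel_iff)
  have s: "\<sigma> n \<in> supported G" "\<tau> n \<in> supported G" for n using \<sigma> \<tau> by (simp_all add: C_supported)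
  have "convergent (\<lambda>n. \<tau> n g)"
  proof (rule Cauchy_convergent, rule CauchyI)
    fix e :: real assume "e > 0"
    from CD[OF \<tau> this] obtain K where K: "\<forall>m\<ge>K. \<forall>n\<ge>K. N (\<lambda>x. \<tau> m x - \<tau> n x) < e" by blast
    have "cmod (\<tau> m g - \<tau> n g) < e" if "m \<ge> K" "n \<ge> K" for m n
      using norm_coeff[OF supported_diff[OF s(2)[of m] s(2)[of n]], of g] K that by fastforce
    then show "\<exists>K. \<forall>m\<ge>K. \<forall>n\<ge>K. norm (\<tau> m g - \<tau> n g) < e" by blast
  qed
  then have "(\<lambda>n. \<tau> n g) \<longlonglongrightarrow> coeff (cls \<sigma>) g"
    unfolding convergent_LIMSEQ_iff by (simp add: coeff_def \<tau>_def)
  moreover have "(\<lambda>n. \<sigma> n g - \<tau> n g) \<longlonglongrightarrow> 0"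
    by (rule Lim_null_comparison[OF always_eventually l])
      (use norm_coeff[OF supported_diff[OF s]] in simp)
  ultimately have "(\<lambda>n. (\<sigma> n g - \<tau> n g) + \<tau> n g) \<longlonglongrightarrow> 0 + coeff (cls \<sigma>) g"
    by (intro tendsto_add)
  then show ?thesis by simp
qed

lemma coeff_add:
  assumes "c \<in> carrier B" "d \<in> carrier B"
  shows "coeff (c \<oplus>\<^bsub>B\<^esub> d) g = coeff c g + coeff d g"
proof -
  obtain \<sigma> \<tau> where st: "\<sigma> \<in> C" "c = cls \<sigma>" "\<tau> \<in> C" "d = cls \<tau>" using assms by (metis B_cases)
  have "(\<lambda>n. \<sigma> n g + \<tau> n g) \<longlonglongrightarrow> coeff (c \<oplus>\<^bsub>B\<^esub> d) g"
    using coeff_lim[OF C_add[OF st(1,3)], of g] st by (simp add: B_add)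
  moreover have "(\<lambda>n. \<sigma> n g + \<tau> n g) \<longlonglongrightarrow> coeff c g + coeff d g"
    using st by (auto intro: tendsto_add coeff_lim)
  ultimately show ?thesis by (rule LIMSEQ_unique)
qed

lemma coeff_smult:
  assumes "c \<in> carrier B"
  shows "coeff (a \<odot>\<^bsub>B\<^esub> c) g = a * coeff c g"
proof -
  obtain \<sigma> where st: "\<sigma> \<in> C" "c = cls \<sigma>" using assms by (metis B_cases)
  have "(\<lambda>n. a * \<sigma> n g) \<longlonglongrightarrow> coeff (a \<odot>\<^bsub>B\<^esub> c) g"
    using coeff_lim[OF C_smult[OF st(1)], of a g] st by (simp add: B_smult)
  moreover have "(\<lambda>n. a * \<sigma> n g) \<longlonglongrightarrow> a * coeff c g"
    using st by (auto intro: tendsto_mult_left coeff_lim)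
  ultimately show ?thesis by (rule LIMSEQ_unique)
qed

lemma coeff_const: "f \<in> supported G \<Longrightarrow> coeff (cls (\<lambda>n. f)) g = f g"
  using LIMSEQ_unique[OF coeff_lim[OF C_const] tendsto_const] by blast

lemma coeff_zero: "coeff \<zero>\<^bsub>B\<^esub> g = 0"
  unfolding B_zero using coeff_const[OF supported_zero] by simp

lemma coeff_one: "coeff \<one>\<^bsub>B\<^esub> g = (if g = \<one>\<^bsub>G\<^esub> then 1 else 0)"
  unfolding B_one using coeff_const[OF supported_delta] by (simp add: delta_def)

lemma coeff_finsum:
  assumes "finite A" "f \<in> A \<rightarrow> carrier B"
  shows "coeff (finsum B f A) g = (\<Sum>k\<in>A. coeff (f k) g)"
  using assms
proof (induction A)
  case (insert k A)
  then have "f k \<in> carrier B" "f \<in> A \<rightarrow> carrier B" by auto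
  with insert show ?case by (simp add: coeff_add)
qed (simp add: coeff_zero)

text \<open>Reduces positivity to finitely supported functions: with sequences representing the
  entries of \<open>Y\<close>, the coefficients of \<open>Y\<^sup>* Y\<close> become limits of
  correlations, to which the \<open>conv_star\<close> lemmas apply.\<close>

lemma positive_matrix_coeff:
  assumes M: "positive_matrix B n M"
  shows "\<exists>y :: nat \<Rightarrow> nat \<Rightarrow> nat \<Rightarrow> 'g \<Rightarrow> complex. (\<forall>k<n. \<forall>i<n. \<forall>m. y k i m \<in> supported G) \<and>
    (\<forall>i<n. \<forall>j<n. \<forall>g. (\<lambda>m. \<Sum>k<n. conv G (star G (y k i m)) (y k j m) g) \<longlonglongrightarrow> coeff (M i j) g)"
proof -
  obtain Y where YM: "(\<forall>i<n. \<forall>j<n. Y i j \<in> carrier B) \<and>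
      (\<forall>i<n. \<forall>j<n. M i j = (\<Oplus>\<^bsub>B\<^esub>k\<in>{..<n}. adj B (Y k i) \<otimes>\<^bsub>B\<^esub> Y k j))"
    by (rule exE[OF M[unfolded positive_matrix_def]])
  note Y' = conjunct1[OF YM] and MY' = conjunct2[OF YM]
  have Y: "\<And>k i. \<lbrakk>k < n; i < n\<rbrakk> \<Longrightarrow> Y k i \<in> carrier B" using Y' by simp
  have MY: "\<And>i j. \<lbrakk>i < n; j < n\<rbrakk> \<Longrightarrow> M i j = (\<Oplus>\<^bsub>B\<^esub>k\<in>{..<n}. adj B (Y k i) \<otimes>\<^bsub>B\<^esub> Y k j)"
    using MY' by simp
  have "\<forall>k i. \<exists>\<sigma>. k < n \<longrightarrow> i < n \<longrightarrow> \<sigma> \<in> C \<and> Y k i = cls \<sigma>"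
    using Y B_cases by metis
  then obtain y where y: "\<And>k i. \<lbrakk>k < n; i < n\<rbrakk> \<Longrightarrow> y k i \<in> C \<and> Y k i = cls (y k i)" by metis
  show ?thesis
  proof (intro exI[of _ y] conjI allI impI)
    show "y k i m \<in> supported G" if "k < n" "i < n" for k i m using y[OF that] C_supported by blast
    fix i j g assume ij: "i < n" "j < n"
    have "coeff (M i j) g = (\<Sum>k<n. coeff (adj B (Y k i) \<otimes>\<^bsub>B\<^esub> Y k j) g)"
      unfolding MY[OF ij] using Y ij by (intro coeff_finsum) (auto intro: B_mult_closed B_adj_closed)
    also have "\<dots> = (\<Sum>k<n. coeff (cls (\<lambda>m. conv G (star G (y k i m)) (y k j m))) g)"
    proof (rule sum.cong[OF refl])
      fix k assume "k \<in> {..<n}"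
      then have "y k i \<in> C" "y k j \<in> C" "Y k i = cls (y k i)" "Y k j = cls (y k j)" using y ij by auto
      then show "coeff (adj B (Y k i) \<otimes>\<^bsub>B\<^esub> Y k j) g = coeff (cls (\<lambda>m. conv G (star G (y k i m)) (y k j m))) g"
        by (simp add: B_adj B_mult C_star)
    qed
    finally have eq: "coeff (M i j) g = (\<Sum>k<n. coeff (cls (\<lambda>m. conv G (star G (y k i m)) (y k j m))) g)" .
    show "(\<lambda>m. \<Sum>k<n. conv G (star G (y k i m)) (y k j m) g) \<longlonglongrightarrow> coeff (M i j) g"
      unfolding eq
    proof (rule tendsto_sum)
      fix k assume "k \<in> {..<n}"
      then have "y k i \<in> C" "y k j \<in> C" using y ij by auto
      then show "(\<lambda>m. conv G (star G (y k i m)) (y k j m) g) \<longlonglongrightarrow>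
          coeff (cls (\<lambda>m. conv G (star G (y k i m)) (y k j m))) g"
        by (intro coeff_lim C_conv C_star)
    qed
  qed
qed

text \<open>The coefficient of entry \<open>(i, j)\<close> is taken at
  \<open>h\<^sub>i\<^sup>-\<^sup>1 h\<^sub>j\<close>, the arrangement for which the approximating
  sums are nonnegative by \<open>conv_star_positive\<close>; nonnegativity survives the
  limit.\<close>

lemma coeff_positive:
  assumes M: "positive_matrix B n M" and h: "\<And>i. i < n \<Longrightarrow> h i \<in> carrier G"
  shows "0 \<le> Re (\<Sum>i<n. \<Sum>j<n. cnj (c i) * c j * coeff (M i j) (inv\<^bsub>G\<^esub> (h i) \<otimes>\<^bsub>G\<^esub> h j))"
proof -
  obtain y :: "nat \<Rightarrow> nat \<Rightarrow> nat \<Rightarrow> 'g \<Rightarrow> complex" where yl: "(\<forall>k<n. \<forall>i<n. \<forall>m. y k i m \<in> supported G) \<and>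
    (\<forall>i<n. \<forall>j<n. \<forall>g. (\<lambda>m. \<Sum>k<n. conv G (star G (y k i m)) (y k j m) g) \<longlonglongrightarrow> coeff (M i j) g)"
    by (rule exE[OF positive_matrix_coeff[OF M]])
  note y' = conjunct1[OF yl] and l' = conjunct2[OF yl]
  have y: "\<And>k i m. \<lbrakk>k < n; i < n\<rbrakk> \<Longrightarrow> y k i m \<in> supported G" using y' by simp
  have l: "\<And>i j g. \<lbrakk>i < n; j < n\<rbrakk> \<Longrightarrow> (\<lambda>m. \<Sum>k<n. conv G (star G (y k i m)) (y k j m) g) \<longlonglongrightarrow> coeff (M i j) g"
    using l' by simp
  have L: "(\<lambda>m. Re (\<Sum>i<n. \<Sum>j<n. cnj (c i) * c j *
      (\<Sum>k<n. conv G (star G (y k i m)) (y k j m) (inv\<^bsub>G\<^esub> (h i) \<otimes>\<^bsub>G\<^esub> h j))))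
    \<longlonglongrightarrow> Re (\<Sum>i<n. \<Sum>j<n. cnj (c i) * c j * coeff (M i j) (inv\<^bsub>G\<^esub> (h i) \<otimes>\<^bsub>G\<^esub> h j))"
  proof (rule tendsto_Re, rule tendsto_sum, rule tendsto_sum, rule tendsto_mult_left)
    fix i j assume "i \<in> {..<n}" "j \<in> {..<n}"
    then show "(\<lambda>m. \<Sum>k<n. conv G (star G (y k i m)) (y k j m) (inv\<^bsub>G\<^esub> (h i) \<otimes>\<^bsub>G\<^esub> h j))
        \<longlonglongrightarrow> coeff (M i j) (inv\<^bsub>G\<^esub> (h i) \<otimes>\<^bsub>G\<^esub> h j)"
      by (intro l) auto
  qed
  have pos: "0 \<le> Re (\<Sum>i<n. \<Sum>j<n. cnj (c i) * c j *
      (\<Sum>k<n. conv G (star G (y k i m)) (y k j m) (inv\<^bsub>G\<^esub> (h i) \<otimes>\<^bsub>G\<^esub> h j)))" for m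
  proof -
    \<comment> \<open>The sum over \<open>k\<close> is moved outside: each row of the factor
      contributes one instance of \<open>conv_star_positive\<close>.\<close>
    have "(\<Sum>i<n. \<Sum>j<n. cnj (c i) * c j *
        (\<Sum>k<n. conv G (star G (y k i m)) (y k j m) (inv\<^bsub>G\<^esub> (h i) \<otimes>\<^bsub>G\<^esub> h j))) =
      (\<Sum>i<n. \<Sum>k<n. \<Sum>j<n. cnj (c i) * c j *
        conv G (star G (y k i m)) (y k j m) (inv\<^bsub>G\<^esub> (h i) \<otimes>\<^bsub>G\<^esub> h j))"
      unfolding sum_distrib_left
    proof (rule sum.cong[OF refl])
      fix i
      show "(\<Sum>j<n. \<Sum>k<n. cnj (c i) * c j * conv G (star G (y k i m)) (y k j m) (inv\<^bsub>G\<^esub> (h i) \<otimes>\<^bsub>G\<^esub> h j)) =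
        (\<Sum>k<n. \<Sum>j<n. cnj (c i) * c j * conv G (star G (y k i m)) (y k j m) (inv\<^bsub>G\<^esub> (h i) \<otimes>\<^bsub>G\<^esub> h j))"
        by (rule sum.swap)
    qed
    also have "\<dots> = (\<Sum>k<n. \<Sum>i<n. \<Sum>j<n. cnj (c i) * c j *
        conv G (star G (y k i m)) (y k j m) (inv\<^bsub>G\<^esub> (h i) \<otimes>\<^bsub>G\<^esub> h j))"
      by (rule sum.swap)
    finally have eq: "(\<Sum>i<n. \<Sum>j<n. cnj (c i) * c j *
        (\<Sum>k<n. conv G (star G (y k i m)) (y k j m) (inv\<^bsub>G\<^esub> (h i) \<otimes>\<^bsub>G\<^esub> h j))) =
      (\<Sum>k<n. \<Sum>i<n. \<Sum>j<n. cnj (c i) * c j *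
        conv G (star G (y k i m)) (y k j m) (inv\<^bsub>G\<^esub> (h i) \<otimes>\<^bsub>G\<^esub> h j))" .
    show ?thesis
      unfolding eq
    proof (subst Re_sum, rule sum_nonneg)
      fix k assume k: "k \<in> {..<n}"
      show "0 \<le> Re (\<Sum>i<n. \<Sum>j<n. cnj (c i) * c j *
          conv G (star G (y k i m)) (y k j m) (inv\<^bsub>G\<^esub> (h i) \<otimes>\<^bsub>G\<^esub> h j))"
        using k y h by (intro conv_star_positive[OF G.group_axioms, of n "\<lambda>i. y k i m"]) auto
    qed
  qed
  show ?thesis by (rule LIMSEQ_le_const[OF L]) (use pos in blast)
qed

lemma coeff_hermitian:
  assumes M: "positive_matrix B n M" and ij: "i < n" "j < n" and g: "g \<in> carrier G"
  shows "coeff (M j i) (inv\<^bsub>G\<^esub> g) = cnj (coeff (M i j) g)"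
proof -
  obtain y :: "nat \<Rightarrow> nat \<Rightarrow> nat \<Rightarrow> 'g \<Rightarrow> complex" where yl: "(\<forall>k<n. \<forall>i<n. \<forall>m. y k i m \<in> supported G) \<and>
    (\<forall>i<n. \<forall>j<n. \<forall>g. (\<lambda>m. \<Sum>k<n. conv G (star G (y k i m)) (y k j m) g) \<longlonglongrightarrow> coeff (M i j) g)"
    by (rule exE[OF positive_matrix_coeff[OF M]])
  note y' = conjunct1[OF yl] and l' = conjunct2[OF yl]
  have y: "\<And>k i m. \<lbrakk>k < n; i < n\<rbrakk> \<Longrightarrow> y k i m \<in> supported G" using y' by simp
  have l: "\<And>i j g. \<lbrakk>i < n; j < n\<rbrakk> \<Longrightarrow> (\<lambda>m. \<Sum>k<n. conv G (star G (y k i m)) (y k j m) g) \<longlonglongrightarrow> coeff (M i j) g"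
    using l' by simp
  have "(\<lambda>m. cnj (\<Sum>k<n. conv G (star G (y k i m)) (y k j m) g)) \<longlonglongrightarrow> cnj (coeff (M i j) g)"
    by (intro tendsto_cnj l ij)
  moreover have "cnj (\<Sum>k<n. conv G (star G (y k i m)) (y k j m) g) =
      (\<Sum>k<n. conv G (star G (y k j m)) (y k i m) (inv\<^bsub>G\<^esub> g))" for m
    unfolding cnj_sum
    using y ij by (intro sum.cong refl conv_star_hermitian[OF G.group_axioms _ _ g, symmetric]) auto
  ultimately have "(\<lambda>m. \<Sum>k<n. conv G (star G (y k j m)) (y k i m) (inv\<^bsub>G\<^esub> g)) \<longlonglongrightarrow> cnj (coeff (M i j) g)"
    by simp
  then show ?thesis using l[OF ij(2,1)] LIMSEQ_unique by blast
qed

text \<open>The estimate \<open>\<bar>\<phi> g\<bar> \<le> \<phi> 1\<close> for a positive element;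
  in \<open>ucp_coeff_bound\<close> it converts positivity into continuity.\<close>

lemma coeff_bound:
  assumes M: "positive_matrix B 1 M" and g: "g \<in> carrier G"
  shows "cmod (coeff (M 0 0) g) \<le> Re (coeff (M 0 0) \<one>\<^bsub>G\<^esub>)"
proof -
  obtain y :: "nat \<Rightarrow> nat \<Rightarrow> nat \<Rightarrow> 'g \<Rightarrow> complex" where yl: "(\<forall>k<1. \<forall>i<1. \<forall>m. y k i m \<in> supported G) \<and>
    (\<forall>i<1. \<forall>j<1. \<forall>g. (\<lambda>m. \<Sum>k<1. conv G (star G (y k i m)) (y k j m) g) \<longlonglongrightarrow> coeff (M i j) g)"
    by (rule exE[OF positive_matrix_coeff[OF M]])
  note y' = conjunct1[OF yl] and l' = conjunct2[OF yl]
  have y: "\<And>k i m. \<lbrakk>k < 1; i < 1\<rbrakk> \<Longrightarrow> y k i m \<in> supported G" using y' by simp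
  have l: "\<And>(i::nat) (j::nat) g. \<lbrakk>i < 1; j < 1\<rbrakk> \<Longrightarrow> (\<lambda>m. \<Sum>k<1. conv G (star G (y k i m)) (y k j m) g) \<longlonglongrightarrow> coeff (M i j) g"
    using l' by simp
  have l0: "(\<lambda>m. conv G (star G (y 0 0 m)) (y 0 0 m) g) \<longlonglongrightarrow> coeff (M 0 0) g" for g
    using l[of 0 0 g] by simp
  show ?thesis
    by (rule LIMSEQ_le[OF tendsto_norm[OF l0] tendsto_Re[OF l0]])
      (use conv_star_bound[OF G.group_axioms y g] in auto)
qed

definition unit_of :: "'g \<Rightarrow> (nat \<Rightarrow> 'g \<Rightarrow> complex) set" where
  "unit_of g = cls (\<lambda>n. delta g)"

lemma unit_of_closed: "g \<in> carrier G \<Longrightarrow> unit_of g \<in> carrier B"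
  unfolding unit_of_def by (intro cls_in_B C_const supported_delta)

lemma unit_of_one: "unit_of \<one>\<^bsub>G\<^esub> = \<one>\<^bsub>B\<^esub>"
  by (simp add: unit_of_def B_one)

lemma coeff_unit_of: "g \<in> carrier G \<Longrightarrow> coeff (unit_of g) x = (if x = g then 1 else 0)"
  unfolding unit_of_def using coeff_const[OF supported_delta] by (simp add: delta_def)

lemma positive_matrix_unit_of:
  assumes h: "\<And>i. i < n \<Longrightarrow> h i \<in> carrier G"
  shows "positive_matrix B n (\<lambda>i j. unit_of (inv\<^bsub>G\<^esub> (h i) \<otimes>\<^bsub>G\<^esub> h j))"
  unfolding positive_matrix_def
\<comment> \<open>The factor has to be a square matrix, so the row of unitaries
  \<open>unit_of (h i)\<close> is padded with zero rows.\<close>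
proof (intro exI[of _ "\<lambda>k i. if k = 0 then unit_of (h i) else \<zero>\<^bsub>B\<^esub>"] conjI allI impI)
  show "(if k = 0 then unit_of (h i) else \<zero>\<^bsub>B\<^esub>) \<in> carrier B" if "i < n" for k i
    using unit_of_closed h that by auto
  fix i j assume ij: "i < n" "j < n"
  have zz: "adj B \<zero>\<^bsub>B\<^esub> \<otimes>\<^bsub>B\<^esub> \<zero>\<^bsub>B\<^esub> = \<zero>\<^bsub>B\<^esub>"
  proof -
    have "conv G (star G (\<lambda>x. 0)) (\<lambda>x. 0) = (\<lambda>x. 0)" by (auto simp: conv_def)
    then show ?thesis by (simp add: B_zero B_adj B_mult C_zero C_star)
  qed
  have uu: "adj B (unit_of (h i)) \<otimes>\<^bsub>B\<^esub> unit_of (h j) = unit_of (inv\<^bsub>G\<^esub> (h i) \<otimes>\<^bsub>G\<^esub> h j)"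
    using h ij by (simp add: unit_of_def B_adj B_mult C_const C_star supported_delta
      conv_star_delta[OF G.group_axioms])
  have "(\<Oplus>\<^bsub>B\<^esub>k\<in>{..<n}. adj B (if k = 0 then unit_of (h i) else \<zero>\<^bsub>B\<^esub>) \<otimes>\<^bsub>B\<^esub>
      (if k = 0 then unit_of (h j) else \<zero>\<^bsub>B\<^esub>)) =
    (\<Oplus>\<^bsub>B\<^esub>k\<in>{..<n}. if 0 = k then unit_of (inv\<^bsub>G\<^esub> (h i) \<otimes>\<^bsub>G\<^esub> h j) else \<zero>\<^bsub>B\<^esub>)"
    using uu zz unit_of_closed h ij by (intro B.finsum_cong') auto
  also have "\<dots> = unit_of (inv\<^bsub>G\<^esub> (h i) \<otimes>\<^bsub>G\<^esub> h j)"
    using ij h by (intro B.finsum_singleton) (auto intro: unit_of_closed)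
  finally show "unit_of (inv\<^bsub>G\<^esub> (h i) \<otimes>\<^bsub>G\<^esub> h j) =
      (\<Oplus>\<^bsub>B\<^esub>k\<in>{..<n}. adj B (if k = 0 then unit_of (h i) else \<zero>\<^bsub>B\<^esub>) \<otimes>\<^bsub>B\<^esub>
      (if k = 0 then unit_of (h j) else \<zero>\<^bsub>B\<^esub>))" by simp
qed

end

section \<open>Square roots in C*-algebras and continuity of positive maps\<close>

context unital_cstar_algebra
begin

lemma ring_A: "ring A"
  by (rule unital_cstar_algebra.axioms(1)[OF unital_cstar_algebra_axioms])

lemma module_A: "module complex_ring A"
  by (rule unital_cstar_algebra.axioms(2)[OF unital_cstar_algebra_axioms])

text \<open>In this locale several unqualified names of ring facts refer to the scalars \<open>complex_ring\<close>.
  The following are the ones about \<open>A\<close>.\<close>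

lemma smult_1 [simp]: "x \<in> carrier A \<Longrightarrow> 1 \<odot> x = x"
  using smult_one[of x] by simp

lemmas mult_closed [simp, intro] = monoid.m_closed[OF ring.is_monoid[OF ring_A]]
lemmas unit_closed [simp, intro] = monoid.one_closed[OF ring.is_monoid[OF ring_A]]
lemmas mult_unit_left = monoid.l_one[OF ring.is_monoid[OF ring_A]]
lemmas mult_unit_right = monoid.r_one[OF ring.is_monoid[OF ring_A]]
lemma semiring_A: "semiring A"
  by unfold_locales

lemma abelian_group_A: "abelian_group A"
  by (rule module.axioms(2)[OF module_A])

lemmas plus_assoc = abelian_monoid.a_assoc[OF abelian_group.axioms(1)[OF abelian_group_A]]
lemmas plus_comm = abelian_monoid.a_comm[OF abelian_group.axioms(1)[OF abelian_group_A]]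
lemmas plus_lcomm = abelian_monoid.a_lcomm[OF abelian_group.axioms(1)[OF abelian_group_A]]
lemmas plus_ac = plus_assoc plus_comm plus_lcomm
lemmas neg_right = abelian_group.r_neg[OF abelian_group_A]
lemmas neg_left = abelian_group.l_neg[OF abelian_group_A]
lemmas neg_right1 = abelian_group.r_neg1[OF abelian_group_A]
lemmas neg_right2 = abelian_group.r_neg2[OF abelian_group_A]

lemmas distrib_l = semiring.l_distr[OF semiring_A]
lemmas distrib_r = semiring.r_distr[OF semiring_A]

lemma minus_conv: "\<lbrakk>x \<in> carrier A; y \<in> carrier A\<rbrakk> \<Longrightarrow> x \<ominus> y = x \<oplus> (-1) \<odot> y"
  by (simp add: a_minus_def complex_module_uminus[OF module_A])

lemma add_cancel_neg: "x \<in> carrier A \<Longrightarrow> x \<oplus> (-1) \<odot> x = \<zero>"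
  using complex_module_uminus[OF module_A, of x] neg_right[of x] by simp

lemma anorm_zero: "anorm A \<zero> = 0"
  by (simp add: anorm_eq_0)

lemma anorm_nonneg: "x \<in> carrier A \<Longrightarrow> 0 \<le> anorm A x"
  using anorm_triangle[of x "(-1) \<odot> x"] by (simp add: add_cancel_neg anorm_zero anorm_smult)

lemma anorm_diff: "\<lbrakk>x \<in> carrier A; y \<in> carrier A\<rbrakk> \<Longrightarrow> anorm A (x \<ominus> y) \<le> anorm A x + anorm A y"
  using anorm_triangle[of x "(-1) \<odot> y"] by (simp add: minus_conv anorm_smult)

lemma anorm_minus_commute:
  assumes "x \<in> carrier A" "y \<in> carrier A"
  shows "anorm A (x \<ominus> y) = anorm A (y \<ominus> x)"
proof -
  have "(-1) \<odot> (x \<ominus> y) = y \<ominus> x"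
    using assms by (simp add: minus_conv smult_r_distr smult_assoc1[symmetric] plus_comm)
  then show ?thesis using anorm_smult[of "x \<ominus> y" "-1"] assms by simp
qed

lemma diff_add_diff:
  assumes "x \<in> carrier A" "y \<in> carrier A" "z \<in> carrier A"
  shows "(x \<ominus> y) \<oplus> (y \<ominus> z) = x \<ominus> z"
  using assms by (simp add: a_minus_def plus_ac neg_right1 neg_right2)

lemma metric_A: "Metric_space (carrier A) (adist A)"
proof
  fix x y z
  show "0 \<le> adist A x y" by (simp add: adist_def anorm_nonneg)
  show "adist A x y = adist A y x" by (simp add: adist_def anorm_minus_commute)
  assume x: "x \<in> carrier A" and y: "y \<in> carrier A"
  have "x = y" if "x \<ominus> y = \<zero>"
  proof -
    have "x = (x \<ominus> y) \<oplus> y" using x y by (simp add: a_minus_def plus_assoc neg_left)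
    then show ?thesis using that y by simp
  qed
  moreover have "x \<ominus> x = \<zero>" using x by (simp add: minus_conv add_cancel_neg)
  ultimately show "adist A x y = 0 \<longleftrightarrow> x = y"
    using x y by (auto simp: adist_def anorm_eq_0)
  assume z: "z \<in> carrier A"
  show "adist A x z \<le> adist A x y + adist A y z"
    using anorm_triangle[of "x \<ominus> y" "y \<ominus> z"] x y z by (simp add: adist_def diff_add_diff)
qed

text \<open>Cancel a factor in \<open>\<parallel>y\<parallel>\<^sup>2 = \<parallel>y\<^sup>*
  y\<parallel> \<le> \<parallel>y\<^sup>*\<parallel> \<parallel>y\<parallel>\<close>, and use the
  result for \<open>x\<close> and for its adjoint.\<close>

lemma anorm_adj:
  assumes x: "x \<in> carrier A"
  shows "anorm A (adj A x) = anorm A x"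
proof -
  have le: "anorm A y \<le> anorm A (adj A y)" if y: "y \<in> carrier A" for y
  proof (cases "anorm A y = 0")
    case True
    then show ?thesis using anorm_nonneg[OF adj_closed[OF y]] by simp
  next
    case False
    then have pos: "anorm A y > 0" using anorm_nonneg[OF y] by simp
    have "anorm A y * anorm A y \<le> anorm A (adj A y) * anorm A y"
      using cstar_identity[OF y] anorm_mult[OF adj_closed[OF y] y] by (simp add: power2_eq_square)
    then show ?thesis using pos by (rule mult_right_le_imp_le)
  qed
  show ?thesis using le[OF x] le[OF adj_closed[OF x]] adj_adj[OF x] by simp
qed

lemma adj_diff: "\<lbrakk>x \<in> carrier A; y \<in> carrier A\<rbrakk> \<Longrightarrow> adj A (x \<ominus> y) = adj A x \<ominus> adj A y"
  by (simp add: minus_conv adj_add adj_smult adj_closed)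

lemma adj_unit: "adj A \<one> = \<one>"
proof -
  have "adj A (adj A \<one> \<otimes> \<one>) = adj A \<one> \<otimes> adj A (adj A \<one>)"
    by (rule adj_mult) (simp_all add: adj_closed)
  then show ?thesis by (simp add: adj_adj adj_closed mult_unit_right)
qed

text \<open>With \<open>z = (x + z\<^sup>2) / 2\<close>, found by Banach's fixed point theorem, \<open>(1 - z)\<^sup>2 = 1 - x\<close>.\<close>

lemma sqrt_one_minus:
  assumes x: "x \<in> carrier A" and sa: "adj A x = x" and small: "anorm A x < 1"
  obtains y where "y \<in> carrier A" "adj A y \<otimes> y = \<one> \<oplus> (-1) \<odot> x"
proof -
  interpret Met: Metric_space "carrier A" "adist A" by (rule metric_A)
  define r where "r = anorm A x"
  have r: "0 \<le> r" "r < 1" using anorm_nonneg[OF x] small by (simp_all add: r_def)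
  \<comment> \<open>On this ball the map keeps the bound, as
    \<open>(r + r\<^sup>2) / 2 \<le> r\<close>, and contracts by the factor \<open>r\<close>.
    Self-adjointness of the fixed point makes \<open>adj A y \<otimes> y\<close> the square of
    \<open>y\<close>.\<close>
  define D where "D = {z \<in> carrier A. adj A z = z \<and> anorm A z \<le> r}"
  define T where "T z = (1/2) \<odot> (x \<oplus> z \<otimes> z)" for z
  interpret Sub: Submetric "carrier A" "adist A" D
    by unfold_locales (auto simp: D_def)
  have Tc: "T z \<in> carrier A" if "z \<in> carrier A" for z using that x by (simp add: T_def)
  have TD: "T z \<in> D" if z: "z \<in> D" for z
  proof -
    have zc: "z \<in> carrier A" and zs: "adj A z = z" and zn: "anorm A z \<le> r" using z by (auto simp: D_def)
    have "adj A (T z) = T z"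
      using x zc sa zs by (simp add: T_def adj_smult adj_add adj_mult)
    moreover have "anorm A (T z) \<le> r"
    proof -
      have "anorm A (T z) \<le> (anorm A x + anorm A z * anorm A z) / 2"
        using anorm_triangle[of x "z \<otimes> z"] anorm_mult[OF zc zc] x zc
        by (simp add: T_def anorm_smult norm_divide)
      also have "anorm A z * anorm A z \<le> r * 1"
        using zn r anorm_nonneg[OF zc] by (intro mult_mono) auto
      finally show ?thesis by (simp add: r_def)
    qed
    ultimately show ?thesis using Tc[OF zc] by (simp add: D_def)
  qed
  have contr: "adist A (T z) (T w) \<le> r * adist A z w" if z: "z \<in> D" and w: "w \<in> D" for z w
  proof -
    have zc: "z \<in> carrier A" and zn: "anorm A z \<le> r" and wc: "w \<in> carrier A" and wn: "anorm A w \<le> r"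
      using z w by (auto simp: D_def)
    let ?d = "z \<ominus> w"
    have dc: "?d \<in> carrier A" using zc wc by simp
    \<comment> \<open>A factorisation of \<open>z\<^sup>2 - w\<^sup>2\<close> that does not assume
      that \<open>z\<close> and \<open>w\<close> commute.\<close>
    have "z \<otimes> ?d \<oplus> ?d \<otimes> w = (z \<otimes> z \<oplus> (-1) \<odot> (z \<otimes> w)) \<oplus> (z \<otimes> w \<oplus> (-1) \<odot> (w \<otimes> w))"
      using zc wc by (simp add: minus_conv distrib_l distrib_r smult_mult_left smult_mult_right)
    also have "\<dots> = z \<otimes> z \<oplus> ((z \<otimes> w \<oplus> (-1) \<odot> (z \<otimes> w)) \<oplus> (-1) \<odot> (w \<otimes> w))"
      using zc wc by (simp add: plus_ac)
    also have "\<dots> = z \<otimes> z \<oplus> (-1) \<odot> (w \<otimes> w)" using zc wc by (simp add: add_cancel_neg)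
    finally have zw: "z \<otimes> ?d \<oplus> ?d \<otimes> w = z \<otimes> z \<oplus> (-1) \<odot> (w \<otimes> w)" .
    have "T z \<ominus> T w = (1/2) \<odot> ((x \<oplus> z \<otimes> z) \<oplus> (-1) \<odot> (x \<oplus> w \<otimes> w))"
      using x zc wc by (simp add: T_def minus_conv smult_r_distr smult_assoc1[symmetric])
    also have "(x \<oplus> z \<otimes> z) \<oplus> (-1) \<odot> (x \<oplus> w \<otimes> w) = (x \<oplus> (-1) \<odot> x) \<oplus> (z \<otimes> z \<oplus> (-1) \<odot> (w \<otimes> w))"
      using x zc wc by (simp add: smult_r_distr plus_ac)
    also have "\<dots> = z \<otimes> ?d \<oplus> ?d \<otimes> w" using x zc wc by (simp add: add_cancel_neg zw)
    finally have "anorm A (T z \<ominus> T w) = anorm A (z \<otimes> ?d \<oplus> ?d \<otimes> w) / 2"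
      using zc wc dc by (simp add: anorm_smult norm_divide)
    also have "\<dots> \<le> (anorm A z * anorm A ?d + anorm A ?d * anorm A w) / 2"
      using anorm_triangle[of "z \<otimes> ?d" "?d \<otimes> w"] anorm_mult[OF zc dc] anorm_mult[OF dc wc] zc wc dc by simp
    also have "\<dots> \<le> (r * anorm A ?d + anorm A ?d * r) / 2"
      using zn wn anorm_nonneg[OF dc] by (intro divide_right_mono add_mono mult_right_mono mult_left_mono) auto
    finally show ?thesis using zc wc Tc[OF zc] Tc[OF wc] by (simp add: adist_def mult.commute)
  qed
  \<comment> \<open>Banach's theorem is applied in \<open>D\<close>, which inherits completeness
    because the norm bound and self-adjointness pass to limits.\<close>
  have comp: "Sub.sub.mcomplete"
  proof (rule Sub.sequentially_closedin_mcomplete_imp_mcomplete[OF complete])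
    fix \<sigma> :: "nat \<Rightarrow> 'a" and l
    assume "range \<sigma> \<subseteq> D \<and> limitin Met.mtopology \<sigma> l sequentially"
    then have \<sigma>: "\<And>n. \<sigma> n \<in> D" and l: "l \<in> carrier A"
      and lim: "\<And>e. e > 0 \<Longrightarrow> \<exists>n. adist A (\<sigma> n) l < e"
      unfolding Met.limit_metric_sequentially by blast+
    have close: "\<exists>z\<in>D. anorm A (z \<ominus> l) < e" if e: "e > 0" for e
    proof -
      obtain n where n: "adist A (\<sigma> n) l < e" using lim[OF e] by blast
      have "\<sigma> n \<in> carrier A" using \<sigma>[of n] by (simp add: D_def)
      then show ?thesis using n l \<sigma>[of n] by (auto simp: adist_def)
    qed
    have "anorm A l \<le> r"
    proof (rule field_le_epsilon)
      fix e :: real assume "e > 0"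
      then obtain z where z: "z \<in> D" "anorm A (z \<ominus> l) < e" using close by blast
      then have zc: "z \<in> carrier A" and zn: "anorm A z \<le> r" by (auto simp: D_def)
      have "l = z \<ominus> (z \<ominus> l)"
        using zc l by (simp add: minus_conv smult_r_distr smult_assoc1[symmetric] plus_assoc[symmetric] add_cancel_neg)
      then have "anorm A l \<le> anorm A z + anorm A (z \<ominus> l)" using anorm_diff[of z "z \<ominus> l"] zc l by simp
      then show "anorm A l \<le> r + e" using z zn by linarith
    qed
    moreover have "adj A l = l"
    proof -
      have "adist A (adj A l) l \<le> 0 + e" if e: "e > 0" for e
      proof -
        obtain z where z: "z \<in> D" "anorm A (z \<ominus> l) < e / 2" using close[of "e / 2"] e by auto
        then have zc: "z \<in> carrier A" and zs: "adj A z = z" by (auto simp: D_def)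
        have "adist A (adj A l) l \<le> adist A (adj A l) z + adist A z l"
          using zc l by (intro Met.triangle adj_closed) auto
        also have "adist A (adj A l) z = adist A l z"
          using adj_diff[OF l zc] anorm_adj[of "l \<ominus> z"] zc l zs by (simp add: adist_def adj_closed)
        also have "adist A l z = adist A z l" by (rule Met.commute)
        finally show ?thesis using z zc l by (simp add: adist_def)
      qed
      then have "adist A (adj A l) l \<le> 0" by (rule field_le_epsilon)
      then have "adist A (adj A l) l = 0" using Met.nonneg[of "adj A l" l] by linarith
      then show ?thesis using l adj_closed[OF l] by simp
    qed
    ultimately show "l \<in> D" using l by (simp add: D_def)
  qed
  have "\<zero> \<in> D"
  proof -
    have "adj A \<zero> = \<zero>" using adj_smult[of \<zero> 0] adj_closed[of \<zero>] smult_l_null[of "adj A \<zero>"] by simp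
    then show ?thesis using r by (simp add: D_def anorm_zero)
  qed
  then have "D \<noteq> {}" by auto
  then obtain z where z: "z \<in> D" "T z = z"
    using Sub.sub.Banach_fixedpoint_thm[OF comp _ _ r(2), of T] TD contr by blast
  have zc: "z \<in> carrier A" and zs: "adj A z = z" using z by (auto simp: D_def)
  define y where "y = \<one> \<oplus> (-1) \<odot> z"
  have yc: "y \<in> carrier A" using zc by (simp add: y_def)
  have "adj A y = y" using zc zs by (simp add: y_def adj_add adj_smult adj_unit)
  moreover have "y \<otimes> y = \<one> \<oplus> (-1) \<odot> x"
  proof -
    have "z \<oplus> z = (1/2 + 1/2) \<odot> (x \<oplus> z \<otimes> z)"
      using z(2) x zc smult_l_distr[of "1/2" "1/2" "x \<oplus> z \<otimes> z"] by (simp add: T_def)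
    then have zz: "z \<oplus> z = x \<oplus> z \<otimes> z" using x zc smult_one[of "x \<oplus> z \<otimes> z"] by simp
    have "y \<otimes> y = (\<one> \<oplus> (-1) \<odot> z) \<oplus> ((-1) \<odot> z \<oplus> z \<otimes> z)"
      using zc by (simp add: y_def distrib_l distrib_r smult_mult_left smult_mult_right
        mult_unit_left mult_unit_right smult_assoc1[symmetric] smult_r_distr plus_ac)
    also have "\<dots> = \<one> \<oplus> ((-1) \<odot> (z \<oplus> z) \<oplus> z \<otimes> z)"
      using zc by (simp add: smult_r_distr plus_ac)
    also have "(-1) \<odot> (z \<oplus> z) \<oplus> z \<otimes> z = (-1) \<odot> x \<oplus> (z \<otimes> z \<oplus> (-1) \<odot> (z \<otimes> z))"
      using x zc unfolding zz by (simp add: smult_r_distr plus_ac)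
    also have "\<dots> = (-1) \<odot> x" using x zc by (simp add: add_cancel_neg)
    finally show ?thesis .
  qed
  ultimately show thesis using that[OF yc] by simp
qed

lemma positive_matrix_one_minus:
  assumes "x \<in> carrier A" "adj A x = x" "anorm A x < 1"
  shows "positive_matrix A 1 (\<lambda>i j. \<one> \<oplus> (-1) \<odot> x)"
proof -
  obtain y where y: "y \<in> carrier A" "adj A y \<otimes> y = \<one> \<oplus> (-1) \<odot> x"
    using sqrt_one_minus[OF assms] by blast
  have "(\<Oplus>k\<in>{..<1::nat}. adj A y \<otimes> y) = adj A y \<otimes> y"
  proof -
    have "{..<1::nat} = {0}" by auto
    then show ?thesis using y(1) adj_closed[OF y(1)] by simp
  qed
  then show ?thesis
    using y unfolding positive_matrix_def by (intro exI[of _ "\<lambda>i j. y"]) simp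
qed

lemma self_adjoint_decomposition:
  assumes x: "x \<in> carrier A"
  obtains a b where "a \<in> carrier A" "b \<in> carrier A" "adj A a = a" "adj A b = b"
    "anorm A a \<le> anorm A x" "anorm A b \<le> anorm A x" "x = a \<oplus> \<i> \<odot> b"
proof -
  let ?s = "adj A x"
  have s: "?s \<in> carrier A" by (rule adj_closed[OF x])
  define a where "a = (1/2) \<odot> (x \<oplus> ?s)"
  define b where "b = (- \<i>/2) \<odot> (x \<oplus> (-1) \<odot> ?s)"
  show thesis
  proof
    show "a \<in> carrier A" "b \<in> carrier A" using x s by (simp_all add: a_def b_def)
    show "adj A a = a" using x s by (simp add: a_def adj_smult adj_add adj_adj plus_comm)
    show "adj A b = b"
      using x s by (simp add: b_def adj_smult adj_add adj_adj smult_r_distr smult_assoc1[symmetric] plus_comm)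
    show "anorm A a \<le> anorm A x"
      using anorm_triangle[OF x s] x s by (simp add: a_def anorm_smult norm_divide anorm_adj)
    show "anorm A b \<le> anorm A x"
      using anorm_triangle[of x "(-1) \<odot> ?s"] x s by (simp add: b_def anorm_smult norm_divide anorm_adj)
    have "\<i> \<odot> b = (1/2) \<odot> x \<oplus> (-1/2) \<odot> ?s"
      using x s by (simp add: b_def smult_r_distr smult_assoc1[symmetric])
    then have "a \<oplus> \<i> \<odot> b = ((1/2) \<odot> x \<oplus> (1/2) \<odot> ?s) \<oplus> ((1/2) \<odot> x \<oplus> (-1/2) \<odot> ?s)"
      using x s by (simp add: a_def smult_r_distr)
    also have "\<dots> = ((1/2) \<odot> x \<oplus> (1/2) \<odot> x) \<oplus> ((1/2) \<odot> ?s \<oplus> (-1/2) \<odot> ?s)"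
      using x s by (simp add: plus_ac)
    also have "(1/2) \<odot> x \<oplus> (1/2) \<odot> x = x"
      using x smult_l_distr[of "1/2" "1/2" x] smult_one[of x] by simp
    also have "(1/2) \<odot> ?s \<oplus> (-1/2) \<odot> ?s = \<zero>"
      using s smult_l_distr[of "1/2" "-1/2" ?s] smult_l_null[of ?s] by simp
    finally show "x = a \<oplus> \<i> \<odot> b" using x by simp
  qed
qed

end

section \<open>Continuity of coefficients under unital completely positive maps\<close>

context group_algebra_norm
begin

text \<open>For self-adjoint \<open>y\<close> of norm below 1, \<open>1 - y\<close> and
  \<open>1 + y\<close> are squares, so \<open>coeff_bound\<close> applies to their images. It places
  the coefficient of \<open>\<phi> y\<close> within 2 of 0 or 1, hence within 3 of 0. Scaling by
  \<open>e\<close> and adding real and imaginary parts gives the factor 6.\<close>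

lemma ucp_coeff_bound:
  assumes A: "unital_cstar_algebra A" and \<phi>: "ucp A B \<phi>" and x: "x \<in> carrier A"
    and e: "anorm A x < e" and g: "g \<in> carrier G"
  shows "cmod (coeff (\<phi> x) g) \<le> 6 * e"
proof -
  interpret A: unital_cstar_algebra A by fact
  have \<phi>c: "\<And>x. x \<in> carrier A \<Longrightarrow> \<phi> x \<in> carrier B"
    and \<phi>add: "\<And>x y. \<lbrakk>x \<in> carrier A; y \<in> carrier A\<rbrakk> \<Longrightarrow> \<phi> (x \<oplus>\<^bsub>A\<^esub> y) = \<phi> x \<oplus>\<^bsub>B\<^esub> \<phi> y"
    and \<phi>smult: "\<And>a x. x \<in> carrier A \<Longrightarrow> \<phi> (a \<odot>\<^bsub>A\<^esub> x) = a \<odot>\<^bsub>B\<^esub> \<phi> x"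
    and \<phi>one: "\<phi> \<one>\<^bsub>A\<^esub> = \<one>\<^bsub>B\<^esub>"
    and \<phi>pos: "\<And>n M. positive_matrix A n M \<Longrightarrow> positive_matrix B n (\<lambda>i j. \<phi> (M i j))"
    using \<phi> unfolding ucp_def complex_linear_map_def by auto
  have e0: "e > 0" using e A.anorm_nonneg[OF x] by linarith
  have cs: "coeff (\<phi> (a \<odot>\<^bsub>A\<^esub> y)) g = a * coeff (\<phi> y) g" if "y \<in> carrier A" for a y g
    using that by (simp add: \<phi>smult coeff_smult \<phi>c)
  have one: "cmod (coeff (\<phi> y) g) \<le> 3" if y: "y \<in> carrier A" "adj A y = y" "anorm A y < 1" for y
  proof -
    have c1: "coeff (\<phi> (\<one>\<^bsub>A\<^esub> \<oplus>\<^bsub>A\<^esub> (-1) \<odot>\<^bsub>A\<^esub> y)) h = (if h = \<one>\<^bsub>G\<^esub> then 1 else 0) - coeff (\<phi> y) h"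
      if "y \<in> carrier A" for y h
      using that by (simp add: \<phi>add \<phi>smult coeff_add coeff_smult \<phi>c B_smult_closed \<phi>one coeff_one
          \<phi>c[OF A.unit_closed, unfolded \<phi>one])
    have b: "cmod ((if h = \<one>\<^bsub>G\<^esub> then 1 else 0) - coeff (\<phi> y) h) \<le> 1 - Re (coeff (\<phi> y) \<one>\<^bsub>G\<^esub>)"
      if y: "y \<in> carrier A" "adj A y = y" "anorm A y < 1" and h: "h \<in> carrier G" for y h
      using coeff_bound[OF \<phi>pos[OF A.positive_matrix_one_minus[OF y]] h] c1[OF y(1)] by simp
    \<comment> \<open>Used for \<open>- y\<close>, the estimate bounds the real part at the identity
      from below by \<open>-1\<close>, which makes the right side of \<open>b\<close> at most
      2.\<close>
    have y': "(-1) \<odot>\<^bsub>A\<^esub> y \<in> carrier A" "adj A ((-1) \<odot>\<^bsub>A\<^esub> y) = (-1) \<odot>\<^bsub>A\<^esub> y" "anorm A ((-1) \<odot>\<^bsub>A\<^esub> y) < 1"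
      using y by (simp_all add: A.adj_smult A.anorm_smult)
    have "0 \<le> 1 - Re (coeff (\<phi> ((-1) \<odot>\<^bsub>A\<^esub> y)) \<one>\<^bsub>G\<^esub>)"
      using b[OF y' G.one_closed] norm_ge_zero order_trans by blast
    then have re: "- 1 \<le> Re (coeff (\<phi> y) \<one>\<^bsub>G\<^esub>)" using cs[OF y(1), of "-1"] by simp
    have "cmod (coeff (\<phi> y) g) \<le> cmod (if g = \<one>\<^bsub>G\<^esub> then 1 else 0) +
        cmod ((if g = \<one>\<^bsub>G\<^esub> then 1 else 0) - coeff (\<phi> y) g)"
      using norm_triangle_ineq4[of "if g = \<one>\<^bsub>G\<^esub> then 1 else 0" "(if g = \<one>\<^bsub>G\<^esub> then 1 else 0) - coeff (\<phi> y) g"] by simp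
    also have "\<dots> \<le> 1 + (1 - Re (coeff (\<phi> y) \<one>\<^bsub>G\<^esub>))" using b[OF y g] by (intro add_mono) auto
    finally show ?thesis using re by linarith
  qed
  have sa: "cmod (coeff (\<phi> y) g) \<le> 3 * e" if y: "y \<in> carrier A" "adj A y = y" "anorm A y < e" for y
  proof -
    let ?y = "of_real (1 / e) \<odot>\<^bsub>A\<^esub> y"
    have "?y \<in> carrier A" "adj A ?y = ?y" using y by (simp_all add: A.adj_smult)
    moreover have "anorm A ?y < 1"
    proof -
      have "anorm A ?y = anorm A y / e" using y e0 by (simp add: A.anorm_smult norm_divide)
      then show ?thesis using y e0 by simp
    qed
    ultimately have "cmod (coeff (\<phi> ?y) g) \<le> 3" by (rule one)
    then have "cmod (coeff (\<phi> y) g) / e \<le> 3" using cs[OF y(1), of "of_real (1 / e)" g] e0 by (simp add: norm_mult norm_divide)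
    then show ?thesis using e0 by (simp add: pos_divide_le_eq)
  qed
  obtain a b where ab: "a \<in> carrier A" "b \<in> carrier A" "adj A a = a" "adj A b = b"
    "anorm A a \<le> anorm A x" "anorm A b \<le> anorm A x" and xab: "x = a \<oplus>\<^bsub>A\<^esub> \<i> \<odot>\<^bsub>A\<^esub> b"
    by (rule A.self_adjoint_decomposition[OF x])
  have "coeff (\<phi> x) g = coeff (\<phi> a) g + \<i> * coeff (\<phi> b) g"
    unfolding xab using ab by (simp add: \<phi>add \<phi>smult coeff_add coeff_smult \<phi>c B_smult_closed)
  also have "cmod \<dots> \<le> cmod (coeff (\<phi> a) g) + cmod (\<i> * coeff (\<phi> b) g)" by (rule norm_triangle_ineq)
  also have "\<dots> \<le> 3 * e + 3 * e"
    using sa[of a] sa[of b] ab e by (intro add_mono) (auto simp: norm_mult)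
  finally show ?thesis by simp
qed

end

section \<open>The main argument\<close>

text \<open>The unitaries at \<open>q(h\<^sub>i)\<^sup>-\<^sup>1 q(h\<^sub>j)\<close> form a
  positive matrix and so do their images under \<open>\<Phi>\<close>; \<open>coeff_positive\<close>
  reads these off at \<open>p(h\<^sub>i)\<^sup>-\<^sup>1 p(h\<^sub>j)\<close>. Both differences come
  from the same elements of \<open>G\<close>, which is what couples the two quotients.\<close>

lemma pullback_normalized_pd:
  assumes G: "group G" and N1: "group_algebra_norm G1 N1" and N2: "group_algebra_norm G2 N2"
    and p: "p \<in> hom G G1" and q: "q \<in> hom G G2"
    and \<Phi>one: "\<Phi> \<one>\<^bsub>completion (group_algebra G2 N2)\<^esub> = \<one>\<^bsub>completion (group_algebra G1 N1)\<^esub>"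
    and \<Phi>pos: "\<And>n M. positive_matrix (completion (group_algebra G2 N2)) n M \<Longrightarrow>
      positive_matrix (completion (group_algebra G1 N1)) n (\<lambda>i j. \<Phi> (M i j))"
  shows "(\<lambda>x. if x \<in> carrier G
    then group_algebra_norm.coeff (\<Phi> (group_algebra_norm.unit_of G2 N2 (q x))) (p x) else 0) \<in> normalized_pd G"
    (is "?f \<in> _")
proof -
  interpret G: group G by fact
  interpret X: group_algebra_norm G1 N1 by fact
  interpret Y: group_algebra_norm G2 N2 by fact
  interpret p: group_hom G G1 p using p by unfold_locales
  interpret q: group_hom G G2 q using q by unfold_locales
  have f: "?f (inv\<^bsub>G\<^esub> (h i) \<otimes>\<^bsub>G\<^esub> h j) =
      X.coeff (\<Phi> (Y.unit_of (inv\<^bsub>G2\<^esub> (q (h i)) \<otimes>\<^bsub>G2\<^esub> q (h j)))) (inv\<^bsub>G1\<^esub> (p (h i)) \<otimes>\<^bsub>G1\<^esub> p (h j))"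
    if "h i \<in> carrier G" "h j \<in> carrier G" for h :: "nat \<Rightarrow> 'a" and i j
    using that by simp
  have pos: "positive_matrix X.B n (\<lambda>i j. \<Phi> (Y.unit_of (inv\<^bsub>G2\<^esub> (q (h i)) \<otimes>\<^bsub>G2\<^esub> q (h j))))"
    if "\<And>i. i < n \<Longrightarrow> h i \<in> carrier G" for n and h :: "nat \<Rightarrow> 'a"
    using that by (intro \<Phi>pos Y.positive_matrix_unit_of) simp
  have "positive_definite G ?f"
    unfolding positive_definite_def
  proof (intro conjI ballI allI impI)
    fix x assume x: "x \<in> carrier G"
    \<comment> \<open>Hermitian symmetry is read off the 2 by 2 matrix for the points
      \<open>1\<close> and \<open>x\<close>, whose off-diagonal entries belong to \<open>x\<close>
      and its inverse.\<close>
    define h where "h i = (if i = (0::nat) then \<one>\<^bsub>G\<^esub> else x)" for i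
    have h: "h i \<in> carrier G" for i using x by (simp add: h_def)
    have "?f (inv\<^bsub>G\<^esub> (h 1) \<otimes>\<^bsub>G\<^esub> h 0) = cnj (?f (inv\<^bsub>G\<^esub> (h 0) \<otimes>\<^bsub>G\<^esub> h 1))"
    proof -
      have "X.coeff (\<Phi> (Y.unit_of (inv\<^bsub>G2\<^esub> (q (h 1)) \<otimes>\<^bsub>G2\<^esub> q (h 0)))) (inv\<^bsub>G1\<^esub> (inv\<^bsub>G1\<^esub> (p (h 0)) \<otimes>\<^bsub>G1\<^esub> p (h 1)))
        = cnj (X.coeff (\<Phi> (Y.unit_of (inv\<^bsub>G2\<^esub> (q (h 0)) \<otimes>\<^bsub>G2\<^esub> q (h 1)))) (inv\<^bsub>G1\<^esub> (p (h 0)) \<otimes>\<^bsub>G1\<^esub> p (h 1)))"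
        using X.coeff_hermitian[OF pos[of 2 h], of 0 1 "inv\<^bsub>G1\<^esub> (p (h 0)) \<otimes>\<^bsub>G1\<^esub> p (h 1)"] h by simp
      moreover have "inv\<^bsub>G1\<^esub> (inv\<^bsub>G1\<^esub> (p (h 0)) \<otimes>\<^bsub>G1\<^esub> p (h 1)) = inv\<^bsub>G1\<^esub> (p (h 1)) \<otimes>\<^bsub>G1\<^esub> p (h 0)"
        using h by (simp add: X.G.inv_mult_group)
      ultimately show ?thesis using h by simp
    qed
    then show "?f (inv\<^bsub>G\<^esub> x) = cnj (?f x)" using x by (simp add: h_def)
  next
    fix F and c :: "'a \<Rightarrow> complex" assume F: "finite F" "F \<subseteq> carrier G"
    \<comment> \<open>Matrices are indexed by numbers, hence this enumeration. The sums are then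
      exchanged because \<open>coeff_positive\<close> conjugates the row index.\<close>
    obtain h where h: "bij_betw h {..<card F} F"
      using F(1) by (metis bij_betw_from_nat_into_finite)
    have hF: "h i \<in> carrier G" if "i < card F" for i
      using h F(2) that by (auto simp: bij_betw_def)
    have "(\<Sum>x\<in>F. \<Sum>y\<in>F. c x * cnj (c y) * ?f (inv\<^bsub>G\<^esub> y \<otimes>\<^bsub>G\<^esub> x)) =
        (\<Sum>y\<in>F. \<Sum>x\<in>F. c x * cnj (c y) * ?f (inv\<^bsub>G\<^esub> y \<otimes>\<^bsub>G\<^esub> x))" by (rule sum.swap)
    also have "\<dots> = (\<Sum>i<card F. \<Sum>j<card F. c (h j) * cnj (c (h i)) * ?f (inv\<^bsub>G\<^esub> (h i) \<otimes>\<^bsub>G\<^esub> h j))"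
      by (simp only: sum.reindex_bij_betw[OF h, symmetric])
    also have "\<dots> = (\<Sum>i<card F. \<Sum>j<card F. cnj (c (h i)) * c (h j) *
        X.coeff (\<Phi> (Y.unit_of (inv\<^bsub>G2\<^esub> (q (h i)) \<otimes>\<^bsub>G2\<^esub> q (h j)))) (inv\<^bsub>G1\<^esub> (p (h i)) \<otimes>\<^bsub>G1\<^esub> p (h j)))"
    proof (intro sum.cong refl)
      fix i j assume "i \<in> {..<card F}" "j \<in> {..<card F}"
      then show "c (h j) * cnj (c (h i)) * ?f (inv\<^bsub>G\<^esub> (h i) \<otimes>\<^bsub>G\<^esub> h j) = cnj (c (h i)) * c (h j) *
        X.coeff (\<Phi> (Y.unit_of (inv\<^bsub>G2\<^esub> (q (h i)) \<otimes>\<^bsub>G2\<^esub> q (h j)))) (inv\<^bsub>G1\<^esub> (p (h i)) \<otimes>\<^bsub>G1\<^esub> p (h j))"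
        using f[of h i j] hF by (simp only: lessThan_iff mult.commute)
    qed
    finally have eq: "(\<Sum>x\<in>F. \<Sum>y\<in>F. c x * cnj (c y) * ?f (inv\<^bsub>G\<^esub> y \<otimes>\<^bsub>G\<^esub> x)) = \<dots>" .
    show "0 \<le> Re (\<Sum>x\<in>F. \<Sum>y\<in>F. c x * cnj (c y) * ?f (inv\<^bsub>G\<^esub> y \<otimes>\<^bsub>G\<^esub> x))"
      unfolding eq by (rule X.coeff_positive[OF pos]) (use hF in auto)
  qed
  moreover have "?f \<one>\<^bsub>G\<^esub> = 1"
    using \<Phi>one by (simp add: Y.unit_of_one X.coeff_one)
  ultimately show ?thesis by (simp add: normalized_pd_def)
qed

text \<open>On the kernel of \<open>q\<close> the function of positive type \<open>f\<close> is the indicator of the kernel of \<open>p\<close>, while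
  closeness on \<open>Q\<close> and Kazhdan's inequality make its real part positive everywhere.\<close>

lemma kernel_subset:
  fixes A :: "'a normed_star_algebra"
  assumes G: "group G" and N1: "group_algebra_norm G1 N1" and N2: "group_algebra_norm G2 N2"
    and p: "p \<in> hom G G1" and q: "q \<in> hom G G2" and A: "unital_cstar_algebra A"
    and \<psi>1: "ucp (completion (group_algebra G1 N1)) A \<psi>1" and \<phi>1: "ucp A (completion (group_algebra G1 N1)) \<phi>1"
    and id1: "\<And>b. b \<in> carrier (completion (group_algebra G1 N1)) \<Longrightarrow> \<phi>1 (\<psi>1 b) = b"
    and \<psi>2: "ucp (completion (group_algebra G2 N2)) A \<psi>2"
    and Q: "finite Q" "Q \<subseteq> carrier G" "0 \<le> C"
    and kazhdan: "\<And>\<phi> h. \<lbrakk>\<phi> \<in> normalized_pd G; h \<in> carrier G\<rbrakk> \<Longrightarrow> 1 - Re (\<phi> h) \<le> C * (\<Sum>s\<in>Q. 1 - Re (\<phi> s))"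
    and close: "\<And>s. s \<in> Q \<Longrightarrow> adist A (\<psi>1 (group_algebra_norm.unit_of G1 N1 (p s)))
      (\<psi>2 (group_algebra_norm.unit_of G2 N2 (q s))) < e"
    and e: "C * (6 * e * card Q) < 1"
    and h: "h \<in> carrier G" "q h = \<one>\<^bsub>G2\<^esub>"
  shows "p h = \<one>\<^bsub>G1\<^esub>"
proof -
  interpret G: group G by fact
  interpret X: group_algebra_norm G1 N1 by fact
  interpret Y: group_algebra_norm G2 N2 by fact
  interpret A: unital_cstar_algebra A by fact
  interpret p: group_hom G G1 p using p by unfold_locales
  interpret q: group_hom G G2 q using q by unfold_locales
  define f where "f x = (if x \<in> carrier G then X.coeff (\<phi>1 (\<psi>2 (Y.unit_of (q x)))) (p x) else 0)" for x
  have "f \<in> normalized_pd G"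
    unfolding f_def[abs_def]
  proof (rule pullback_normalized_pd[OF G N1 N2 p q, where \<Phi> = "\<lambda>b. \<phi>1 (\<psi>2 b)"])
    show "\<phi>1 (\<psi>2 \<one>\<^bsub>Y.B\<^esub>) = \<one>\<^bsub>X.B\<^esub>" using \<phi>1 \<psi>2 by (simp add: ucp_def)
    show "positive_matrix X.B n (\<lambda>i j. \<phi>1 (\<psi>2 (M i j)))" if "positive_matrix Y.B n M" for n M
    proof -
      have "positive_matrix A n (\<lambda>i j. \<psi>2 (M i j))" using \<psi>2 that unfolding ucp_def by blast
      then show ?thesis using \<phi>1 unfolding ucp_def by blast
    qed
  qed
  then have le: "1 - Re (f h) \<le> C * (\<Sum>s\<in>Q. 1 - Re (f s))" using h by (intro kazhdan)
  \<comment> \<open>As \<open>\<phi>1\<close> maps \<open>?x\<close> back to the unitary at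
    \<open>p s\<close>, whose coefficient there is 1, the number \<open>1 - f s\<close> is a
    coefficient of the image of the small element \<open>?x - ?y\<close>.\<close>
  have "1 - Re (f s) \<le> 6 * e" if s: "s \<in> Q" for s
  proof -
    have sG: "s \<in> carrier G" using s Q by auto
    let ?x = "\<psi>1 (X.unit_of (p s))" and ?y = "\<psi>2 (Y.unit_of (q s))"
    have uX: "X.unit_of (p s) \<in> carrier X.B" and uY: "Y.unit_of (q s) \<in> carrier Y.B"
      using sG by (simp_all add: X.unit_of_closed Y.unit_of_closed)
    have x: "?x \<in> carrier A" and y: "?y \<in> carrier A"
      using \<psi>1 \<psi>2 uX uY unfolding ucp_def complex_linear_map_def by auto
    have \<phi>c: "\<And>x. x \<in> carrier A \<Longrightarrow> \<phi>1 x \<in> carrier X.B"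
      and \<phi>add: "\<And>x y. \<lbrakk>x \<in> carrier A; y \<in> carrier A\<rbrakk> \<Longrightarrow> \<phi>1 (x \<oplus>\<^bsub>A\<^esub> y) = \<phi>1 x \<oplus>\<^bsub>X.B\<^esub> \<phi>1 y"
      and \<phi>smult: "\<And>a x. x \<in> carrier A \<Longrightarrow> \<phi>1 (a \<odot>\<^bsub>A\<^esub> x) = a \<odot>\<^bsub>X.B\<^esub> \<phi>1 x"
      using \<phi>1 unfolding ucp_def complex_linear_map_def by auto
    have "?x \<ominus>\<^bsub>A\<^esub> ?y \<in> carrier A" using x y by simp
    moreover have "anorm A (?x \<ominus>\<^bsub>A\<^esub> ?y) < e" using close[OF s] x y by (simp add: adist_def)
    moreover have "p s \<in> carrier G1" using sG by simp
    ultimately have "cmod (X.coeff (\<phi>1 (?x \<ominus>\<^bsub>A\<^esub> ?y)) (p s)) \<le> 6 * e"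
      by (rule X.ucp_coeff_bound[OF A \<phi>1])
    also have "X.coeff (\<phi>1 (?x \<ominus>\<^bsub>A\<^esub> ?y)) (p s) = X.coeff (\<phi>1 ?x) (p s) - X.coeff (\<phi>1 ?y) (p s)"
      using x y by (simp add: A.minus_conv \<phi>add \<phi>smult X.coeff_add X.coeff_smult \<phi>c X.B_smult_closed)
    also have "X.coeff (\<phi>1 ?x) (p s) = 1"
      using id1[OF uX] sG by (simp add: X.coeff_unit_of)
    also have "X.coeff (\<phi>1 ?y) (p s) = f s" using sG by (simp add: f_def)
    finally have "cmod (1 - f s) \<le> 6 * e" .
    then show ?thesis using complex_Re_le_cmod[of "1 - f s"] by simp
  qed
  then have "(\<Sum>s\<in>Q. 1 - Re (f s)) \<le> of_nat (card Q) * (6 * e)" by (rule sum_bounded_above)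
  then have "C * (\<Sum>s\<in>Q. 1 - Re (f s)) \<le> C * (of_nat (card Q) * (6 * e))"
    using Q(3) by (rule mult_left_mono)
  then have "1 - Re (f h) < 1" using le e by (simp add: mult_ac)
  moreover have "f h = (if p h = \<one>\<^bsub>G1\<^esub> then 1 else 0)"
  proof -
    have "\<psi>2 (Y.unit_of (q h)) = \<one>\<^bsub>A\<^esub>" using h \<psi>2 by (simp add: Y.unit_of_one ucp_def)
    then have "\<phi>1 (\<psi>2 (Y.unit_of (q h))) = \<one>\<^bsub>X.B\<^esub>" using \<phi>1 by (simp add: ucp_def)
    then show ?thesis using h by (simp add: f_def X.coeff_one)
  qed
  ultimately show ?thesis by (auto split: if_splits)
qed

section \<open>Separability and the choice of two indices\<close>

lemma separable_approximation:
  assumes A: "unital_cstar_algebra A" and sep: "separable_algebra A"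
  obtains D where "countable D" "D \<subseteq> carrier A" "\<And>x e. \<lbrakk>x \<in> carrier A; e > 0\<rbrakk> \<Longrightarrow> \<exists>d\<in>D. adist A x d < e"
proof -
  interpret unital_cstar_algebra A by fact
  interpret Met: Metric_space "carrier A" "adist A" by (rule metric_A)
  obtain D where D: "countable D" "D \<subseteq> carrier A" "Met.mtopology closure_of D = carrier A"
    using sep unfolding separable_algebra_def separable_space_def by auto
  have "\<exists>d\<in>D. adist A x d < e" if x: "x \<in> carrier A" and e: "e > 0" for x e
  proof -
    have "x \<in> Met.mtopology closure_of D" using x D by simp
    then have "\<exists>d\<in>D. d \<in> Met.mball x e"
      using e unfolding Met.metric_closure_of by blast
    then show ?thesis by auto
  qed
  with D show thesis using that by blast
qed

text \<open>Round each \<open>v i s\<close> to a point of a countable dense set at distance below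
  \<open>e / 2\<close>. For finite \<open>Q\<close> only countably many rounded families exist, so
  two distinct indices share one, and the triangle inequality applies.\<close>

lemma uncountable_two_close:
  assumes A: "unital_cstar_algebra A" and sep: "separable_algebra A" and I: "uncountable I"
    and Q: "finite Q" and v: "\<And>i s. \<lbrakk>i \<in> I; s \<in> Q\<rbrakk> \<Longrightarrow> v i s \<in> carrier A" and e: "e > 0"
  shows "\<exists>i\<in>I. \<exists>j\<in>I. i \<noteq> j \<and> (\<forall>s\<in>Q. adist A (v i s) (v j s) < e)"
proof -
  interpret unital_cstar_algebra A by fact
  interpret Met: Metric_space "carrier A" "adist A" by (rule metric_A)
  obtain D where D: "countable D" "D \<subseteq> carrier A"
    and app: "\<And>x e. \<lbrakk>x \<in> carrier A; e > 0\<rbrakk> \<Longrightarrow> \<exists>d\<in>D. adist A x d < e"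
    using separable_approximation[OF A sep] by blast
  have "\<forall>i s. \<exists>d. i \<in> I \<longrightarrow> s \<in> Q \<longrightarrow> d \<in> D \<and> adist A (v i s) d < e / 2"
    using app[OF v, of _ _ "e / 2"] e by (meson half_gt_zero)
  then obtain d where d: "\<And>i s. \<lbrakk>i \<in> I; s \<in> Q\<rbrakk> \<Longrightarrow> d i s \<in> D \<and> adist A (v i s) (d i s) < e / 2"
    by metis
  define T where "T i = restrict (d i) Q" for i
  have "countable (PiE Q (\<lambda>_. D))" using Q D by (intro countable_PiE) auto
  moreover have "T ` I \<subseteq> PiE Q (\<lambda>_. D)" using d by (auto simp: T_def)
  ultimately have "countable (T ` I)" by (rule countable_subset[rotated])
  then have "\<not> inj_on T I" using I countable_image_inj_on by blast
  then obtain i j where ij: "i \<in> I" "j \<in> I" "i \<noteq> j" "T i = T j" by (auto simp: inj_on_def)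
  have "adist A (v i s) (v j s) < e" if s: "s \<in> Q" for s
  proof -
    have eq: "d i s = d j s" using fun_cong[OF ij(4), of s] s by (simp add: T_def)
    have dc: "d i s \<in> carrier A" using d[OF ij(1) s] D by auto
    have "adist A (v i s) (v j s) \<le> adist A (v i s) (d i s) + adist A (d i s) (v j s)"
      using v ij s dc by (intro Met.triangle) auto
    also have "adist A (d i s) (v j s) = adist A (v j s) (d j s)" using eq Met.commute by simp
    finally show ?thesis using d[OF ij(1) s] d[OF ij(2) s] by linarith
  qed
  with ij show ?thesis by blast
qed

theorem theorem4:
  fixes \<Gamma> :: "'g monoid" and N :: "'i \<Rightarrow> 'g set" and I :: "'i set"
    and \<C> :: "(nat \<Rightarrow> 'g set \<Rightarrow> complex) set normed_star_algebra set"
  assumes "group \<Gamma>"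
    and "property_T \<Gamma>"
    and "uncountable I"
    and "\<And>\<alpha>. \<alpha> \<in> I \<Longrightarrow> N \<alpha> \<lhd> \<Gamma>"
    and "\<And>\<alpha> \<beta>. \<lbrakk>\<alpha> \<in> I; \<beta> \<in> I; \<alpha> \<noteq> \<beta>\<rbrakk> \<Longrightarrow> \<not> (\<Gamma> Mod N \<alpha>) \<cong> (\<Gamma> Mod N \<beta>)"
    and "\<And>\<alpha>. \<alpha> \<in> I \<Longrightarrow> simple_grp (\<Gamma> Mod N \<alpha>)"
    and "\<And>\<alpha>. \<alpha> \<in> I \<Longrightarrow> icc (\<Gamma> Mod N \<alpha>)"
    and "\<C> = {full_group_cstar (\<Gamma> Mod N \<alpha>) | \<alpha>. \<alpha> \<in> I} \<or>
         \<C> = {reduced_group_cstar (\<Gamma> Mod N \<alpha>) | \<alpha>. \<alpha> \<in> I}"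
  shows "\<not> (\<exists>A :: 'a normed_star_algebra. separable_algebra A \<and> complementary_universal A \<C>)"
proof
  assume "\<exists>A :: 'a normed_star_algebra. separable_algebra A \<and> complementary_universal A \<C>"
  then obtain A :: "'a normed_star_algebra" where sep: "separable_algebra A"
    and univ: "complementary_universal A \<C>" by blast
  have A: "unital_cstar_algebra A" using univ by (simp add: complementary_universal_def)
  interpret group \<Gamma> by fact
  have quot: "group (\<Gamma> Mod N \<alpha>)" if "\<alpha> \<in> I" for \<alpha>
    by (rule normal.factorgroup_is_group[OF assms(4)[OF that]])
  \<comment> \<open>From here on both choices of the class are treated at once, as completions for a
    family of norms.\<close>
  obtain nm where nm: "\<And>\<alpha>. \<alpha> \<in> I \<Longrightarrow> group_algebra_norm (\<Gamma> Mod N \<alpha>) (nm \<alpha>)"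
    and C: "\<C> = {completion (group_algebra (\<Gamma> Mod N \<alpha>) (nm \<alpha>)) | \<alpha>. \<alpha> \<in> I}"
  proof -
    assume *: "\<And>nm. (\<And>\<alpha>. \<alpha> \<in> I \<Longrightarrow> group_algebra_norm (\<Gamma> Mod N \<alpha>) (nm \<alpha>)) \<Longrightarrow>
      \<C> = {completion (group_algebra (\<Gamma> Mod N \<alpha>) (nm \<alpha>)) | \<alpha>. \<alpha> \<in> I} \<Longrightarrow> thesis"
    from assms(8) show thesis
    proof
      assume "\<C> = {full_group_cstar (\<Gamma> Mod N \<alpha>) | \<alpha>. \<alpha> \<in> I}"
      then show thesis
        by (intro *[of "\<lambda>\<alpha>. full_norm (\<Gamma> Mod N \<alpha>)"])
          (auto simp: full_group_cstar_def intro: group_algebra_norm_full quot)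
    next
      assume "\<C> = {reduced_group_cstar (\<Gamma> Mod N \<alpha>) | \<alpha>. \<alpha> \<in> I}"
      then show thesis
        by (intro *[of "\<lambda>\<alpha>. reduced_norm (\<Gamma> Mod N \<alpha>)"])
          (auto simp: reduced_group_cstar_def intro: group_algebra_norm_reduced quot)
    qed
  qed
  define B where "B \<alpha> = completion (group_algebra (\<Gamma> Mod N \<alpha>) (nm \<alpha>))" for \<alpha>
  have "\<forall>\<alpha>\<in>I. \<exists>\<psi> \<phi>. ucp (B \<alpha>) A \<psi> \<and> ucp A (B \<alpha>) \<phi> \<and> (\<forall>b\<in>carrier (B \<alpha>). \<phi> (\<psi> b) = b)"
    using univ unfolding complementary_universal_def C B_def by blast
  then obtain \<psi> \<phi> where \<psi>: "\<And>\<alpha>. \<alpha> \<in> I \<Longrightarrow> ucp (B \<alpha>) A (\<psi> \<alpha>)" and \<phi>: "\<And>\<alpha>. \<alpha> \<in> I \<Longrightarrow> ucp A (B \<alpha>) (\<phi> \<alpha>)"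
    and id: "\<And>\<alpha> b. \<lbrakk>\<alpha> \<in> I; b \<in> carrier (B \<alpha>)\<rbrakk> \<Longrightarrow> \<phi> \<alpha> (\<psi> \<alpha> b) = b"
    by metis
  define q where "q \<alpha> x = N \<alpha> #>\<^bsub>\<Gamma>\<^esub> x" for \<alpha> x
  have hom: "q \<alpha> \<in> hom \<Gamma> (\<Gamma> Mod N \<alpha>)" if "\<alpha> \<in> I" for \<alpha>
    using normal.r_coset_hom_Mod[OF assms(4)[OF that]] by (simp add: q_def[abs_def])
  have q_one: "q \<alpha> x = \<one>\<^bsub>\<Gamma> Mod N \<alpha>\<^esub> \<longleftrightarrow> x \<in> N \<alpha>" if "\<alpha> \<in> I" "x \<in> carrier \<Gamma>" for \<alpha> x
  proof -
    have "subgroup (N \<alpha>) \<Gamma>" using assms(4)[OF that(1)] by (rule normal_imp_subgroup)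
    then show ?thesis
      using coset_join1[of "N \<alpha>" x] coset_join2[of x "N \<alpha>"] that by (auto simp: q_def FactGroup_def)
  qed
  obtain Q C where Q: "finite Q" "Q \<subseteq> carrier \<Gamma>" "0 \<le> C"
    and kazhdan: "\<And>\<phi> h. \<lbrakk>\<phi> \<in> normalized_pd \<Gamma>; h \<in> carrier \<Gamma>\<rbrakk> \<Longrightarrow> 1 - Re (\<phi> h) \<le> C * (\<Sum>s\<in>Q. 1 - Re (\<phi> s))"
    using kazhdan_inequality[OF assms(1,2)] by blast
  \<comment> \<open>The 6 comes from \<open>ucp_coeff_bound\<close>, \<open>C\<close> and
    \<open>card Q\<close> from Kazhdan's inequality. The summand 1 makes the resulting bound
    strictly less than 1 and covers a vanishing product.\<close>
  define e where "e = 1 / (6 * C * card Q + 1)"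
  have pos: "6 * C * card Q + 1 > 0" using Q(3) by (simp add: add_nonneg_pos)
  then have e0: "e > 0" by (simp add: e_def)
  have e1: "C * (6 * e * card Q) < 1"
  proof -
    have "C * (6 * e * card Q) = (6 * C * card Q) / (6 * C * card Q + 1)" by (simp add: e_def)
    also have "\<dots> < 1" using pos by simp
    finally show ?thesis .
  qed
  define v where "v \<alpha> s = \<psi> \<alpha> (group_algebra_norm.unit_of (\<Gamma> Mod N \<alpha>) (nm \<alpha>) (q \<alpha> s))" for \<alpha> s
  have vA: "v \<alpha> s \<in> carrier A" if \<alpha>: "\<alpha> \<in> I" and s: "s \<in> Q" for \<alpha> s
  proof -
    have "q \<alpha> s \<in> carrier (\<Gamma> Mod N \<alpha>)" using hom[OF \<alpha>] s Q by (auto simp: hom_def)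
    then have "group_algebra_norm.unit_of (\<Gamma> Mod N \<alpha>) (nm \<alpha>) (q \<alpha> s) \<in> carrier (B \<alpha>)"
      unfolding B_def by (rule group_algebra_norm.unit_of_closed[OF nm[OF \<alpha>]])
    then show ?thesis using \<psi>[OF \<alpha>] unfolding v_def ucp_def complex_linear_map_def by blast
  qed
  have "\<exists>\<alpha>\<in>I. \<exists>\<beta>\<in>I. \<alpha> \<noteq> \<beta> \<and> (\<forall>s\<in>Q. adist A (v \<alpha> s) (v \<beta> s) < e)"
    by (rule uncountable_two_close[OF A sep assms(3) Q(1) _ e0]) (rule vA)
  then obtain \<alpha> \<beta> where \<alpha>: "\<alpha> \<in> I" and \<beta>: "\<beta> \<in> I" and ne: "\<alpha> \<noteq> \<beta>"
    and close: "\<And>s. s \<in> Q \<Longrightarrow> adist A (v \<alpha> s) (v \<beta> s) < e" by blast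
  have sub: "N \<delta> \<subseteq> N \<gamma>"
    if \<gamma>: "\<gamma> \<in> I" and \<delta>: "\<delta> \<in> I" and cl: "\<And>s. s \<in> Q \<Longrightarrow> adist A (v \<gamma> s) (v \<delta> s) < e" for \<gamma> \<delta>
  proof
    fix h assume h: "h \<in> N \<delta>"
    have hG: "h \<in> carrier \<Gamma>"
      using h subgroup.subset[OF normal_imp_subgroup[OF assms(4)[OF \<delta>]]] by blast
    have "q \<gamma> h = \<one>\<^bsub>\<Gamma> Mod N \<gamma>\<^esub>"
      by (rule kernel_subset[OF assms(1) nm[OF \<gamma>] nm[OF \<delta>] hom[OF \<gamma>] hom[OF \<delta>] A
            \<psi>[OF \<gamma>, unfolded B_def] \<phi>[OF \<gamma>, unfolded B_def] id[OF \<gamma>, unfolded B_def] \<psi>[OF \<delta>, unfolded B_def]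
            Q kazhdan cl[unfolded v_def] e1 hG])
        (use q_one[OF \<delta> hG] h in auto)
    then show "h \<in> N \<gamma>" using q_one[OF \<gamma> hG] by simp
  qed
  have "adist A (v \<beta> s) (v \<alpha> s) < e" if "s \<in> Q" for s
    using close[OF that] unital_cstar_algebra.metric_A[OF A] Metric_space.commute by metis
  then have "N \<alpha> = N \<beta>" using sub[OF \<alpha> \<beta> close] sub[OF \<beta> \<alpha>] by blast
  then have "(\<Gamma> Mod N \<alpha>) \<cong> (\<Gamma> Mod N \<beta>)" by (simp add: iso_refl)
  then show False using assms(5)[OF \<alpha> \<beta> ne] by blast
qed

end
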